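(* Let $G$ be a profinite group. Then $G$ is finite-by-pronilpotent (i.e. $G$ has a finite normal subgroup $N$ such that $G/N$ is pronilpotent) if and only if the set of coprime commutators of $G$ has cardinality less than $2^{\aleph_0}$.
   Context: All subgroups of profinite groups are closed and all homomorphisms continuous. For an element $x$ of a profinite group, $|x|$ denotes the order (a Steinitz number) of the procyclic subgroup $\overline{\langle x\rangle}$, and $\pi(x)$ the set of primes dividing $|x|$. A coprime commutator in a profinite group $G$ is an element of the form $[x,y]$ with $x,y\in G$ and $\pi(x)\cap\pi(y)=\emptyset$. *)

theory Defs
  imports "HOL-Analysis.Analysis" "HOL-Algebra.Algebra"
begin

definition totally_disconnected_space :: "'a topology \<Rightarrow> bool" where
  "totally_disconnected_space T \<longleftrightarrow>
     (\<forall>S. connectedin T S \<longrightarrow> (\<exists>a. S \<subseteq> {a}))"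

definition topological_group :: "('a, 'b) monoid_scheme \<Rightarrow> 'a topology \<Rightarrow> bool" where
  "topological_group G T \<longleftrightarrow>
     group G \<and> topspace T = carrier G \<and>
     continuous_map (prod_topology T T) T (\<lambda>(x, y). x \<otimes>\<^bsub>G\<^esub> y) \<and>
     continuous_map T T (\<lambda>x. inv\<^bsub>G\<^esub> x)"

definition profinite :: "('a, 'b) monoid_scheme \<Rightarrow> 'a topology \<Rightarrow> bool" where
  "profinite G T \<longleftrightarrow>
     topological_group G T \<and> compact_space T \<and> Hausdorff_space T \<and>
     totally_disconnected_space T"

definition quotient_group_topology ::
    "('a, 'b) monoid_scheme \<Rightarrow> 'a topology \<Rightarrow> 'a set \<Rightarrow> 'a set topology" where
  "quotient_group_topology G T N =
     topology (\<lambda>S. S \<subseteq> carrier (G Mod N) \<and> openin T (\<Union>S))"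

fun lower_central :: "('a, 'b) monoid_scheme \<Rightarrow> nat \<Rightarrow> 'a set" where
  "lower_central G 0 = carrier G"
| "lower_central G (Suc n) =
     generate G {inv\<^bsub>G\<^esub> x \<otimes>\<^bsub>G\<^esub> inv\<^bsub>G\<^esub> y \<otimes>\<^bsub>G\<^esub> x \<otimes>\<^bsub>G\<^esub> y
                 | x y. x \<in> lower_central G n \<and> y \<in> carrier G}"

definition nilpotent_group :: "('a, 'b) monoid_scheme \<Rightarrow> bool" where
  "nilpotent_group G \<longleftrightarrow> group G \<and> (\<exists>n. lower_central G n = {\<one>\<^bsub>G\<^esub>})"

text \<open>Pronilpotent: a profinite group all of whose continuous finite quotients
  \<open>G/U\<close> (\<open>U\<close> open normal) are nilpotent, i.e. an inverse limit of finite
  nilpotent groups.\<close>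
definition pronilpotent :: "('a, 'b) monoid_scheme \<Rightarrow> 'a topology \<Rightarrow> bool" where
  "pronilpotent G T \<longleftrightarrow>
     profinite G T \<and>
     (\<forall>U. U \<lhd> G \<and> openin T U \<longrightarrow> nilpotent_group (G Mod U))"

definition finite_by_pronilpotent :: "('a, 'b) monoid_scheme \<Rightarrow> 'a topology \<Rightarrow> bool" where
  "finite_by_pronilpotent G T \<longleftrightarrow>
     (\<exists>N. N \<lhd> G \<and> finite N \<and>
          pronilpotent (G Mod N) (quotient_group_topology G T N))"

definition procyclic :: "('a, 'b) monoid_scheme \<Rightarrow> 'a topology \<Rightarrow> 'a \<Rightarrow> 'a set" where
  "procyclic G T x = T closure_of (generate G {x})"

text \<open>\<open>\<pi>(x)\<close>: primes dividing the Steinitz number \<open>|x|\<close>, which is the lcm of the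
  indices of the open normal subgroups of the procyclic group generated by \<open>x\<close>;
  so \<open>p\<close> divides \<open>|x|\<close> iff it divides one of these indices.\<close>
definition prime_set :: "('a, 'b) monoid_scheme \<Rightarrow> 'a topology \<Rightarrow> 'a \<Rightarrow> nat set" where
  "prime_set G T x =
     {p. Factorial_Ring.prime p \<and>
         (\<exists>V. V \<lhd> (G\<lparr>carrier := procyclic G T x\<rparr>) \<and>
              openin (subtopology T (procyclic G T x)) V \<and>
              p dvd card (rcosets\<^bsub>G\<lparr>carrier := procyclic G T x\<rparr>\<^esub> V))}"

definition coprime_commutators :: "('a, 'b) monoid_scheme \<Rightarrow> 'a topology \<Rightarrow> 'a set" where
  "coprime_commutators G T =
     {inv\<^bsub>G\<^esub> x \<otimes>\<^bsub>G\<^esub> inv\<^bsub>G\<^esub> y \<otimes>\<^bsub>G\<^esub> x \<otimes>\<^bsub>G\<^esub> y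
      | x y. x \<in> carrier G \<and> y \<in> carrier G \<and> prime_set G T x \<inter> prime_set G T y = {}}"

end

theory Submission
  imports Defs
begin

text \<open>In a finite nilpotent group elements of coprime order commute. Hence if \<open>N\<close> is a finite
  normal subgroup with \<open>G/N\<close> pronilpotent, then every coprime commutator lies in \<open>N\<close>.

  Conversely, suppose there are fewer than continuum many coprime commutators. For a closed nonempty
  set of coprime pairs, the compact set of its commutators cannot be perfect, so it has an isolated
  point, and \<open>[x, y]\<close> is constant on the pairs in some box
  \<open>U x\<^sub>0 \<times> U y\<^sub>0\<close> with \<open>U\<close> open normal. Constancy on a box makes
  elements of \<open>U\<close> of coprime orders commute, first for two fixed disjoint sets of primes,
  then simultaneously for all coprime pairs in \<open>U\<close>, and after shrinking \<open>U\<close> every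
  \<open>x\<close> in \<open>G\<close> commutes with every \<open>v\<close> in \<open>U\<close> of order coprime to
  that of \<open>x\<close>. Then for a prime \<open>p\<close> the commutator of a \<open>p\<close>-element and
  a \<open>p'\<close>-element depends only on their cosets modulo \<open>U\<close>, and is trivial unless
  \<open>p\<close> divides the index of \<open>U\<close>. This gives a finite normal set of commutators, which
  a transfer argument shows to be torsion. By Dietzmann's lemma it generates a finite normal subgroup
  \<open>N\<close>; in finite quotients of \<open>G/N\<close> elements of coprime order commute, so
  these quotients are nilpotent.\<close>

section \<open>Compact sets without isolated points\<close>

text \<open>The gap between countable and continuum is harmless: a Cantor scheme in a compact set
  without isolated points already yields a point for every set of natural numbers. The main obstacle
  is uniformity. Two fixed sets of primes give an open normal subgroup that depends on them, there
  are infinitely many ways to divide up the primes, and only finite intersections of open subgroups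
  stay open. Finite index comes to the rescue: an element whose order avoids the primes of the index
  of \<open>U\<close> lies in \<open>U\<close>, so only finitely many primes need separate
  treatment. A second obstacle is that constancy on a box speaks about quotients
  \<open>y y\<^sub>0\<^sup>-\<^sup>1\<close>, which are not the \<tau>-elements of \<open>U\<close>
  that are wanted; \<open>coset_elements_mem\<close> bridges this. Torsion comes from reading one
  commutator in two ways. If \<open>x\<close> is a \<open>p\<close>-element and \<open>y\<close> a
  \<open>p'\<close>-element, then \<open>[x, y]\<close> is a product of the two
  \<open>p\<close>-elements \<open>x\<^sup>-\<^sup>1\<close> and \<open>x\<^sup>y\<close>, and also
  a product of two \<open>p'\<close>-elements. Transfer bounds the \<open>p'\<close>-part of a power
  of it by the first reading and the \<open>p\<close>-part by the second.\<close>

lemma perfect_compact_lepoll: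
  fixes T :: "'a topology"
  assumes comp: "compact_space T" and Y: "closedin T Y" "Y \<noteq> {}"
    and sep: "\<And>x y. \<lbrakk>x \<in> Y; y \<in> Y; x \<noteq> y\<rbrakk> \<Longrightarrow> \<exists>D. openin T D \<and> closedin T D \<and> x \<in> D \<and> y \<notin> D"
    and perf: "\<And>A x. \<lbrakk>openin T A; x \<in> A; x \<in> Y\<rbrakk> \<Longrightarrow> \<exists>y\<in>Y. y \<in> A \<and> y \<noteq> x"
  shows "lepoll (UNIV :: nat set set) Y"
proof -
  define good where "good C \<longleftrightarrow> openin T C \<and> closedin T C \<and> C \<inter> Y \<noteq> {}" for C
  have "\<exists>D. good (C \<inter> D) \<and> good (C - D)" if C: "good C" for C
  proof -
    from C obtain x where x: "x \<in> C" "x \<in> Y" by (auto simp: good_def)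
    have Co: "openin T C" "closedin T C" using C by (simp_all add: good_def)
    obtain y where y: "y \<in> Y" "y \<in> C" "y \<noteq> x" using perf[OF Co(1) x] by auto
    obtain D where D: "openin T D" "closedin T D" "x \<in> D" "y \<notin> D" using sep[OF x(2) y(1)] y(3) by auto
    have ne: "C \<inter> D \<inter> Y \<noteq> {}" "(C - D) \<inter> Y \<noteq> {}" using D x y by auto
    have "good (C \<inter> D)" "good (C - D)"
      unfolding good_def using ne Co D(1,2) by (simp_all add: openin_Int closedin_Int openin_diff closedin_diff)
    then show ?thesis by blast
  qed
  then obtain h where h: "\<And>C. good C \<Longrightarrow> good (C \<inter> h C) \<and> good (C - h C)" by metis
  \<comment> \<open>A Cantor scheme: the clopen sets \<open>B S n\<close> shrink along the branch
    prescribed by \<open>S\<close>, passing at level \<open>n\<close> to the half inside or outside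
    \<open>h C\<close>. Compactness puts a point of \<open>Y\<close> on every branch.\<close>
  define step where "step S n C = (if n \<in> S then C \<inter> h C else C - h C)" for S :: "nat set" and n C
  define B where "B S = rec_nat (topspace T) (step S)" for S
  have B0: "B S 0 = topspace T" and BS: "B S (Suc n) = step S n (B S n)" for S n
    by (simp_all add: B_def)
  have gB: "good (B S n)" for S n
  proof (induction n)
    case 0
    have "topspace T \<inter> Y \<noteq> {}" using Y closedin_subset[OF Y(1)] by auto
    then show ?case by (simp add: B0 good_def)
  next
    case (Suc n) then show ?case using h by (simp add: BS step_def)
  qed
  have "\<exists>x\<in>Y. \<forall>n. x \<in> B S n" for S
  proof -
    have "decseq (\<lambda>n. B S n \<inter> Y)"
      by (rule decseq_SucI) (auto simp: BS step_def)
    moreover have "closedin T (B S n \<inter> Y)" "B S n \<inter> Y \<noteq> {}" for n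
      using gB[of S n] Y(1) by (simp_all add: good_def closedin_Int)
    ultimately have "(\<Inter>n. B S n \<inter> Y) \<noteq> {}"
      using compact_space_imp_nest[OF comp, of "\<lambda>n. B S n \<inter> Y"] by blast
    then show ?thesis by blast
  qed
  then obtain f where f: "\<And>S. f S \<in> Y" "\<And>S n. f S \<in> B S n" by metis
  have "inj f"
  proof (rule injI, rule ccontr)
    fix S S' assume eq: "f S = f S'" and "S \<noteq> S'"
    then have ex: "\<exists>n. (n \<in> S) \<noteq> (n \<in> S')" by blast
    \<comment> \<open>Up to the first index at which \<open>S\<close> and \<open>S'\<close> differ
      the two branches agree; there they enter complementary halves of the same set.\<close>
    define n where "n = (LEAST n. (n \<in> S) \<noteq> (n \<in> S'))"
    have n: "(n \<in> S) \<noteq> (n \<in> S')" using LeastI_ex[OF ex] by (simp add: n_def)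
    have less: "(m \<in> S) = (m \<in> S')" if "m < n" for m
      using not_less_Least[of m "\<lambda>n. (n \<in> S) \<noteq> (n \<in> S')"] that unfolding n_def by simp
    have "m \<le> n \<Longrightarrow> B S m = B S' m" for m
      by (induction m) (auto simp: B0 BS step_def less)
    then have Beq: "B S' n = B S n" by simp
    have "f S \<in> step S n (B S n)" using f(2)[of S "Suc n"] BS by metis
    moreover have "f S \<in> step S' n (B S n)" using f(2)[of S' "Suc n"] BS[of S' n] eq Beq by metis
    ultimately show False using n unfolding step_def by (cases "n \<in> S") auto
  qed
  with f show ?thesis by (auto simp: lepoll_def intro!: exI[of _ f])
qed

section \<open>Conjugation, commutation and cosets in abstract groups\<close>

lemma (in group) inv_mult_cancel: "x \<in> carrier G \<Longrightarrow> y \<in> carrier G \<Longrightarrow> inv x \<otimes> (x \<otimes> y) = y"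
  by (simp add: m_assoc[symmetric])

lemma (in group) mult_inv_cancel: "x \<in> carrier G \<Longrightarrow> y \<in> carrier G \<Longrightarrow> x \<otimes> (inv x \<otimes> y) = y"
  by (simp add: m_assoc[symmetric])

lemmas (in group) gsimps = m_assoc inv_mult_group inv_mult_cancel mult_inv_cancel

lemma (in group) commute_mult:
  assumes "a \<otimes> s = s \<otimes> a" "b \<otimes> s = s \<otimes> b" "a \<in> carrier G" "b \<in> carrier G" "s \<in> carrier G"
  shows "a \<otimes> b \<otimes> s = s \<otimes> (a \<otimes> b)"
proof -
  have "a \<otimes> b \<otimes> s = a \<otimes> (s \<otimes> b)" using assms by (simp add: m_assoc)
  also have "\<dots> = s \<otimes> a \<otimes> b" using assms by (simp add: m_assoc[symmetric])
  finally show ?thesis using assms by (simp add: m_assoc)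
qed

lemma (in group) commute_inv:
  assumes "a \<otimes> s = s \<otimes> a" "a \<in> carrier G" "s \<in> carrier G"
  shows "inv a \<otimes> s = s \<otimes> inv a"
proof -
  have "inv a \<otimes> s = inv a \<otimes> (s \<otimes> a) \<otimes> inv a" using assms(2,3) by (simp add: m_assoc)
  also have "\<dots> = s \<otimes> inv a" using assms(2,3) by (simp add: assms(1)[symmetric] inv_mult_cancel)
  finally show ?thesis .
qed

lemma (in group) conj_mem:
  assumes "W \<lhd> G" "w \<in> W" "x \<in> carrier G"
  shows "x \<otimes> w \<otimes> inv x \<in> W" "inv x \<otimes> w \<otimes> x \<in> W"
  using normal.inv_op_closed1[OF assms(1,3,2)] normal.inv_op_closed2[OF assms(1,3,2)] by simp_all

lemma (in group) rcoset_iff: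
  assumes "subgroup W G" "x \<in> carrier G" "y \<in> carrier G"
  shows "y \<in> W #> x \<longleftrightarrow> y \<otimes> inv x \<in> W"
  by (rule subgroup.rcos_module[OF assms(1) is_group assms(2,3)])

lemma (in group) rcoset_eq_Collect:
  assumes "subgroup W G" "x \<in> carrier G"
  shows "W #> x = {y \<in> carrier G. y \<otimes> inv x \<in> W}"
  using rcoset_iff[OF assms] r_coset_subset_G[OF subgroup.subset[OF assms(1)] assms(2)] by auto

lemma (in group) rcoset_eq_iff:
  assumes "subgroup W G" "x \<in> carrier G" "y \<in> carrier G"
  shows "W #> x = W #> y \<longleftrightarrow> x \<otimes> inv y \<in> W"
proof
  assume "W #> x = W #> y"
  then have "x \<in> W #> y" using rcos_self[OF assms(2,1)] by simp
  then show "x \<otimes> inv y \<in> W" using rcoset_iff[OF assms(1,3,2)] by simp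
next
  assume "x \<otimes> inv y \<in> W"
  then have "x \<in> W #> y" using rcoset_iff[OF assms(1,3,2)] by simp
  then show "W #> x = W #> y" using repr_independence[OF _ assms(3,1)] by simp
qed

text \<open>The set is the normal core of \<open>H\<close>. In \<open>ex_onormal\<close> it turns an
  open subgroup into an open normal one.\<close>

lemma (in group) subgroup_conj_core:
  assumes "subgroup H G"
  shows "{v \<in> carrier G. \<forall>g\<in>carrier G. g \<otimes> v \<otimes> inv g \<in> H} \<lhd> G"
proof (rule normal_invI)
  interpret H: subgroup H G by (rule assms)
  show "subgroup {v \<in> carrier G. \<forall>g\<in>carrier G. g \<otimes> v \<otimes> inv g \<in> H} G"
  proof (rule subgroupI)
    show "{v \<in> carrier G. \<forall>g\<in>carrier G. g \<otimes> v \<otimes> inv g \<in> H} \<noteq> {}"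
      using H.one_closed by (auto intro!: exI[of _ \<one>])
  next
    fix a assume a: "a \<in> {v \<in> carrier G. \<forall>g\<in>carrier G. g \<otimes> v \<otimes> inv g \<in> H}"
    have "g \<otimes> inv a \<otimes> inv g = inv (g \<otimes> a \<otimes> inv g)" if "g \<in> carrier G" for g
      using a that by (simp add: gsimps)
    then show "inv a \<in> {v \<in> carrier G. \<forall>g\<in>carrier G. g \<otimes> v \<otimes> inv g \<in> H}"
      using a by (auto intro: H.m_inv_closed)
  next
    fix a b assume a: "a \<in> {v \<in> carrier G. \<forall>g\<in>carrier G. g \<otimes> v \<otimes> inv g \<in> H}"
      and b: "b \<in> {v \<in> carrier G. \<forall>g\<in>carrier G. g \<otimes> v \<otimes> inv g \<in> H}"
    have "g \<otimes> (a \<otimes> b) \<otimes> inv g = (g \<otimes> a \<otimes> inv g) \<otimes> (g \<otimes> b \<otimes> inv g)" if "g \<in> carrier G" for g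
      using a b that by (simp add: gsimps)
    then show "a \<otimes> b \<in> {v \<in> carrier G. \<forall>g\<in>carrier G. g \<otimes> v \<otimes> inv g \<in> H}"
      using a b by auto
  qed auto
next
  fix x h assume x: "x \<in> carrier G" and h: "h \<in> {v \<in> carrier G. \<forall>g\<in>carrier G. g \<otimes> v \<otimes> inv g \<in> H}"
  have "g \<otimes> (x \<otimes> h \<otimes> inv x) \<otimes> inv g = (g \<otimes> x) \<otimes> h \<otimes> inv (g \<otimes> x)" if "g \<in> carrier G" for g
    using x h that by (simp add: gsimps)
  then show "x \<otimes> h \<otimes> inv x \<in> {v \<in> carrier G. \<forall>g\<in>carrier G. g \<otimes> v \<otimes> inv g \<in> H}"
    using x h by auto
qed

section \<open>The topology of a profinite group\<close>

locale profinite_group = group G for G (structure) +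
  fixes T
  assumes prof: "profinite G T"
begin

lemma topsp: "topspace T = carrier G"
  and comp: "compact_space T" and haus: "Hausdorff_space T" and totdisc: "totally_disconnected_space T"
  and cont_mult0: "continuous_map (prod_topology T T) T (\<lambda>(x, y). x \<otimes> y)"
  and cont_inv0: "continuous_map T T (\<lambda>x. inv x)"
  using prof by (auto simp: profinite_def topological_group_def)

lemma cont_mult:
  assumes "continuous_map Y T f" "continuous_map Y T g"
  shows "continuous_map Y T (\<lambda>x. f x \<otimes> g x)"
  using continuous_map_compose[OF continuous_map_pairedI[OF assms] cont_mult0] by (simp add: o_def)

lemma cont_inv:
  assumes "continuous_map Y T f"
  shows "continuous_map Y T (\<lambda>x. inv (f x))"
  using continuous_map_compose[OF assms cont_inv0] by (simp add: o_def)

lemma cont_const: "c \<in> carrier G \<Longrightarrow> continuous_map Y T (\<lambda>x. c)"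
  by (simp add: topsp)

lemmas cont_intros = cont_mult cont_inv cont_const continuous_map_id[unfolded id_def]
  continuous_map_fst continuous_map_snd

lemma openin_preimage:
  assumes "continuous_map T T f" "openin T A"
  shows "openin T {x \<in> carrier G. f x \<in> A}"
  using openin_continuous_map_preimage[OF assms] by (simp add: topsp)

lemma closedin_preimage:
  assumes "continuous_map T T f" "closedin T A"
  shows "closedin T {x \<in> carrier G. f x \<in> A}"
  using closedin_continuous_map_preimage[OF assms] by (simp add: topsp)

lemma closedin_equal:
  assumes "continuous_map T T f" "continuous_map T T g"
  shows "closedin T {x \<in> carrier G. f x = g x}"
  using closedin_continuous_maps_eq[OF haus assms] by (simp add: topsp)

definition onormal :: "'a set \<Rightarrow> bool" where
  "onormal W \<longleftrightarrow> W \<lhd> G \<and> openin T W"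

definition csubgroup :: "'a set \<Rightarrow> bool" where
  "csubgroup C \<longleftrightarrow> subgroup C G \<and> closedin T C"

lemma onormalD:
  assumes "onormal W"
  shows "W \<lhd> G" "subgroup W G" "openin T W" "W \<subseteq> carrier G"
  using assms normal_imp_subgroup[of W G] subgroup.subset[of W G] unfolding onormal_def by blast+

lemma csubgroupD:
  assumes "csubgroup W"
  shows "subgroup W G" "closedin T W" "W \<subseteq> carrier G"
  using assms subgroup.subset[of W G] unfolding csubgroup_def by blast+

lemma openin_rcoset:
  assumes "subgroup W G" "openin T W" "x \<in> carrier G"
  shows "openin T (W #> x)"
  unfolding rcoset_eq_Collect[OF assms(1,3)]
  by (intro openin_preimage assms cont_intros) (use assms in auto)

text \<open>The coset of a point outside \<open>W\<close> is an open neighbourhood that misses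
  \<open>W\<close>.\<close>

lemma open_subgroup_closed:
  assumes "subgroup W G" "openin T W"
  shows "closedin T W"
proof -
  have "openin T (carrier G - W)"
  proof (rule openin_subopen[THEN iffD2], rule ballI)
    fix x assume x: "x \<in> carrier G - W"
    have "False" if y: "y \<in> W #> x" "y \<in> W" for y
    proof -
      have yG: "y \<in> carrier G" "y \<otimes> inv x \<in> W"
        using y x rcoset_eq_Collect[OF assms(1), of x] by auto
      then have "inv (y \<otimes> inv x) \<otimes> y \<in> W"
        using y assms(1) by (simp add: subgroup.m_closed subgroup.m_inv_closed)
      then show False using x yG by (simp add: gsimps)
    qed
    then have "(W #> x) \<inter> W = {}" by blast
    moreover have "W #> x \<subseteq> carrier G" "x \<in> W #> x" using x assms(1)
      by (simp_all add: rcos_self r_coset_subset_G subgroup.subset)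
    ultimately show "\<exists>U. openin T U \<and> x \<in> U \<and> U \<subseteq> carrier G - W"
      using openin_rcoset[OF assms] x by blast
  qed
  then show ?thesis using assms(1) by (simp add: closedin_def topsp subgroup.subset)
qed

lemma onormal_csubgroup: "onormal W \<Longrightarrow> csubgroup W"
  by (simp add: csubgroup_def onormalD open_subgroup_closed)

lemma onormal_Int: "onormal W \<Longrightarrow> onormal W' \<Longrightarrow> onormal (W \<inter> W')"
  by (auto simp: onormal_def normal_subgroup_intersect)

lemma onormal_carrier: "onormal (carrier G)"
  using normal_self openin_topspace[of T] by (simp add: onormal_def topsp)

text \<open>Cosets are open and pairwise disjoint, so a finite subcover must already contain all of
  them.\<close>

lemma finite_rcosets:
  assumes "onormal W"
  shows "finite (rcosets W)"
proof -
  have sub: "subgroup W G" "openin T W" using assms onormalD by auto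
  have "\<exists>\<F>. finite \<F> \<and> \<F> \<subseteq> rcosets W \<and> carrier G \<subseteq> \<Union>\<F>"
    using comp[unfolded compact_space_alt, rule_format, of "rcosets W"] sub rcosets_part_G[OF sub(1)]
    by (auto simp: topsp RCOSETS_def intro: openin_rcoset)
  then obtain F where F: "finite F" "F \<subseteq> rcosets W" "carrier G \<subseteq> \<Union>F" by blast
  have "rcosets W \<subseteq> F"
  proof
    fix R assume R: "R \<in> rcosets W"
    then obtain x where x: "x \<in> carrier G" "R = W #> x" by (auto simp: RCOSETS_def)
    then have "x \<in> R" using rcos_self sub by blast
    moreover obtain S where S: "S \<in> F" "x \<in> S" using F x by blast
    ultimately have "R = S" using rcos_disjoint[OF sub(1)] R F
      unfolding pairwise_def disjnt_def by blast
    then show "R \<in> F" using S by simp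
  qed
  then show ?thesis using F finite_subset by blast
qed

text \<open>Components and quasi-components agree in a compact Hausdorff space. If no clopen
  neighbourhood of \<open>a\<close> fits into \<open>A\<close>, compactness provides a point outside
  \<open>A\<close> in the quasi-component of \<open>a\<close>, against total
  disconnectedness.\<close>

lemma clopen_nbhd:
  assumes "openin T A" "a \<in> A"
  shows "\<exists>K. openin T K \<and> closedin T K \<and> a \<in> K \<and> K \<subseteq> A"
proof (rule ccontr)
  assume no: "\<not> ?thesis"
  define \<U> where "\<U> = {K - A |K. openin T K \<and> closedin T K \<and> a \<in> K}"
  have aG: "a \<in> carrier G" using assms openin_subset topsp by blast
  have "\<Inter>\<U> \<noteq> {}"
  proof (rule compact_space_fip[THEN iffD1, OF comp, rule_format], intro conjI ballI allI impI)
    fix C assume "C \<in> \<U>" then show "closedin T C" using assms by (auto simp: \<U>_def intro: closedin_diff)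
  next
    fix \<F> assume "finite \<F> \<and> \<F> \<subseteq> \<U>"
    then have "finite \<F>" "\<F> \<subseteq> \<U>" by auto
    then have "\<exists>K. openin T K \<and> closedin T K \<and> a \<in> K \<and> K - A \<subseteq> \<Inter>\<F>"
    proof (induction rule: finite_induct)
      case empty
      show ?case unfolding topsp[symmetric] using aG topsp openin_topspace[of T] closedin_topspace[of T] by (intro exI[of _ "carrier G"]) simp
    next
      case (insert F \<F>)
      then obtain K where K: "openin T K" "closedin T K" "a \<in> K" "K - A \<subseteq> \<Inter>\<F>" by blast
      obtain L where L: "openin T L" "closedin T L" "a \<in> L" "F = L - A"
        using insert by (auto simp: \<U>_def)
      show ?case using K L by (intro exI[of _ "K \<inter> L"]) (auto)
    qed
    then show "\<Inter>\<F> \<noteq> {}" using no by blast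
  qed
  then obtain b where b: "b \<in> \<Inter>\<U>" by blast
  have U0: "carrier G - A \<in> \<U>" using aG topsp unfolding \<U>_def
    using openin_topspace[of T] closedin_topspace[of T] by auto
  then have bA: "b \<notin> A" "b \<in> carrier G" using b by auto
  have "quasi_component_of T a b"
    unfolding quasi_component_of using aG bA b by (auto simp: topsp \<U>_def)
  then have "b \<in> connected_component_of_set T a"
    using quasi_eq_connected_component_of[of T] comp haus by auto
  then have "{a, b} \<subseteq> connected_component_of_set T a"
    using aG by (auto simp: connected_component_of_refl topsp)
  moreover have "connectedin T (connected_component_of_set T a)"
    by (rule connectedin_connected_component_of)
  ultimately have "a = b" using totdisc unfolding totally_disconnected_space_def by blast
  then show False using assms bA by blast
qed

text \<open>A form of the tube lemma: the complement is the projection of a closed set along a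
  compact factor, hence closed.\<close>

lemma openin_forall:
  assumes "closedin T K" "continuous_map (prod_topology T T) T f" "openin T A"
  shows "openin T {v \<in> carrier G. \<forall>k\<in>K. f (k, v) \<in> A}"
proof -
  have KG: "K \<subseteq> carrier G" using assms(1) closedin_subset topsp by blast
  define S where "S = {p \<in> topspace (prod_topology T T). f p \<in> carrier G - A} \<inter> (K \<times> carrier G)"
  have "closedin T (carrier G - A)"
    using assms(3) closedin_diff[OF closedin_topspace[of T]] by (simp add: topsp)
  then have "closedin (prod_topology T T) {p \<in> topspace (prod_topology T T). f p \<in> carrier G - A}"
    by (rule closedin_continuous_map_preimage[OF assms(2)])
  moreover have "closedin (prod_topology T T) (K \<times> carrier G)"
    using assms(1) closedin_topspace[of T] by (simp add: closedin_prod_Times_iff topsp)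
  ultimately have "closedin (prod_topology T T) S"
    unfolding S_def by (rule closedin_Int)
  then have "closedin T (snd ` S)"
    using closed_map_snd[OF comp, of T] unfolding closed_map_def by simp
  moreover have "{v \<in> carrier G. \<forall>k\<in>K. f (k, v) \<in> A} = carrier G - snd ` S"
  proof -
    have fG: "f (k, v) \<in> carrier G" if "k \<in> K" "v \<in> carrier G" for k v
      using continuous_map_image_subset_topspace[OF assms(2)] that KG by (auto simp: topsp)
    have "v \<in> snd ` S \<longleftrightarrow> v \<in> carrier G \<and> (\<exists>k\<in>K. f (k, v) \<notin> A)" for v
    proof
      assume "v \<in> snd ` S" then show "v \<in> carrier G \<and> (\<exists>k\<in>K. f (k, v) \<notin> A)"
        by (auto simp: S_def)
    next
      assume v: "v \<in> carrier G \<and> (\<exists>k\<in>K. f (k, v) \<notin> A)"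
      then obtain k where k: "k \<in> K" "f (k, v) \<notin> A" by auto
      then have "(k, v) \<in> S" using v KG fG by (auto simp: S_def topsp)
      then show "v \<in> snd ` S" by (rule rev_image_eqI) simp
    qed
    then show ?thesis by auto
  qed
  ultimately show ?thesis using openin_diff[OF openin_topspace[of T]] by (simp add: topsp)
qed

lemma ex_onormal:
  assumes "openin T A" "\<one> \<in> A"
  shows "\<exists>W. onormal W \<and> W \<subseteq> A"
proof -
  obtain K where K: "openin T K" "closedin T K" "\<one> \<in> K" "K \<subseteq> A"
    using clopen_nbhd[OF assms] by blast
  have KG: "K \<subseteq> carrier G" using K closedin_subset topsp by blast
  \<comment> \<open>This is the set of \<open>v\<close> with \<open>K v = K\<close>. It is an open
    subgroup because \<open>K\<close> is compact and open, and it lies in \<open>K\<close> because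
    \<open>\<one> \<in> K\<close>.\<close>
  define H where "H = {v \<in> carrier G. \<forall>k\<in>K. k \<otimes> v \<in> K} \<inter> {v \<in> carrier G. \<forall>k\<in>K. k \<otimes> inv v \<in> K}"
  have 1: "openin T {v \<in> carrier G. \<forall>k\<in>K. k \<otimes> v \<in> K}"
    using openin_forall[OF K(2) _ K(1), of "\<lambda>p. fst p \<otimes> snd p"] cont_mult[OF continuous_map_fst continuous_map_snd]
    by simp
  have 2: "openin T {v \<in> carrier G. \<forall>k\<in>K. k \<otimes> inv v \<in> K}"
    using openin_forall[OF K(2) _ K(1), of "\<lambda>p. fst p \<otimes> inv (snd p)"]
      cont_mult[OF continuous_map_fst cont_inv[OF continuous_map_snd]]
    by simp
  have oH: "openin T H" unfolding H_def using 1 2 by blast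
  have HK: "H \<subseteq> K" using K(3) by (force simp: H_def)
  have sH: "subgroup H G"
  proof (rule subgroupI)
    show "H \<noteq> {}" using KG by (auto simp: H_def subset_iff intro!: exI[of _ \<one>])
  next
    fix a b assume a: "a \<in> H" and b: "b \<in> H"
    have "k \<otimes> (a \<otimes> b) = k \<otimes> a \<otimes> b" "k \<otimes> inv (a \<otimes> b) = k \<otimes> inv b \<otimes> inv a" if "k \<in> K" for k
      using that KG a b by (auto simp: H_def gsimps subset_iff)
    then show "a \<otimes> b \<in> H" using a b by (auto simp: H_def)
  qed (auto simp: H_def)
  define W where "W = {v \<in> carrier G. \<forall>g\<in>carrier G. g \<otimes> v \<otimes> inv g \<in> H}"
  have "W \<lhd> G" unfolding W_def by (rule subgroup_conj_core[OF sH])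
  moreover have "openin T W" unfolding W_def
    using openin_forall[OF closedin_topspace[of T, unfolded topsp] _ oH, of "\<lambda>p. fst p \<otimes> snd p \<otimes> inv (fst p)"]
      cont_mult[OF cont_mult[OF continuous_map_fst continuous_map_snd] cont_inv[OF continuous_map_fst]]
    by simp
  moreover have "W \<subseteq> A" 
  proof
    fix v assume "v \<in> W"
    then have "v \<in> carrier G" "\<one> \<otimes> v \<otimes> inv \<one> \<in> H" unfolding W_def by blast+
    then show "v \<in> A" using HK K(4) by auto
  qed
  ultimately show ?thesis unfolding onormal_def by blast
qed

lemma ex_onormal_rcoset:
  assumes "openin T A" "a \<in> A"
  shows "\<exists>W. onormal W \<and> W #> a \<subseteq> A"
proof -
  have a: "a \<in> carrier G" using assms openin_subset topsp by blast
  have "openin T {x \<in> carrier G. x \<otimes> a \<in> A}"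
    by (intro openin_preimage cont_intros a assms)
  then obtain W where W: "onormal W" "W \<subseteq> {x \<in> carrier G. x \<otimes> a \<in> A}"
    using ex_onormal[of "{x \<in> carrier G. x \<otimes> a \<in> A}"] a assms by auto
  then show ?thesis by (auto simp: r_coset_def)
qed

text \<open>Cosets of open normal subgroups form a base of the topology, so membership in a closed
  set can be tested modulo each of them. This reduces many later claims to arithmetic in finite
  quotients.\<close>

lemma closedin_memI:
  assumes "closedin T C" "x \<in> carrier G"
    and "\<And>W. onormal W \<Longrightarrow> \<exists>y\<in>C. y \<otimes> inv x \<in> W"
  shows "x \<in> C"
proof (rule ccontr)
  assume "x \<notin> C"
  then have "x \<in> carrier G - C" "openin T (carrier G - C)"
    using assms by (auto simp: closedin_def topsp)
  then obtain W where W: "onormal W" "W #> x \<subseteq> carrier G - C"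
    using ex_onormal_rcoset[of "carrier G - C" x] by auto
  obtain y where y: "y \<in> C" "y \<otimes> inv x \<in> W" using assms(3)[OF W(1)] by blast
  have "y \<in> carrier G" using y(1) closedin_subset[OF assms(1)] topsp by auto
  then have "y \<in> W #> x" using y(2) rcoset_iff[OF onormalD(2)[OF W(1)] assms(2)] by simp
  then show False using W(2) y(1) by auto
qed

lemma onormal_eq_one:
  assumes "x \<in> carrier G" "\<And>W. onormal W \<Longrightarrow> x \<in> W"
  shows "x = \<one>"
proof -
  have "closedin T {\<one>}" using haus by (metis closedin_Hausdorff_sing_eq one_closed topsp)
  then have "x \<in> {\<one>}"
  proof (rule closedin_memI[OF _ assms(1)])
    fix W assume "onormal W"
    then have "inv x \<in> W" using assms(2) subgroup.m_inv_closed[OF onormalD(2)] by simp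
    then show "\<exists>y\<in>{\<one>}. y \<otimes> inv x \<in> W" using assms(1) by simp
  qed
  then show ?thesis by simp
qed

text \<open>Commutation claims are later phrased as membership in such a centralizer, so that the
  results on closed subgroups apply. It is closed as an intersection of equalizers in a Hausdorff
  space.\<close>

lemma centralizer_csubgroup:
  assumes "S \<subseteq> carrier G"
  shows "csubgroup {c \<in> carrier G. \<forall>s\<in>S. c \<otimes> s = s \<otimes> c}"
proof -
  have eq: "{c \<in> carrier G. \<forall>s\<in>S. c \<otimes> s = s \<otimes> c}
      = \<Inter> (insert (carrier G) ((\<lambda>s. {c \<in> carrier G. c \<otimes> s = s \<otimes> c}) ` S))" by auto
  have "closedin T {c \<in> carrier G. \<forall>s\<in>S. c \<otimes> s = s \<otimes> c}"
    unfolding eq using assms closedin_topspace[of T, unfolded topsp]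
    by (intro closedin_Inter) (auto intro!: closedin_equal cont_intros)
  moreover have "subgroup {c \<in> carrier G. \<forall>s\<in>S. c \<otimes> s = s \<otimes> c} G"
  proof (rule subgroupI)
    fix a b assume a: "a \<in> {c \<in> carrier G. \<forall>s\<in>S. c \<otimes> s = s \<otimes> c}"
      and b: "b \<in> {c \<in> carrier G. \<forall>s\<in>S. c \<otimes> s = s \<otimes> c}"
    have "a \<otimes> b \<otimes> s = s \<otimes> (a \<otimes> b)" if "s \<in> S" for s
      using a b that assms by (auto intro!: commute_mult)
    then show "a \<otimes> b \<in> {c \<in> carrier G. \<forall>s\<in>S. c \<otimes> s = s \<otimes> c}" using a b by auto
  next
    fix a assume a: "a \<in> {c \<in> carrier G. \<forall>s\<in>S. c \<otimes> s = s \<otimes> c}"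
    have "inv a \<otimes> s = s \<otimes> inv a" if "s \<in> S" for s
      using a that assms by (auto intro!: commute_inv)
    then show "inv a \<in> {c \<in> carrier G. \<forall>s\<in>S. c \<otimes> s = s \<otimes> c}" using a by auto
  next
    show "{c \<in> carrier G. \<forall>s\<in>S. c \<otimes> s = s \<otimes> c} \<noteq> {}" using assms by (auto intro!: exI[of _ \<one>])
  qed auto
  ultimately show ?thesis by (simp add: csubgroup_def)
qed

end

section \<open>The primes dividing the order of an element\<close>

lemma coprime_prime_factors:
  fixes m n :: nat
  assumes "m > 0" "n > 0" "prime_factors m \<inter> prime_factors n = {}"
  shows "coprime m n"
proof (rule ccontr)
  assume "\<not> coprime m n"
  then obtain p where p: "Factorial_Ring.prime p" "p dvd gcd m n"
    using prime_factor_nat[of "gcd m n"] by (auto simp: coprime_iff_gcd_eq_1)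
  then have "p \<in> prime_factors m" "p \<in> prime_factors n"
    using assms(1,2) by (simp_all add: in_prime_factors_iff)
  then show False using assms(3) by auto
qed

text \<open>Bezout with natural coefficients can be used directly in exponents:
  \<open>x [^] (m * u)\<close> is \<open>x\<close> times a power of \<open>x [^] n\<close>.\<close>

lemma ex_linear_combination:
  fixes m n :: nat
  assumes "coprime m n" "m > 0"
  shows "\<exists>u v. m * u = 1 + n * v"
  using bezout_nat[of m n] assms by (auto simp: algebra_simps)

text \<open>\<open>r\<close> and \<open>s\<close> are the \<sigma>-part and the \<sigma>'-part of
  \<open>n\<close>, collected one prime at a time.\<close>

lemma factor_by_primes:
  fixes n :: nat
  assumes "n > 0"
  shows "\<exists>r s. n = r * s \<and> prime_factors r \<subseteq> \<sigma> \<and> prime_factors s \<inter> \<sigma> = {}"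
  using assms
proof (induction n rule: prime_divisors_induct)
  case (unit x)
  then show ?case by (intro exI[of _ 1]) auto
next
  case (factor p x)
  then have "x > 0" by simp
  with factor obtain r s where rs: "x = r * s" "prime_factors r \<subseteq> \<sigma>" "prime_factors s \<inter> \<sigma> = {}" by auto
  have nz: "r \<noteq> 0" "s \<noteq> 0" "p \<noteq> 0" using rs factor by auto
  have pp: "prime_factors p = {p}" using factor(1) by (simp add: prime_factorization_prime)
  show ?case
  proof (cases "p \<in> \<sigma>")
    case True
    then show ?thesis using rs nz pp
      by (intro exI[of _ "p * r"] exI[of _ s]) (simp add: prime_factors_product)
  next
    case False
    then show ?thesis using rs nz pp
      by (intro exI[of _ r] exI[of _ "p * s"]) (simp add: prime_factors_product)
  qed
qed simp

lemma (in group) conj_pow: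
  assumes "x \<in> carrier G" "g \<in> carrier G"
  shows "(inv g \<otimes> x \<otimes> g) [^] (n::nat) = inv g \<otimes> (x [^] n) \<otimes> g"
  using assms by (induction n) (simp_all add: gsimps)

lemma (in group) normal_quotient_hom:
  assumes "N \<lhd> G"
  shows "group_hom G (G Mod N) (\<lambda>x. N #> x)"
  using normal.r_coset_hom_Mod[OF assms] normal.factorgroup_is_group[OF assms]
  by (simp add: group_hom_def group_hom_axioms_def)

lemma (in group) subgroup_nat_pow_closed:
  "subgroup H G \<Longrightarrow> x \<in> H \<Longrightarrow> x [^] (n::nat) \<in> H"
  by (induction n) (simp_all add: subgroup.one_closed subgroup.m_closed)

section \<open>Orders modulo open normal subgroups\<close>

context profinite_group
begin

definition rord :: "'a set \<Rightarrow> 'a \<Rightarrow> nat" where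
  "rord W x = group.ord (G Mod W) (W #> x)"

text \<open>This is \<open>prime_set G T x\<close> (\<open>prime_set_eq_sp\<close>), computed in quotients of \<open>G\<close> rather
  than of the procyclic subgroup.\<close>
definition sp :: "'a \<Rightarrow> nat set" where
  "sp x = {p. Factorial_Ring.prime p \<and> (\<exists>W. onormal W \<and> p dvd rord W x)}"

lemma coset_one_iff: "onormal W \<Longrightarrow> x \<in> carrier G \<Longrightarrow> W #> x = W \<longleftrightarrow> x \<in> W"
  using rcoset_eq_iff[OF onormalD(2), of W x \<one>] onormalD(4)[of W] by (simp add: coset_mult_one)

lemma pow_mem_iff:
  assumes "onormal W" "x \<in> carrier G"
  shows "x [^] (n::nat) \<in> W \<longleftrightarrow> rord W x dvd n"
proof -
  interpret q: group_hom G "G Mod W" "\<lambda>x. W #> x" by (rule normal_quotient_hom[OF onormalD(1)[OF assms(1)]])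
  have "x [^] n \<in> W \<longleftrightarrow> W #> (x [^] n) = \<one>\<^bsub>G Mod W\<^esub>"
    using coset_one_iff[OF assms(1), of "x [^] n"] assms(2) by simp
  also have "\<dots> \<longleftrightarrow> (W #> x) [^]\<^bsub>G Mod W\<^esub> n = \<one>\<^bsub>G Mod W\<^esub>"
    using q.hom_nat_pow[OF assms(2), of n] by simp
  also have "\<dots> \<longleftrightarrow> rord W x dvd n"
    unfolding rord_def by (rule q.H.pow_eq_id) (use assms(2) in \<open>rule q.hom_closed\<close>)
  finally show ?thesis .
qed

lemma finite_Mod: "onormal W \<Longrightarrow> finite (carrier (G Mod W))"
  using finite_rcosets by (simp add: FactGroup_def)

lemma rord_pos:
  assumes "onormal W" "x \<in> carrier G"
  shows "rord W x > 0"
proof -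
  interpret q: group_hom G "G Mod W" "\<lambda>x. W #> x" by (rule normal_quotient_hom[OF onormalD(1)[OF assms(1)]])
  show ?thesis
    using q.H.ord_ge_1[OF finite_Mod[OF assms(1)] q.hom_closed[OF assms(2)]] by (simp add: rord_def)
qed

lemma rord_dvd_index:
  assumes "onormal W" "x \<in> carrier G"
  shows "rord W x dvd card (rcosets W)"
proof -
  interpret q: group_hom G "G Mod W" "\<lambda>x. W #> x" by (rule normal_quotient_hom[OF onormalD(1)[OF assms(1)]])
  show ?thesis
    using q.H.ord_dvd_group_order[OF q.hom_closed[OF assms(2)]]
    by (simp add: rord_def order_def FactGroup_def)
qed

lemma index_pos: "onormal W \<Longrightarrow> card (rcosets W) > 0"
  using finite_rcosets[of W] rcosetsI[of W \<one>] onormalD(4)[of W] by (auto simp: card_gt_0_iff)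

lemma rord_mem: "onormal W \<Longrightarrow> x \<in> carrier G \<Longrightarrow> x [^] rord W x \<in> W"
  by (simp add: pow_mem_iff)

lemma rord_mono:
  assumes "onormal W" "onormal W'" "W \<subseteq> W'" "x \<in> carrier G"
  shows "rord W' x dvd rord W x"
  using pow_mem_iff[OF assms(2,4), of "rord W x"] rord_mem[OF assms(1,4)] assms(3) by auto

lemma prime_factors_rord:
  assumes "onormal W" "x \<in> carrier G"
  shows "prime_factors (rord W x) \<subseteq> sp x"
  using assms(1) by (auto simp: sp_def in_prime_factors_iff)

text \<open>Any exponent that takes \<open>x\<close> into \<open>W\<close> is a multiple of
  \<open>rord W x\<close>, so it suffices to exhibit one exponent with primes in \<sigma> for every
  \<open>W\<close>.\<close>

lemma sp_leI:
  assumes "x \<in> carrier G"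
    and "\<And>W. onormal W \<Longrightarrow> \<exists>n>0. x [^] n \<in> W \<and> prime_factors n \<subseteq> \<sigma>"
  shows "sp x \<subseteq> \<sigma>"
proof
  fix p assume "p \<in> sp x"
  then obtain W where W: "onormal W" "p dvd rord W x" "Factorial_Ring.prime p" by (auto simp: sp_def)
  then obtain n where n: "n > 0" "x [^] n \<in> W" "prime_factors n \<subseteq> \<sigma>" using assms(2) by blast
  then have "rord W x dvd n" using pow_mem_iff[OF W(1) assms(1), of n] by simp
  with W n have "p \<in> prime_factors n" using dvd_trans[of p "rord W x" n] by (simp add: in_prime_factors_iff)
  then show "p \<in> \<sigma>" using n by auto
qed

lemma sp_inv:
  assumes "x \<in> carrier G"
  shows "sp (inv x) = sp x"
proof -
  have "sp (inv y) \<subseteq> sp y" if y: "y \<in> carrier G" for y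
  proof (rule sp_leI)
    fix W assume W: "onormal W"
    have "(inv y) [^] rord W y \<in> W"
      using nat_pow_inv[OF y, of "rord W y"] rord_mem[OF W y] subgroup.m_inv_closed[OF onormalD(2)[OF W]] by simp
    then show "\<exists>n>0. (inv y) [^] n \<in> W \<and> prime_factors n \<subseteq> sp y"
      using rord_pos[OF W y] prime_factors_rord[OF W y] by blast
  qed (use y in simp)
  from this[of x] this[of "inv x"] assms show ?thesis by auto
qed

lemma sp_conj:
  assumes "x \<in> carrier G" "g \<in> carrier G"
  shows "sp (inv g \<otimes> x \<otimes> g) = sp x"
proof -
  have "sp (inv g \<otimes> y \<otimes> g) \<subseteq> sp y" if y: "y \<in> carrier G" and g: "g \<in> carrier G" for y g
  proof (rule sp_leI)
    fix W assume W: "onormal W"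
    have "(inv g \<otimes> y \<otimes> g) [^] rord W y \<in> W"
      unfolding conj_pow[OF y g] by (rule conj_mem(2)[OF onormalD(1)[OF W] rord_mem[OF W y] g])
    then show "\<exists>n>0. (inv g \<otimes> y \<otimes> g) [^] n \<in> W \<and> prime_factors n \<subseteq> sp y"
      using rord_pos[OF W y] prime_factors_rord[OF W y] by blast
  qed (use y g in simp)
  from this[of x g] this[of "inv g \<otimes> x \<otimes> g" "inv g"] assms show ?thesis by (auto simp: gsimps)
qed

lemma sp_mult:
  assumes "x \<in> carrier G" "y \<in> carrier G" "x \<otimes> y = y \<otimes> x"
  shows "sp (x \<otimes> y) \<subseteq> sp x \<union> sp y"
proof (rule sp_leI)
  fix W assume W: "onormal W"
  let ?m = "rord W x" and ?n = "rord W y"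
  have "x [^] (?m * ?n) \<in> W" "y [^] (?m * ?n) \<in> W"
    using pow_mem_iff[OF W] assms by simp_all
  then have "(x \<otimes> y) [^] (?m * ?n) \<in> W"
    using pow_mult_distrib[OF assms(3,1,2)] subgroup.m_closed[OF onormalD(2)[OF W]] by simp
  moreover have "?m > 0" "?n > 0" using rord_pos[OF W] assms by auto
  moreover have "prime_factors (?m * ?n) \<subseteq> sp x \<union> sp y"
    using prime_factors_rord[OF W assms(1)] prime_factors_rord[OF W assms(2)] calculation(2,3)
    by (auto simp: prime_factors_product)
  ultimately show "\<exists>n>0. (x \<otimes> y) [^] n \<in> W \<and> prime_factors n \<subseteq> sp x \<union> sp y"
    by (intro exI[of _ "?m * ?n"]) auto
qed (use assms in simp)

lemma sp_one: "sp \<one> = {}"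
proof -
  have "sp \<one> \<subseteq> {}"
    by (rule sp_leI) (auto intro!: exI[of _ 1] subgroup.one_closed onormalD)
  then show ?thesis by simp
qed

lemma sp_empty:
  assumes "x \<in> carrier G" "sp x = {}"
  shows "x = \<one>"
proof (rule onormal_eq_one[OF assms(1)])
  fix W assume W: "onormal W"
  have "prime_factors (rord W x) = {}" using prime_factors_rord[OF W assms(1)] assms(2) by auto
  then have "rord W x = 1" using rord_pos[OF W assms(1)]
    by (auto simp: prime_factorization_empty_iff)
  then show "x \<in> W" using pow_mem_iff[OF W assms(1), of 1] assms(1) by simp
qed

lemma sp_pow:
  assumes "x \<in> carrier G"
  shows "sp (x [^] (k::nat)) \<subseteq> sp x"
proof (induction k)
  case 0 then show ?case by (simp add: sp_one)
next
  case (Suc k)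
  have "x [^] k \<otimes> x = x \<otimes> x [^] k" using assms by (metis nat_pow_Suc nat_pow_Suc2)
  then have "sp (x [^] k \<otimes> x) \<subseteq> sp (x [^] k) \<union> sp x" using assms by (intro sp_mult) auto
  then show ?case using Suc by auto
qed

text \<open>The complement is a union of cosets of \<open>W\<close>, and these are open.\<close>

lemma closedin_rcoset_invariant:
  assumes "onormal W"
  shows "closedin T {x \<in> carrier G. P (W #> x)}"
proof -
  have "openin T (carrier G - {x \<in> carrier G. P (W #> x)})"
  proof (rule openin_subopen[THEN iffD2], rule ballI)
    fix x assume x: "x \<in> carrier G - {x \<in> carrier G. P (W #> x)}"
    then have xG: "x \<in> carrier G" by simp
    have "W #> y = W #> x" if "y \<in> W #> x" for y
      using repr_independence[OF that xG onormalD(2)[OF assms]] by simp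
    then have "W #> x \<subseteq> carrier G - {x \<in> carrier G. P (W #> x)}"
      using x r_coset_subset_G[OF onormalD(4)[OF assms] xG] by auto
    moreover have "x \<in> W #> x" by (rule rcos_self[OF xG onormalD(2)[OF assms]])
    ultimately show "\<exists>U. openin T U \<and> x \<in> U \<and> U \<subseteq> carrier G - {x \<in> carrier G. P (W #> x)}"
      using openin_rcoset[OF onormalD(2,3)[OF assms] xG] by blast
  qed
  then show ?thesis by (auto simp: closedin_def topsp)
qed

lemma closedin_rord: "onormal W \<Longrightarrow> closedin T {x \<in> carrier G. P (rord W x)}"
  unfolding rord_def by (rule closedin_rcoset_invariant)

lemma closedin_sp: "closedin T {x \<in> carrier G. sp x \<subseteq> \<sigma>}"
proof -
  have "{x \<in> carrier G. sp x \<subseteq> \<sigma>} =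
    \<Inter> ((\<lambda>W. {x \<in> carrier G. prime_factors (rord W x) \<subseteq> \<sigma>}) ` {W. onormal W})" (is "?L = ?R")
  proof
    show "?L \<subseteq> ?R" using prime_factors_rord by blast
    show "?R \<subseteq> ?L"
    proof
      fix x assume x: "x \<in> ?R"
      then have xG: "x \<in> carrier G" using onormal_carrier by auto
      have "sp x \<subseteq> \<sigma>"
      proof (rule sp_leI[OF xG])
        fix W assume W: "onormal W"
        then show "\<exists>n>0. x [^] n \<in> W \<and> prime_factors n \<subseteq> \<sigma>"
          using rord_pos[OF W xG] rord_mem[OF W xG] x by blast
      qed
      then show "x \<in> ?L" using xG by simp
    qed
  qed
  moreover have "closedin T ?R"
    using onormal_carrier by (intro closedin_Inter) (auto intro!: closedin_rord)
  ultimately show ?thesis by simp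
qed

text \<open>Modulo \<open>W\<close>, the element \<open>b\<close> is a power of \<open>(a b)\<^sup>n\<close>, hence of
  \<open>c\<close>.\<close>
lemma part_mem:
  assumes a: "a \<in> carrier G" "sp a \<subseteq> \<sigma>" and b: "b \<in> carrier G" "sp b \<inter> \<sigma> = {}"
    and ab: "a \<otimes> b = b \<otimes> a" and C: "csubgroup C"
    and H: "\<And>W. onormal W \<Longrightarrow> \<exists>n>0. prime_factors n \<subseteq> \<sigma> \<and> (\<exists>c\<in>C. (a \<otimes> b) [^] n \<otimes> inv c \<in> W)"
  shows "b \<in> C"
proof (rule closedin_memI[OF csubgroupD(2)[OF C] b(1)])
  fix W assume W: "onormal W"
  interpret q: group_hom G "G Mod W" "\<lambda>x. W #> x" by (rule normal_quotient_hom[OF onormalD(1)[OF W]])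
  obtain n c where n: "n > 0" "prime_factors n \<subseteq> \<sigma>" and c: "c \<in> C" "(a \<otimes> b) [^] n \<otimes> inv c \<in> W"
    using H[OF W] by blast
  have cG: "c \<in> carrier G" using c csubgroupD(3)[OF C] by auto
  \<comment> \<open>The factor \<open>rord W a\<close> makes \<open>a\<close> vanish modulo
    \<open>W\<close>, and the factor \<open>n\<close> brings \<open>a b\<close> close to
    \<open>C\<close>. All primes of \<open>?m\<close> lie in \<sigma>, so it is coprime to
    \<open>?l\<close> and Bezout recovers \<open>b\<close>.\<close>
  let ?m = "n * rord W a" and ?l = "rord W b"
  have m: "?m > 0" "prime_factors ?m \<subseteq> \<sigma>"
    using n rord_pos[OF W a(1)] prime_factors_rord[OF W a(1)] a(2) by (auto simp: prime_factors_product)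
  have "coprime ?m ?l"
    using coprime_prime_factors[of ?m ?l] m rord_pos[OF W b(1)] prime_factors_rord[OF W b(1)] b(2) by blast
  then obtain u v where uv: "?m * u = 1 + ?l * v" using ex_linear_combination[of ?m ?l] m by blast
  have abG: "a \<otimes> b \<in> carrier G" using a b by simp
  have e1: "W #> ((a \<otimes> b) [^] n) = W #> c"
    using rcoset_eq_iff[OF onormalD(2)[OF W], of "(a \<otimes> b) [^] n" c] c cG abG by simp
  have "W #> (c [^] (rord W a * u)) = (W #> c) [^]\<^bsub>G Mod W\<^esub> (rord W a * u)"
    using q.hom_nat_pow[OF cG] by simp
  also have "\<dots> = (W #> ((a \<otimes> b) [^] n)) [^]\<^bsub>G Mod W\<^esub> (rord W a * u)" using e1 by simp
  also have "\<dots> = W #> (((a \<otimes> b) [^] n) [^] (rord W a * u))"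
    using q.hom_nat_pow[of "(a \<otimes> b) [^] n"] abG by simp
  also have "((a \<otimes> b) [^] n) [^] (rord W a * u) = (a \<otimes> b) [^] (?m * u)"
    using nat_pow_pow[OF abG, of n "rord W a * u"] by (simp add: mult.assoc)
  also have "\<dots> = a [^] (?m * u) \<otimes> b [^] (?m * u)" by (rule pow_mult_distrib[OF ab a(1) b(1)])
  also have "b [^] (?m * u) = b \<otimes> b [^] (?l * v)"
    unfolding uv using b(1) nat_pow_mult[OF b(1), of 1 "?l * v"] by simp
  also have "a [^] (?m * u) \<otimes> (b \<otimes> b [^] (?l * v)) \<otimes> inv b \<in> W"
  proof -
    have 1: "a [^] (?m * u) \<in> W" using pow_mem_iff[OF W a(1), of "?m * u"] by simp
    have 2: "b \<otimes> b [^] (?l * v) \<otimes> inv b \<in> W"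
      by (rule conj_mem(1)[OF onormalD(1)[OF W] _ b(1)]) (use pow_mem_iff[OF W b(1), of "?l * v"] in simp)
    show ?thesis
      using subgroup.m_closed[OF onormalD(2)[OF W] 1 2] a(1) b(1) by (simp add: m_assoc)
  qed
  then have "W #> (a [^] (?m * u) \<otimes> (b \<otimes> b [^] (?l * v))) = W #> b"
    using rcoset_eq_iff[OF onormalD(2)[OF W] _ b(1)] a(1) b(1) by (simp del: q.hom_mult)
  finally have "W #> (c [^] (rord W a * u)) = W #> b" .
  then have "c [^] (rord W a * u) \<otimes> inv b \<in> W"
    using rcoset_eq_iff[OF onormalD(2)[OF W], of _ b] cG b(1) by simp
  moreover have "c [^] k \<in> C" for k :: nat
    by (induction k) (use c subgroup.one_closed[OF csubgroupD(1)[OF C]]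
        subgroup.m_closed[OF csubgroupD(1)[OF C]] in simp_all)
  ultimately show "\<exists>y\<in>C. y \<otimes> inv b \<in> W" by blast
qed

text \<open>This is \<open>part_mem\<close> with exponent 1 and \<open>\<sigma> = sp a\<close>. It
  makes closed subgroups inherit both parts of their elements.\<close>

lemma part_mem_subgroup:
  assumes "a \<in> carrier G" "b \<in> carrier G" "sp a \<inter> sp b = {}"
    and "a \<otimes> b = b \<otimes> a" "csubgroup C" "a \<otimes> b \<in> C"
  shows "a \<in> C" "b \<in> C"
proof -
  show b: "b \<in> C"
  proof (rule part_mem[OF assms(1) subset_refl assms(2) _ assms(4,5)])
    fix W assume W: "onormal W"
    show "\<exists>n>0. prime_factors n \<subseteq> sp a \<and> (\<exists>c\<in>C. (a \<otimes> b) [^] n \<otimes> inv c \<in> W)"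
      using assms(1,2,6) subgroup.one_closed[OF onormalD(2)[OF W]]
      by (intro exI[of _ 1] conjI bexI[of _ "a \<otimes> b"]) simp_all
  qed (use assms(3) in auto)
  have "a = (a \<otimes> b) \<otimes> inv b" using assms(1,2) by (simp add: m_assoc)
  then show "a \<in> C"
    using b assms(6) subgroup.m_closed[OF csubgroupD(1)[OF assms(5)]] subgroup.m_inv_closed[OF csubgroupD(1)[OF assms(5)]]
    by metis
qed

text \<open>Modulo each open normal subgroup the two parts are powers of \<open>x\<close>; compactness
  provides them simultaneously.\<close>
lemma parts_exist:
  assumes x: "x \<in> carrier G"
  shows "\<exists>a b. a \<in> carrier G \<and> b \<in> carrier G \<and> x = a \<otimes> b \<and> a \<otimes> b = b \<otimes> a \<and>
    sp a \<subseteq> sp x \<inter> \<sigma> \<and> sp b \<subseteq> sp x - \<sigma> \<and>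
    (\<forall>W. onormal W \<longrightarrow> prime_factors (rord W a) \<subseteq> prime_factors (rord W x)
      \<and> prime_factors (rord W b) \<subseteq> prime_factors (rord W x))"
proof -
  \<comment> \<open>\<open>S W\<close> collects the candidates for the \<sigma>-part of
    \<open>x\<close> that are correct modulo \<open>W\<close>. The last condition, being a power of
    \<open>x\<close> modulo \<open>W\<close>, later makes \<open>rord W a\<close> and
    \<open>rord W b\<close> divide \<open>rord W x\<close>.\<close>
  define S where "S W = {a \<in> carrier G. a \<otimes> x = x \<otimes> a} \<inter>
      {a \<in> carrier G. prime_factors (rord W a) \<subseteq> \<sigma>} \<inter>
      {a \<in> carrier G. inv a \<otimes> x \<in> {b \<in> carrier G. prime_factors (rord W b) \<inter> \<sigma> = {}}} \<inter>
      {a \<in> carrier G. \<exists>k::nat. W #> a = W #> (x [^] k)}" for W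
  have clS: "closedin T (S W)" if "onormal W" for W
    unfolding S_def using that x
    by (intro closedin_Int closedin_equal closedin_preimage closedin_rord closedin_rcoset_invariant cont_intros) auto
  have neS: "S W \<noteq> {}" if W: "onormal W" for W
  proof -
    obtain r s where rs: "rord W x = r * s" "prime_factors r \<subseteq> \<sigma>" "prime_factors s \<inter> \<sigma> = {}"
      using factor_by_primes[OF rord_pos[OF W x]] by blast
    have pos: "r > 0" "s > 0" using rord_pos[OF W x] rs(1) by auto
    have "coprime s r" using coprime_prime_factors[of s r] pos rs by blast
    then obtain u v where uv: "s * u = 1 + r * v" using ex_linear_combination[of s r] pos by blast
    \<comment> \<open>The factor \<open>s\<close> gives \<open>a\<close> an order dividing
      \<open>r\<close> modulo \<open>W\<close>; since \<open>s * u = 1 + r * v\<close>, the cofactor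
      \<open>inv a \<otimes> x\<close> is the inverse of \<open>x [^] (r * v)\<close>, of order
      dividing \<open>s\<close> modulo \<open>W\<close>.\<close>
    define a where "a = x [^] (s * u)"
    have aG: "a \<in> carrier G" using x by (simp add: a_def)
    have ax: "a \<otimes> x = x \<otimes> a" unfolding a_def using x nat_pow_Suc nat_pow_Suc2 by metis
    have "a [^] r = x [^] (s * u * r)" unfolding a_def by (rule nat_pow_pow[OF x])
    then have "a [^] r \<in> W" using pow_mem_iff[OF W x, of "s * u * r"] rs(1) by (simp add: mult_ac)
    then have "rord W a dvd r" using pow_mem_iff[OF W aG] by simp
    then have "prime_factors (rord W a) \<subseteq> prime_factors r" using pos by (intro dvd_prime_factors) auto
    moreover have "a = x \<otimes> x [^] (r * v)" unfolding a_def uv using nat_pow_mult[OF x, of 1 "r * v"] x by simp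
    then have "inv a \<otimes> x = inv (x [^] (r * v))"
      using x ax nat_pow_mult[OF x] nat_pow_comm[OF x, of 1 "r * v"] by (simp add: gsimps inv_mult_group)
    then have "(inv a \<otimes> x) [^] s = inv (x [^] (r * v * s))"
      using x by (simp add: nat_pow_inv nat_pow_pow)
    then have "(inv a \<otimes> x) [^] s \<in> W" using pow_mem_iff[OF W x, of "r * v * s"] rs(1)
        subgroup.m_inv_closed[OF onormalD(2)[OF W]] by (simp add: mult_ac)
    then have "rord W (inv a \<otimes> x) dvd s" using pow_mem_iff[OF W] aG x by simp
    then have "prime_factors (rord W (inv a \<otimes> x)) \<subseteq> prime_factors s" using pos by (intro dvd_prime_factors) auto
    moreover have "\<exists>k::nat. W #> a = W #> (x [^] k)" unfolding a_def by blast
    ultimately have "a \<in> S W" unfolding S_def using aG ax x rs(2,3) by auto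
    then show ?thesis by auto
  qed
  have monoS: "S W \<subseteq> S W'" if "onormal W" "onormal W'" "W \<subseteq> W'" for W W'
  proof
    fix a assume a: "a \<in> S W"
    have aG: "a \<in> carrier G" "inv a \<otimes> x \<in> carrier G" using a x by (auto simp: S_def)
    have sub: "prime_factors (rord W' y) \<subseteq> prime_factors (rord W y)" if "y \<in> carrier G" for y
      using dvd_prime_factors[OF _ rord_mono[OF \<open>onormal W\<close> \<open>onormal W'\<close> \<open>W \<subseteq> W'\<close> that]]
        rord_pos[OF \<open>onormal W\<close> that] by auto
    obtain k :: nat where "W #> a = W #> (x [^] k)" using a unfolding S_def by auto
    then have "a \<otimes> inv (x [^] k) \<in> W'"
      using rcoset_eq_iff[OF onormalD(2)[OF \<open>onormal W\<close>] aG(1), of "x [^] k"] x \<open>W \<subseteq> W'\<close> by auto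
    then have "W' #> a = W' #> (x [^] k)"
      using rcoset_eq_iff[OF onormalD(2)[OF \<open>onormal W'\<close>] aG(1), of "x [^] k"] x by auto
    then show "a \<in> S W'"
      using a sub[OF aG(1)] sub[OF aG(2)] unfolding S_def by auto
  qed
  have "\<Inter> (S ` {W. onormal W}) \<noteq> {}"
  proof (rule compact_space_fip[THEN iffD1, OF comp, rule_format], intro conjI ballI allI impI)
    fix C assume "C \<in> S ` {W. onormal W}" then show "closedin T C" using clS by auto
  next
    fix \<F> assume "finite \<F> \<and> \<F> \<subseteq> S ` {W. onormal W}"
    then have "finite \<F>" "\<F> \<subseteq> S ` {W. onormal W}" by auto
    then have "\<exists>W. onormal W \<and> S W \<subseteq> \<Inter>\<F>"
    proof (induction rule: finite_induct)
      case empty show ?case using onormal_carrier by auto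
    next
      case (insert F \<F>)
      then obtain W where W: "onormal W" "S W \<subseteq> \<Inter>\<F>" by auto
      obtain W' where W': "onormal W'" "F = S W'" using insert by auto
      have "S (W \<inter> W') \<subseteq> S W" "S (W \<inter> W') \<subseteq> S W'"
        using monoS[OF onormal_Int[OF W(1) W'(1)] W(1)] monoS[OF onormal_Int[OF W(1) W'(1)] W'(1)] by simp_all
      then show ?case using W W' onormal_Int[OF W(1) W'(1)] by (intro exI[of _ "W \<inter> W'"]) auto
    qed
    then show "\<Inter>\<F> \<noteq> {}" using neS by blast
  qed
  then obtain a where a: "\<And>W. onormal W \<Longrightarrow> a \<in> S W" by auto
  define b where "b = inv a \<otimes> x"
  have aG: "a \<in> carrier G" "a \<otimes> x = x \<otimes> a" using a[OF onormal_carrier] by (auto simp: S_def)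
  have bG: "b \<in> carrier G" using aG x by (simp add: b_def)
  have ax: "inv a \<otimes> x = x \<otimes> inv a" by (rule commute_inv[OF aG(2,1) x])
  have xab: "x = a \<otimes> b" using aG x by (simp add: b_def mult_inv_cancel)
  have ab: "a \<otimes> b = b \<otimes> a" unfolding b_def ax using aG x by (simp add: m_assoc mult_inv_cancel) (simp add: ax[symmetric] mult_inv_cancel)
  have ra: "prime_factors (rord W a) \<subseteq> \<sigma>" "prime_factors (rord W b) \<inter> \<sigma> = {}"
    "rord W a dvd rord W x" "rord W b dvd rord W x" if W: "onormal W" for W
  proof -
    show "prime_factors (rord W a) \<subseteq> \<sigma>" "prime_factors (rord W b) \<inter> \<sigma> = {}"
      using a[OF W] unfolding S_def b_def by auto
    obtain k :: nat where "W #> a = W #> (x [^] k)" using a[OF W] unfolding S_def by auto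
    then have "rord W a = rord W (x [^] k)" by (simp add: rord_def)
    moreover have "(x [^] k) [^] rord W x = x [^] (k * rord W x)" by (rule nat_pow_pow[OF x])
    then have "(x [^] k) [^] rord W x \<in> W" using pow_mem_iff[OF W x, of "k * rord W x"] by simp
    then have "rord W (x [^] k) dvd rord W x" using pow_mem_iff[OF W] x by simp
    ultimately show *: "rord W a dvd rord W x" by simp
    have "b [^] rord W x = (inv a) [^] rord W x \<otimes> x [^] rord W x"
      unfolding b_def using pow_mult_distrib[OF ax] aG x by simp
    moreover have "(inv a) [^] rord W x \<in> W"
      using pow_mem_iff[OF W aG(1), of "rord W x"] * subgroup.m_inv_closed[OF onormalD(2)[OF W]] aG
      by (simp add: nat_pow_inv)
    ultimately have "b [^] rord W x \<in> W"
      using rord_mem[OF W x] subgroup.m_closed[OF onormalD(2)[OF W]] by simp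
    then show "rord W b dvd rord W x" using pow_mem_iff[OF W bG] by simp
  qed
  have rs: "prime_factors (rord W a) \<subseteq> prime_factors (rord W x)" "prime_factors (rord W b) \<subseteq> prime_factors (rord W x)"
    if W: "onormal W" for W
    using dvd_prime_factors[OF _ ra(3)[OF W]] dvd_prime_factors[OF _ ra(4)[OF W]] rord_pos[OF W x] by simp_all
  have "sp a \<subseteq> sp x \<inter> \<sigma>"
  proof (rule sp_leI[OF aG(1)])
    fix W assume W: "onormal W"
    then show "\<exists>n>0. a [^] n \<in> W \<and> prime_factors n \<subseteq> sp x \<inter> \<sigma>"
      using rord_pos[OF W aG(1)] rord_mem[OF W aG(1)] ra(1)[OF W] rs(1)[OF W] prime_factors_rord[OF W x]
      by (intro exI[of _ "rord W a"]) auto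
  qed
  moreover have "sp b \<subseteq> sp x - \<sigma>"
  proof (rule sp_leI[OF bG])
    fix W assume W: "onormal W"
    then show "\<exists>n>0. b [^] n \<in> W \<and> prime_factors n \<subseteq> sp x - \<sigma>"
      using rord_pos[OF W bG] rord_mem[OF W bG] ra(2)[OF W] rs(2)[OF W] prime_factors_rord[OF W x]
      by (intro exI[of _ "rord W b"]) auto
  qed
  ultimately show ?thesis using aG bG xab ab rs by blast
qed

end

section \<open>Finite groups in which elements of coprime order commute\<close>

lemma (in group) ord_dvd_card_subgroup:
  assumes "subgroup H G" "x \<in> H"
  shows "ord x dvd card H"
proof -
  interpret H: group "G\<lparr>carrier := H\<rparr>" by (rule subgroup_imp_group[OF assms(1)])
  have "x [^]\<^bsub>G\<lparr>carrier := H\<rparr>\<^esub> order (G\<lparr>carrier := H\<rparr>) = \<one>"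
    using H.pow_order_eq_1[of x] assms(2) by simp
  then have "x [^] card H = \<one>" by (simp add: order_def nat_pow_def)
  then show ?thesis using pow_eq_id[of x] assms subgroup.subset by blast
qed

lemma (in group) commuting_product_subgroup:
  assumes H: "subgroup H G" and K: "subgroup K G" and comm: "\<And>h k. h \<in> H \<Longrightarrow> k \<in> K \<Longrightarrow> h \<otimes> k = k \<otimes> h"
  defines "L \<equiv> {h \<otimes> k | h k. h \<in> H \<and> k \<in> K}"
  shows "subgroup L G" "H \<subseteq> L" "K \<subseteq> L"
proof -
  have HG: "h \<in> carrier G" if "h \<in> H" for h using that subgroup.subset[OF H] by auto
  have KG: "k \<in> carrier G" if "k \<in> K" for k using that subgroup.subset[OF K] by auto
  show "subgroup L G"
  proof (rule subgroupI)
    show "L \<subseteq> carrier G" using HG KG by (auto simp: L_def)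
    show "L \<noteq> {}" using subgroup.one_closed[OF H] subgroup.one_closed[OF K] by (auto simp: L_def)
  next
    fix a assume "a \<in> L"
    then obtain h k where hk: "h \<in> H" "k \<in> K" "a = h \<otimes> k" by (auto simp: L_def)
    have "inv a = inv h \<otimes> inv k" unfolding hk(3) comm[OF hk(1,2)] using HG KG hk by (simp add: inv_mult_group)
    then show "inv a \<in> L"
      using subgroup.m_inv_closed[OF H hk(1)] subgroup.m_inv_closed[OF K hk(2)] by (auto simp: L_def)
  next
    fix a b assume "a \<in> L" "b \<in> L"
    then obtain h k h' k' where hk: "h \<in> H" "k \<in> K" "a = h \<otimes> k" and hk': "h' \<in> H" "k' \<in> K" "b = h' \<otimes> k'"
      by (auto simp: L_def)
    have G: "h \<in> carrier G" "h' \<in> carrier G" "k \<in> carrier G" "k' \<in> carrier G" using HG KG hk hk' by auto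
    have "a \<otimes> b = h \<otimes> (k \<otimes> h') \<otimes> k'" unfolding hk hk' using G by (simp add: m_assoc)
    also have "\<dots> = (h \<otimes> h') \<otimes> (k \<otimes> k')" unfolding comm[OF hk'(1) hk(2), symmetric] using G by (simp add: m_assoc)
    finally show "a \<otimes> b \<in> L"
      using subgroup.m_closed[OF H hk(1) hk'(1)] subgroup.m_closed[OF K hk(2) hk'(2)] by (auto simp: L_def)
  qed
  show "H \<subseteq> L"
  proof
    fix h assume h: "h \<in> H"
    then have "h = h \<otimes> \<one>" using HG by simp
    then show "h \<in> L" unfolding L_def using h subgroup.one_closed[OF K] by blast
  qed
  show "K \<subseteq> L"
  proof
    fix k assume k: "k \<in> K"
    then have "k = \<one> \<otimes> k" using KG by simp
    then show "k \<in> L" unfolding L_def using k subgroup.one_closed[OF H] by blast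
  qed
qed

text \<open>Class equation: class sizes are powers of \<open>p\<close>. If \<open>\<one>\<close>
  were the only central element, every class but \<open>{\<one>}\<close> would have size divisible
  by \<open>p\<close>, and the order would be 1 modulo \<open>p\<close>.\<close>

lemma (in group) center_nontrivial_prime_power_order:
  assumes ord: "order G = p ^ k" "k > 0" and p: "Factorial_Ring.prime p"
  shows "\<exists>z\<in>carrier G. z \<noteq> \<one> \<and> (\<forall>x\<in>carrier G. x \<otimes> z = z \<otimes> x)"
proof (rule ccontr)
  assume no: "\<not> ?thesis"
  define \<phi> where "\<phi> = (\<lambda>g. (\<lambda>h \<in> carrier G. g \<otimes> h \<otimes> inv g))"
  interpret act: group_action G "carrier G" \<phi> unfolding \<phi>_def by (rule action_by_conjugation)
  have fin: "finite (carrier G)"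
  proof -
    have "order G > 0" using ord p by (simp add: prime_gt_0_nat)
    then show ?thesis using order_gt_0_iff_finite by simp
  qed
  let ?O = "orbits G (carrier G) \<phi>"
  have finO: "finite ?O" unfolding orbits_def using fin by simp
  have orb: "orbit G \<phi> x = {g \<otimes> x \<otimes> inv g | g. g \<in> carrier G}" if "x \<in> carrier G" for x
    unfolding orbit_def \<phi>_def using that by auto
  have "{g \<otimes> \<one> \<otimes> inv g | g. g \<in> carrier G} = (\<lambda>g. \<one>) ` carrier G"
    unfolding Setcompr_eq_image by (rule image_cong) simp_all
  then have one: "orbit G \<phi> \<one> = {\<one>}" using orb[OF one_closed] one_closed by auto
  have pd: "p dvd card o'" if o': "o' \<in> ?O - {{\<one>}}" for o'
  proof -
    obtain x where x: "x \<in> carrier G" "o' = orbit G \<phi> x" using o' by (auto simp: orbits_def)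
    have "x \<noteq> \<one>" using x(2) o' one by auto
    then obtain g where g: "g \<in> carrier G" "g \<otimes> x \<noteq> x \<otimes> g" using no x(1) by auto
    have "p ^ k = card o' * card (stabilizer G \<phi> x)" using act.orbit_stabilizer_theorem[OF x(1)] ord(1) x(2) by simp
    then have "card o' dvd p ^ k" by (rule dvdI)
    then obtain i where i: "card o' = p ^ i" using divides_primepow_nat[OF p] by blast
    have "card o' \<noteq> 1"
    proof
      assume "card o' = 1"
      then obtain y where y: "o' = {y}" by (auto simp: card_1_singleton_iff)
      have "x \<in> o'" using x(2) act.orbit_refl[OF x(1)] by simp
      moreover have "g \<otimes> x \<otimes> inv g \<in> o'" unfolding x(2) orb[OF x(1)] using g(1) by blast
      ultimately
      have "g \<otimes> x \<otimes> inv g = x" using y by simp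
      then have "g \<otimes> x \<otimes> inv g \<otimes> g = x \<otimes> g" by simp
      then show False using g x(1) by (simp add: m_assoc)
    qed
    then show ?thesis using i by (cases i) auto
  qed
  have "(\<Sum>o'\<in>?O. card o') = card (carrier G)"
    using act.disjoint_sum[OF fin, of "\<lambda>_. 1::nat"] by simp
  moreover have "orbit G \<phi> \<one> \<in> ?O" unfolding orbits_def using one_closed by blast
  then have "{\<one>} \<in> ?O" using one by simp
  ultimately have "card (carrier G) = 1 + (\<Sum>o'\<in>?O - {{\<one>}}. card o')"
    using sum.remove[OF finO, of "{\<one>}" card] by simp
  moreover have "p dvd (\<Sum>o'\<in>?O - {{\<one>}}. card o')" by (rule dvd_sum) (use pd in blast)
  moreover have "p dvd card (carrier G)" using ord by (simp add: order_def[symmetric])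
  ultimately have "p dvd (\<Sum>o'\<in>?O - {{\<one>}}. card o')" "p dvd 1 + (\<Sum>o'\<in>?O - {{\<one>}}. card o')" by simp_all
  then have "p dvd 1" by (rule dvd_add_left_iff[THEN iffD1])
  then show False using p by (simp add: prime_nat_iff)
qed

section \<open>Sylow and Hall subgroups when coprime elements commute\<close>

locale coprime_commuting_group = group +
  assumes fin: "finite (carrier G)"
    and cc: "\<And>x y. \<lbrakk>x \<in> carrier G; y \<in> carrier G; prime_factors (ord x) \<inter> prime_factors (ord y) = {}\<rbrakk>
      \<Longrightarrow> x \<otimes> y = y \<otimes> x"
begin

lemma ord_pos: "x \<in> carrier G \<Longrightarrow> ord x > 0"
  using ord_ge_1[OF fin] by fastforce

lemma order_pos: "order G > 0"
  using fin order_gt_0_iff_finite by simp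

text \<open>One Sylow subgroup is fixed for each prime; for a prime not dividing the order it has a
  single element.\<close>

definition syl :: "nat \<Rightarrow> 'a set" where
  "syl p = (SOME H. subgroup H G \<and> card H = p ^ multiplicity p (order G))"

lemma syl:
  assumes "Factorial_Ring.prime p"
  shows "subgroup (syl p) G" "card (syl p) = p ^ multiplicity p (order G)"
proof -
  obtain m where "order G = p ^ multiplicity p (order G) * m"
    using multiplicity_dvd[of p "order G"] by (auto elim: dvdE)
  then have "\<exists>H. subgroup H G \<and> card H = p ^ multiplicity p (order G)"
    using sylow_thm[OF assms group_axioms _ fin] by blast
  then have "subgroup (syl p) G \<and> card (syl p) = p ^ multiplicity p (order G)"
    unfolding syl_def by (rule someI_ex)
  then show "subgroup (syl p) G" "card (syl p) = p ^ multiplicity p (order G)" by simp_all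
qed

lemma syl_ord:
  assumes "Factorial_Ring.prime p" "x \<in> syl p"
  shows "prime_factors (ord x) \<subseteq> {p}"
proof -
  have "ord x dvd p ^ multiplicity p (order G)"
    using ord_dvd_card_subgroup[OF syl(1)[OF assms(1)] assms(2)] syl(2)[OF assms(1)] by simp
  then obtain i where i: "ord x = p ^ i" using divides_primepow_nat[OF assms(1)] by blast
  show ?thesis
  proof
    fix q assume "q \<in> prime_factors (ord x)"
    then have q: "Factorial_Ring.prime q" "q dvd p ^ i" by (simp_all add: in_prime_factors_iff i)
    then have "q dvd p" using prime_dvd_power by blast
    then show "q \<in> {p}" using primes_dvd_imp_eq[OF q(1) assms(1)] by simp
  qed
qed

text \<open>Each maximal prime power in the order of \<open>G\<close> is the order of a subgroup of
  \<open>H\<close>, so it divides \<open>card H\<close>; together these powers force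
  \<open>order G dvd card H\<close>.\<close>

lemma full_subgroup:
  assumes H: "subgroup H G" and sylH: "\<And>p. Factorial_Ring.prime p \<Longrightarrow> p dvd order G \<Longrightarrow> syl p \<subseteq> H"
  shows "H = carrier G"
proof -
  have HG: "H \<subseteq> carrier G" by (rule subgroup.subset[OF H])
  have finH: "finite H" by (rule finite_subset[OF HG fin])
  have cpos: "card H > 0" using finH subgroup.one_closed[OF H] by (auto simp: card_gt_0_iff)
  have "order G dvd card H"
  proof (rule multiplicity_le_imp_dvd)
    show "order G \<noteq> 0" using order_pos by simp
    fix p :: nat assume p: "Factorial_Ring.prime p"
    show "multiplicity p (order G) \<le> multiplicity p (card H)"
    proof (cases "p dvd order G")
      case True
      have sub: "subgroup (syl p) (G\<lparr>carrier := H\<rparr>)"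
        by (rule subgroup_incl[OF syl(1)[OF p] H sylH[OF p True]])
      interpret H: group "G\<lparr>carrier := H\<rparr>" by (rule subgroup_imp_group[OF H])
      have "card (rcosets\<^bsub>G\<lparr>carrier := H\<rparr>\<^esub> (syl p)) * card (syl p) = card H"
        using H.lagrange[OF sub] by (simp add: order_def)
      then have "card (syl p) dvd card H" by (rule dvdI[OF trans[OF _ mult.commute], OF sym])
      then have "p ^ multiplicity p (order G) dvd card H" using syl(2)[OF p] by simp
      then show ?thesis using cpos p by (intro multiplicity_geI) (auto simp: prime_nat_iff)
    next
      case False then show ?thesis by (simp add: not_dvd_imp_multiplicity_0)
    qed
  qed
  then have "order G \<le> card H" using cpos by (rule dvd_imp_le)
  then show ?thesis using HG fin by (intro card_seteq) (auto simp: order_def)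
qed

text \<open>Sylow subgroups for different primes commute elementwise, so their product over
  \<open>S\<close> is again a subgroup. The order of a product of commuting elements divides the
  product of their orders, which confines the primes to \<open>S\<close>.\<close>

lemma hall_subgroup:
  assumes "finite S" "\<And>p. p \<in> S \<Longrightarrow> Factorial_Ring.prime p"
  shows "\<exists>M. subgroup M G \<and> (\<forall>p\<in>S. syl p \<subseteq> M) \<and> (\<forall>m\<in>M. prime_factors (ord m) \<subseteq> S)"
  using assms
proof (induction S rule: finite_induct)
  case empty
  show ?case using triv_subgroup by (intro exI[of _ "{\<one>}"]) simp
next
  case (insert q S)
  then obtain M where M: "subgroup M G" "\<forall>p\<in>S. syl p \<subseteq> M" "\<forall>m\<in>M. prime_factors (ord m) \<subseteq> S" by auto
  have q: "Factorial_Ring.prime q" using insert by auto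
  note Q = syl(1)[OF q]
  have MG: "m \<in> carrier G" if "m \<in> M" for m using that subgroup.subset[OF M(1)] by auto
  have QG: "r \<in> carrier G" if "r \<in> syl q" for r using that subgroup.subset[OF Q] by auto
  have comm: "m \<otimes> r = r \<otimes> m" if "m \<in> M" "r \<in> syl q" for m r
  proof -
    have "prime_factors (ord m) \<subseteq> S" "prime_factors (ord r) \<subseteq> {q}" using M(3) that syl_ord[OF q] by auto
    then show ?thesis using cc[OF MG[OF that(1)] QG[OF that(2)]] insert.hyps(2) by blast
  qed
  define N where "N = {m \<otimes> r | m r. m \<in> M \<and> r \<in> syl q}"
  note prod = commuting_product_subgroup[OF M(1) Q comm, folded N_def]
  have "syl p \<subseteq> N" if "p \<in> insert q S" for p using that M(2) prod(2,3) by auto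
  moreover have "prime_factors (ord a) \<subseteq> insert q S" if a: "a \<in> N" for a
  proof -
    obtain m r where mr: "m \<in> M" "r \<in> syl q" "a = m \<otimes> r" using a by (auto simp: N_def)
    have "ord a dvd ord m * ord r"
      unfolding mr(3) by (rule ord_mul_divides[OF comm[OF mr(1,2)] MG[OF mr(1)] QG[OF mr(2)]])
    moreover have pos: "ord m \<noteq> 0" "ord r \<noteq> 0" using ord_pos[OF MG[OF mr(1)]] ord_pos[OF QG[OF mr(2)]] by simp_all
    ultimately have "prime_factors (ord a) \<subseteq> prime_factors (ord m * ord r)" by (intro dvd_prime_factors) auto
    also have "\<dots> = prime_factors (ord m) \<union> prime_factors (ord r)" by (rule prime_factors_product[OF pos])
    also have "\<dots> \<subseteq> insert q S" using M(3) mr(1) syl_ord[OF q mr(2)] by auto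
    finally show ?thesis .
  qed
  ultimately show ?case using prod(1) by (intro exI[of _ N]) blast
qed

text \<open>\<open>G\<close> is the product of a \<sigma>-subgroup \<open>M\<close> and a
  \<sigma>'-subgroup \<open>N\<close> that commute. Writing a \<sigma>-element as
  \<open>m \<otimes> r\<close>, the factor \<open>r\<close> is a product of commuting
  \<sigma>-elements and hence trivial. So the \<sigma>-elements are exactly those of the subgroup
  \<open>M\<close>.\<close>

lemma pi_elements_mult:
  assumes x: "x \<in> carrier G" "prime_factors (ord x) \<subseteq> \<sigma>" and y: "y \<in> carrier G" "prime_factors (ord y) \<subseteq> \<sigma>"
  shows "prime_factors (ord (x \<otimes> y)) \<subseteq> \<sigma>"
proof -
  let ?F = "prime_factors (order G)"
  have prF: "\<And>p. p \<in> ?F \<inter> \<sigma> \<Longrightarrow> Factorial_Ring.prime p" "\<And>p. p \<in> ?F - \<sigma> \<Longrightarrow> Factorial_Ring.prime p" by auto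
  obtain M where M: "subgroup M G" "\<forall>p\<in>?F \<inter> \<sigma>. syl p \<subseteq> M" "\<forall>m\<in>M. prime_factors (ord m) \<subseteq> ?F \<inter> \<sigma>"
    using hall_subgroup[OF _ prF(1), of "?F \<inter> \<sigma>"] by blast
  obtain N where N: "subgroup N G" "\<forall>p\<in>?F - \<sigma>. syl p \<subseteq> N" "\<forall>m\<in>N. prime_factors (ord m) \<subseteq> ?F - \<sigma>"
    using hall_subgroup[OF _ prF(2), of "?F - \<sigma>"] by blast
  have MG: "m \<in> carrier G" if "m \<in> M" for m using that subgroup.subset[OF M(1)] by auto
  have NG: "r \<in> carrier G" if "r \<in> N" for r using that subgroup.subset[OF N(1)] by auto
  have comm: "m \<otimes> r = r \<otimes> m" if "m \<in> M" "r \<in> N" for m r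
    using cc[OF MG[OF that(1)] NG[OF that(2)]] M(3) N(3) that by blast
  define L where "L = {m \<otimes> r | m r. m \<in> M \<and> r \<in> N}"
  note prod = commuting_product_subgroup[OF M(1) N(1) comm, folded L_def]
  have "syl p \<subseteq> L" if p: "Factorial_Ring.prime p" "p dvd order G" for p
  proof -
    have "p \<in> ?F" using p order_pos by (simp add: in_prime_factors_iff)
    then show ?thesis using M(2) N(2) prod(2,3) by blast
  qed
  then have L: "L = carrier G" using full_subgroup[OF prod(1)] by blast
  have inM: "z \<in> M" if z: "z \<in> carrier G" "prime_factors (ord z) \<subseteq> \<sigma>" for z
  proof -
    obtain m r where mr: "m \<in> M" "r \<in> N" "z = m \<otimes> r" using z L unfolding L_def by blast
    note G = MG[OF mr(1)] NG[OF mr(2)]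
    have "inv m \<otimes> z = z \<otimes> inv m"
      by (rule commute_inv[OF _ G(1) z(1)]) (use G comm[OF mr(1,2), symmetric] mr(3) in \<open>simp add: m_assoc\<close>)
    moreover have r: "r = inv m \<otimes> z" using G mr(3) by (simp add: inv_mult_cancel)
    ultimately have "ord r dvd ord (inv m) * ord z"
      using ord_mul_divides[of "inv m" z] G(1) z(1) by simp
    moreover have pos: "ord (inv m) \<noteq> 0" "ord z \<noteq> 0" using ord_pos[of "inv m"] ord_pos[of z] G z by auto
    ultimately have "prime_factors (ord r) \<subseteq> prime_factors (ord (inv m) * ord z)" by (intro dvd_prime_factors) auto
    also have "\<dots> = prime_factors (ord (inv m)) \<union> prime_factors (ord z)" by (rule prime_factors_product[OF pos])
    also have "\<dots> \<subseteq> \<sigma>" using M(3) mr(1) z(2) G(1) by auto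
    finally have "prime_factors (ord r) = {}" using N(3) mr(2) by blast
    then have "ord r = 1" using ord_pos[OF G(2)] by (auto simp: prime_factorization_empty_iff)
    then have "r = \<one>" using ord_eq_1[OF G(2)] by simp
    then show ?thesis using mr G by simp
  qed
  have "x \<otimes> y \<in> M" using subgroup.m_closed[OF M(1) inM[OF x] inM[OF y]] .
  then show ?thesis using M(3) by blast
qed

text \<open>A nontrivial central element of one nontrivial Sylow subgroup commutes with the others
  because of coprime orders, so its centralizer contains every chosen Sylow subgroup.\<close>

lemma center_nontrivial:
  assumes "carrier G \<noteq> {\<one>}"
  shows "\<exists>z\<in>carrier G. z \<noteq> \<one> \<and> (\<forall>x\<in>carrier G. x \<otimes> z = z \<otimes> x)"
proof -
  have "order G \<noteq> 1" using assms order_one_triv_iff by simp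
  then obtain p where p: "Factorial_Ring.prime p" "p dvd order G" using prime_factor_nat[of "order G"] by auto
  note P = syl(1)[OF p(1)]
  have "multiplicity p (order G) > 0"
    using p order_pos by (simp add: prime_multiplicity_gt_zero_iff)
  moreover have "order (G\<lparr>carrier := syl p\<rparr>) = p ^ multiplicity p (order G)"
    using syl(2)[OF p(1)] by (simp add: order_def)
  ultimately have "\<exists>z\<in>syl p. z \<noteq> \<one> \<and> (\<forall>x\<in>syl p. x \<otimes> z = z \<otimes> x)"
    using group.center_nontrivial_prime_power_order[OF subgroup_imp_group[OF P] _ _ p(1), of "multiplicity p (order G)"]
    by simp
  then obtain z where z: "z \<in> syl p" "z \<noteq> \<one>" "\<And>x. x \<in> syl p \<Longrightarrow> x \<otimes> z = z \<otimes> x"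
    by auto
  have zG: "z \<in> carrier G" using z subgroup.subset[OF P] by auto
  let ?C = "{c \<in> carrier G. c \<otimes> z = z \<otimes> c}"
  have "subgroup ?C G"
  proof (rule subgroupI)
    show "?C \<noteq> {}" using zG by (auto intro!: exI[of _ \<one>])
  next
    fix a assume "a \<in> ?C" then show "inv a \<in> ?C" using commute_inv[OF _ _ zG, of a] by simp
  next
    fix a b assume "a \<in> ?C" "b \<in> ?C" then show "a \<otimes> b \<in> ?C" using commute_mult[OF _ _ _ _ zG, of a b] by simp
  qed auto
  moreover have "syl q \<subseteq> ?C" if q: "Factorial_Ring.prime q" for q
  proof
    fix x assume x: "x \<in> syl q"
    have xG: "x \<in> carrier G" using x subgroup.subset[OF syl(1)[OF q]] by auto
    show "x \<in> ?C"
    proof (cases "q = p")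
      case True then show ?thesis using z(3) x xG by simp
    next
      case False
      then have "prime_factors (ord x) \<inter> prime_factors (ord z) = {}"
        using syl_ord[OF q x] syl_ord[OF p(1) z(1)] by blast
      then show ?thesis using cc[OF xG zG] xG by simp
    qed
  qed
  ultimately have "?C = carrier G" by (intro full_subgroup) auto
  then show ?thesis using z(2) zG by blast
qed

end

section \<open>Coprime elements of nilpotent groups\<close>

lemma (in group) lower_central_normal: "lower_central G n \<lhd> G"
proof (induction n)
  case 0 show ?case using normal_self by simp
next
  case (Suc n)
  let ?S = "{inv x \<otimes> inv y \<otimes> x \<otimes> y | x y. x \<in> lower_central G n \<and> y \<in> carrier G}"
  have LG: "x \<in> carrier G" if "x \<in> lower_central G n" for x
    using that subgroup.subset[OF normal_imp_subgroup[OF Suc]] by auto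
  have "generate G ?S \<lhd> G"
  proof (rule normal_generateI)
    show "?S \<subseteq> carrier G" using LG by auto
  next
    fix h g assume "h \<in> ?S" and g: "g \<in> carrier G"
    then obtain x y where xy: "x \<in> lower_central G n" "y \<in> carrier G" "h = inv x \<otimes> inv y \<otimes> x \<otimes> y" by blast
    note G = LG[OF xy(1)] xy(2) g
    have "g \<otimes> h \<otimes> inv g = inv (g \<otimes> x \<otimes> inv g) \<otimes> inv (g \<otimes> y \<otimes> inv g) \<otimes> (g \<otimes> x \<otimes> inv g) \<otimes> (g \<otimes> y \<otimes> inv g)"
      unfolding xy(3) using G by (simp add: gsimps)
    moreover have "g \<otimes> x \<otimes> inv g \<in> lower_central G n" by (rule conj_mem(1)[OF Suc xy(1) g])
    moreover have "g \<otimes> y \<otimes> inv g \<in> carrier G" using G by simp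
    ultimately show "g \<otimes> h \<otimes> inv g \<in> ?S" by blast
  qed
  then show ?case by simp
qed

lemma (in group) lower_central_commutator:
  assumes "x \<in> lower_central G n" "y \<in> carrier G"
  shows "inv x \<otimes> inv y \<otimes> x \<otimes> y \<in> lower_central G (Suc n)"
  using assms by (auto intro!: generate.incl)

lemma (in group) central_commutator_pow:
  assumes x: "x \<in> carrier G" and y: "y \<in> carrier G" and c: "c \<in> carrier G" "c \<otimes> x = x \<otimes> c" "x \<otimes> y = y \<otimes> x \<otimes> c"
  shows "x [^] (k::nat) \<otimes> y = y \<otimes> x [^] k \<otimes> c [^] k"
proof (induction k)
  case 0 then show ?case using y by simp
next
  case (Suc k)
  have ck: "c [^] k \<otimes> x = x \<otimes> c [^] k"
    using x c(1) c(2) by (induction k) (simp_all add: commute_mult)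
  have "x [^] Suc k \<otimes> y = x [^] k \<otimes> y \<otimes> x \<otimes> c" using x y c by (simp add: m_assoc)
  also have "\<dots> = y \<otimes> x [^] k \<otimes> (c [^] k \<otimes> x) \<otimes> c" unfolding Suc using x y c by (simp add: m_assoc)
  also have "\<dots> = y \<otimes> x [^] Suc k \<otimes> c [^] Suc k" unfolding ck using x y c by (simp add: m_assoc)
  finally show ?case .
qed

text \<open>A central commutator turns powers of \<open>x\<close> or of \<open>y\<close> into powers
  of \<open>c\<close>. Hence the order of \<open>c\<close> divides both \<open>a\<close> and
  \<open>b\<close>.\<close>

lemma (in group) central_commutator_coprime:
  assumes x: "x \<in> carrier G" "x [^] a = \<one>" and y: "y \<in> carrier G" "y [^] b = \<one>" and c: "c \<in> carrier G"
    and central: "\<And>z. z \<in> carrier G \<Longrightarrow> c \<otimes> z = z \<otimes> c" and xyc: "x \<otimes> y = y \<otimes> x \<otimes> c"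
    and ab: "coprime (a::nat) b"
  shows "c = \<one>"
proof -
  have "x [^] a \<otimes> y = y \<otimes> x [^] a \<otimes> c [^] a"
    by (rule central_commutator_pow[OF x(1) y(1) c central[OF x(1)] xyc])
  then have ca: "c [^] a = \<one>" using x y c by simp
  have "y \<otimes> x = (y \<otimes> x \<otimes> c) \<otimes> inv c" using x(1) y(1) c by (simp add: gsimps)
  then have yxc: "y \<otimes> x = x \<otimes> y \<otimes> inv c" by (simp add: xyc)
  have "inv c \<otimes> y = y \<otimes> inv c" by (rule commute_inv[OF central[OF y(1)] c y(1)])
  then have "y [^] b \<otimes> x = x \<otimes> y [^] b \<otimes> inv c [^] b"
    using central_commutator_pow[OF y(1) x(1) _ _ yxc] c by simp
  then have "inv c [^] b = \<one>" using x y c by simp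
  then have cb: "c [^] b = \<one>" using c by (simp add: nat_pow_inv)
  have "ord c dvd a" "ord c dvd b" using pow_eq_id[OF c] ca cb by simp_all
  then have "ord c dvd 1" using ab by (meson coprime_common_divisor)
  then show ?thesis using ord_eq_1[OF c] by simp
qed

text \<open>The commutator of \<open>x\<close> and \<open>y\<close> descends the lower central
  series: if it lies in one term, it is central modulo the next term, and
  \<open>central_commutator_coprime\<close> in that quotient makes it trivial there.\<close>

lemma (in group) nilpotent_coprime_commute:
  assumes nil: "nilpotent_group G" and x: "x \<in> carrier G" "x [^] a = \<one>" and y: "y \<in> carrier G" "y [^] b = \<one>"
    and ab: "coprime (a::nat) b"
  shows "x \<otimes> y = y \<otimes> x"
proof -
  define c where "c = inv x \<otimes> inv y \<otimes> x \<otimes> y"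
  have cG: "c \<in> carrier G" using x y by (simp add: c_def)
  have xyc: "x \<otimes> y = y \<otimes> x \<otimes> c" using x(1) y(1) by (simp add: c_def gsimps)
  have "c \<in> lower_central G n" for n
  proof (induction n)
    case 0 show ?case using cG by simp
  next
    case (Suc n)
    define L where "L = lower_central G (Suc n)"
    have L: "L \<lhd> G" unfolding L_def by (rule lower_central_normal)
    note sL = normal_imp_subgroup[OF L]
    define Q where "Q = G Mod L"
    define h where "h z = L #> z" for z
    interpret q: group_hom G Q h
      using normal.r_coset_hom_Mod[OF L] normal.factorgroup_is_group[OF L]
      by (simp add: group_hom_def group_hom_axioms_def Q_def h_def[abs_def])
    have central: "h c \<otimes>\<^bsub>Q\<^esub> A = A \<otimes>\<^bsub>Q\<^esub> h c" if A: "A \<in> carrier Q" for A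
    proof -
      obtain z where z: "z \<in> carrier G" "A = h z" using A by (auto simp: Q_def h_def carrier_FactGroup)
      have "inv c \<otimes> inv z \<otimes> c \<otimes> z \<in> L" unfolding L_def by (rule lower_central_commutator[OF Suc z(1)])
      then have "z \<otimes> c \<otimes> (inv c \<otimes> inv z \<otimes> c \<otimes> z) \<otimes> inv (z \<otimes> c) \<in> L"
        by (rule conj_mem(1)[OF L]) (use z cG in simp)
      then have "c \<otimes> z \<otimes> inv (z \<otimes> c) \<in> L" using z cG by (simp add: gsimps)
      then have "h (c \<otimes> z) = h (z \<otimes> c)"
        unfolding h_def using rcoset_eq_iff[OF sL, of "c \<otimes> z" "z \<otimes> c"] z cG by simp
      then show ?thesis using z cG by simp
    qed
    have "h (x \<otimes> y) = h (y \<otimes> x \<otimes> c)" using xyc by (rule arg_cong)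
    then have xyq: "h x \<otimes>\<^bsub>Q\<^esub> h y = h y \<otimes>\<^bsub>Q\<^esub> h x \<otimes>\<^bsub>Q\<^esub> h c" using x(1) y(1) cG by simp
    have "h x [^]\<^bsub>Q\<^esub> a = \<one>\<^bsub>Q\<^esub>" "h y [^]\<^bsub>Q\<^esub> b = \<one>\<^bsub>Q\<^esub>"
      using q.hom_nat_pow[OF x(1), of a] q.hom_nat_pow[OF y(1), of b] x(2) y(2) by simp_all
    then have "h c = \<one>\<^bsub>Q\<^esub>"
      using q.H.central_commutator_coprime[OF q.hom_closed[OF x(1)] _ q.hom_closed[OF y(1)] _ q.hom_closed[OF cG] central xyq ab]
      by simp
    then have "L #> c = L" by (simp add: h_def Q_def)
    then have "c \<in> L" using rcos_self[OF cG sL] by simp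
    then show ?case by (simp add: L_def)
  qed
  then have "c = \<one>" using nil unfolding nilpotent_group_def by auto
  then show ?thesis using xyc x(1) y(1) by simp
qed

section \<open>Nilpotency through central quotients\<close>

context coprime_commuting_group
begin

text \<open>The lift is the part of \<open>x\<close> at the primes of the order of its coset. It is
  the power \<open>x [^] (1 + r * v)\<close>, and \<open>r\<close> is a multiple of the order of the
  coset, so the coset does not change.\<close>

lemma lift_quotient_element:
  assumes Z: "Z \<lhd> G" and x: "x \<in> carrier G"
  shows "\<exists>a\<in>carrier G. Z #> a = Z #> x \<and> prime_factors (ord a) \<subseteq> prime_factors (group.ord (G Mod Z) (Z #> x))"
proof -
  interpret q: group_hom G "G Mod Z" "\<lambda>x. Z #> x"
      by (rule normal_quotient_hom[OF Z])
  let ?m = "q.H.ord (Z #> x)" and ?n = "ord x"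
  have qx: "Z #> x \<in> carrier (G Mod Z)" by (rule q.hom_closed[OF x])
  have "(Z #> x) [^]\<^bsub>G Mod Z\<^esub> ?n = \<one>\<^bsub>G Mod Z\<^esub>"
    using q.hom_nat_pow[OF x, of ?n] x q.hom_one by simp
  then have mn: "?m dvd ?n" using q.H.pow_eq_id[OF qx] by simp
  have npos: "?n > 0" by (rule ord_pos[OF x])
  then have mpos: "?m > 0" using mn by (auto intro: Nat.gr0I)
  obtain r s where rs: "?n = r * s" "prime_factors r \<subseteq> prime_factors ?m" "prime_factors s \<inter> prime_factors ?m = {}"
    using factor_by_primes[OF npos] by blast
  have pos: "r > 0" "s > 0" using rs(1) npos by auto
  have "coprime s r" by (rule coprime_prime_factors) (use pos rs in auto)
  then obtain u v where uv: "s * u = 1 + r * v" using ex_linear_combination pos by blast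
  have "coprime ?m s" by (rule coprime_prime_factors[OF mpos pos(2)]) (use rs in auto)
  then have "?m dvd r" using mn rs(1) by (simp add: coprime_dvd_mult_left_iff)
  then have mv: "?m dvd r * v" by simp
  define a where "a = x [^] (s * u)"
  have aG: "a \<in> carrier G" using x by (simp add: a_def)
  have "a [^] r = x [^] (s * u * r)" unfolding a_def by (rule nat_pow_pow[OF x])
  then have "a [^] r = \<one>" using pow_eq_id[OF x, of "s * u * r"] rs(1) by (simp add: mult_ac)
  then have "ord a dvd r" using pow_eq_id[OF aG] by simp
  then have "prime_factors (ord a) \<subseteq> prime_factors ?m" using rs(2) pos dvd_prime_factors[of r "ord a"] by auto
  moreover have "Z #> a = Z #> x"
  proof -
    have "Z #> a = (Z #> x) [^]\<^bsub>G Mod Z\<^esub> (1 + r * v)" unfolding a_def uv[symmetric] by (rule q.hom_nat_pow[OF x])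
    also have "\<dots> = (Z #> x) \<otimes>\<^bsub>G Mod Z\<^esub> (Z #> x) [^]\<^bsub>G Mod Z\<^esub> (r * v)"
      using q.H.nat_pow_mult[OF qx, of 1 "r * v"] qx q.H.nat_pow_eone[OF qx] by (simp del: mult_FactGroup)
    also have "\<dots> = Z #> x" using q.H.pow_eq_id[OF qx, of "r * v"] mv qx by (simp del: mult_FactGroup one_FactGroup)
    finally show ?thesis .
  qed
  ultimately show ?thesis using aG by blast
qed

lemma quotient_coprime_commuting:
  assumes Z: "Z \<lhd> G"
  shows "coprime_commuting_group (G Mod Z)"
proof -
  interpret q: group_hom G "G Mod Z" "\<lambda>x. Z #> x"
      by (rule normal_quotient_hom[OF Z])
  show ?thesis
  proof (unfold_locales)
    show "finite (carrier (G Mod Z))" using fin by (simp add: carrier_FactGroup)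
    fix A B assume A: "A \<in> carrier (G Mod Z)" and B: "B \<in> carrier (G Mod Z)"
      and disj: "prime_factors (q.H.ord A) \<inter> prime_factors (q.H.ord B) = {}"
    obtain x where x: "x \<in> carrier G" "A = Z #> x" using A by (auto simp: carrier_FactGroup)
    obtain y where y: "y \<in> carrier G" "B = Z #> y" using B by (auto simp: carrier_FactGroup)
    obtain a where a: "a \<in> carrier G" "Z #> a = A" "prime_factors (ord a) \<subseteq> prime_factors (q.H.ord A)"
      using lift_quotient_element[OF Z x(1)] x(2) by blast
    obtain b where b: "b \<in> carrier G" "Z #> b = B" "prime_factors (ord b) \<subseteq> prime_factors (q.H.ord B)"
      using lift_quotient_element[OF Z y(1)] y(2) by blast
    have "a \<otimes> b = b \<otimes> a" by (rule cc[OF a(1) b(1)]) (use a(3) b(3) disj in blast)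
    then show "A \<otimes>\<^bsub>G Mod Z\<^esub> B = B \<otimes>\<^bsub>G Mod Z\<^esub> A"
      using q.hom_mult[OF a(1) b(1)] q.hom_mult[OF b(1) a(1)] a(2) b(2) by simp
  qed
qed

text \<open>\<open>Z'\<close> is the preimage of the centre of \<open>G Mod Z\<close>, which is
  nontrivial by \<open>center_nontrivial\<close> in the quotient.\<close>

lemma ex_larger_central:
  assumes Z: "Z \<lhd> G" and ne: "Z \<noteq> carrier G"
  shows "\<exists>Z'. Z' \<lhd> G \<and> Z \<subset> Z' \<and> (\<forall>x\<in>Z'. \<forall>y\<in>carrier G. inv x \<otimes> inv y \<otimes> x \<otimes> y \<in> Z)"
proof -
  interpret Q: coprime_commuting_group "G Mod Z" by (rule quotient_coprime_commuting[OF Z])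
  interpret q: group_hom G "G Mod Z" "\<lambda>x. Z #> x"
      by (rule normal_quotient_hom[OF Z])
  note sZ = normal_imp_subgroup[OF Z]
  have ZG: "Z \<subseteq> carrier G" by (rule subgroup.subset[OF sZ])
  have qone: "Z #> z = Z \<longleftrightarrow> z \<in> Z" if "z \<in> carrier G" for z
    using rcoset_eq_iff[OF sZ that one_closed] that ZG by (simp add: coset_mult_one)
  define Z' where "Z' = {x \<in> carrier G. \<forall>y\<in>carrier G. inv x \<otimes> inv y \<otimes> x \<otimes> y \<in> Z}"
  have Z'_iff: "x \<in> Z' \<longleftrightarrow> x \<in> carrier G \<and> (\<forall>y\<in>carrier G. (Z #> x) \<otimes>\<^bsub>G Mod Z\<^esub> (Z #> y) = (Z #> y) \<otimes>\<^bsub>G Mod Z\<^esub> (Z #> x))" for x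
  proof -
    have "inv x \<otimes> inv y \<otimes> x \<otimes> y \<in> Z \<longleftrightarrow> (Z #> x) \<otimes>\<^bsub>G Mod Z\<^esub> (Z #> y) = (Z #> y) \<otimes>\<^bsub>G Mod Z\<^esub> (Z #> x)"
      if xy: "x \<in> carrier G" "y \<in> carrier G" for y
    proof -
      have "inv x \<otimes> inv y \<otimes> x \<otimes> y \<in> Z \<longleftrightarrow> x \<otimes> y \<otimes> inv (y \<otimes> x) \<in> Z"
      proof
        assume "inv x \<otimes> inv y \<otimes> x \<otimes> y \<in> Z"
        then have "(y \<otimes> x) \<otimes> (inv x \<otimes> inv y \<otimes> x \<otimes> y) \<otimes> inv (y \<otimes> x) \<in> Z" by (rule conj_mem(1)[OF Z]) (use xy in simp)
        then show "x \<otimes> y \<otimes> inv (y \<otimes> x) \<in> Z" using xy by (simp add: gsimps)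
      next
        assume "x \<otimes> y \<otimes> inv (y \<otimes> x) \<in> Z"
        then have "inv (y \<otimes> x) \<otimes> (x \<otimes> y \<otimes> inv (y \<otimes> x)) \<otimes> (y \<otimes> x) \<in> Z" by (rule conj_mem(2)[OF Z]) (use xy in simp)
        then show "inv x \<otimes> inv y \<otimes> x \<otimes> y \<in> Z" using xy by (simp add: gsimps)
      qed
      also have "\<dots> \<longleftrightarrow> Z #> (x \<otimes> y) = Z #> (y \<otimes> x)"
        using rcoset_eq_iff[OF sZ, of "x \<otimes> y" "y \<otimes> x"] xy by simp
      also have "\<dots> \<longleftrightarrow> (Z #> x) \<otimes>\<^bsub>G Mod Z\<^esub> (Z #> y) = (Z #> y) \<otimes>\<^bsub>G Mod Z\<^esub> (Z #> x)"
        using q.hom_mult[OF xy] q.hom_mult[OF xy(2,1)] by simp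
      finally show ?thesis .
    qed
    then show ?thesis unfolding Z'_def by blast
  qed
  have qc: "Z #> x \<in> carrier (G Mod Z)" if "x \<in> carrier G" for x by (rule q.hom_closed[OF that])
  have "Z' \<lhd> G"
  proof (rule normal_invI)
    show "subgroup Z' G"
    proof (rule subgroupI)
      show "Z' \<noteq> {}" using subgroup.one_closed[OF sZ] by (auto simp: Z'_def intro!: exI[of _ \<one>])
    next
      fix a assume a: "a \<in> Z'"
      then have aG: "a \<in> carrier G" by (simp add: Z'_iff)
      have "(Z #> inv a) \<otimes>\<^bsub>G Mod Z\<^esub> (Z #> y) = (Z #> y) \<otimes>\<^bsub>G Mod Z\<^esub> (Z #> inv a)" if y: "y \<in> carrier G" for y
        using Q.commute_inv[OF _ qc[OF aG] qc[OF y]] a y q.hom_inv[OF aG] unfolding Z'_iff by simp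
      then show "inv a \<in> Z'" using aG unfolding Z'_iff by simp
    next
      fix a b assume a: "a \<in> Z'" and b: "b \<in> Z'"
      then have G: "a \<in> carrier G" "b \<in> carrier G" by (simp_all add: Z'_iff)
      have "(Z #> (a \<otimes> b)) \<otimes>\<^bsub>G Mod Z\<^esub> (Z #> y) = (Z #> y) \<otimes>\<^bsub>G Mod Z\<^esub> (Z #> (a \<otimes> b))" if y: "y \<in> carrier G" for y
        unfolding q.hom_mult[OF G]
      proof (rule Q.commute_mult[OF _ _ qc[OF G(1)] qc[OF G(2)] qc[OF y]])
        show "(Z #> a) \<otimes>\<^bsub>G Mod Z\<^esub> (Z #> y) = (Z #> y) \<otimes>\<^bsub>G Mod Z\<^esub> (Z #> a)" using a y unfolding Z'_iff by blast
        show "(Z #> b) \<otimes>\<^bsub>G Mod Z\<^esub> (Z #> y) = (Z #> y) \<otimes>\<^bsub>G Mod Z\<^esub> (Z #> b)" using b y unfolding Z'_iff by blast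
      qed
      then show "a \<otimes> b \<in> Z'" using G unfolding Z'_iff by simp
    qed (auto simp: Z'_def)
  next
    fix g h assume g: "g \<in> carrier G" and h: "h \<in> Z'"
    then have hG: "h \<in> carrier G" by (simp add: Z'_iff)
    have "(Z #> h) \<otimes>\<^bsub>G Mod Z\<^esub> (Z #> g) = (Z #> g) \<otimes>\<^bsub>G Mod Z\<^esub> (Z #> h)" using h g unfolding Z'_iff by blast
    then have "Z #> (g \<otimes> h) = Z #> (h \<otimes> g)" using q.hom_mult[OF g hG] q.hom_mult[OF hG g] by simp
    then have "Z #> (g \<otimes> h \<otimes> inv g) = Z #> (h \<otimes> g \<otimes> inv g)"
      using q.hom_mult[of "g \<otimes> h" "inv g"] q.hom_mult[of "h \<otimes> g" "inv g"] g hG by simp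
    then have "Z #> (g \<otimes> h \<otimes> inv g) = Z #> h" using g hG by (simp add: m_assoc)
    then show "g \<otimes> h \<otimes> inv g \<in> Z'" using h g hG unfolding Z'_iff by simp
  qed
  moreover have "Z \<subseteq> Z'"
  proof
    fix x assume x: "x \<in> Z"
    then have xG: "x \<in> carrier G" using ZG by auto
    have "inv x \<otimes> (inv y \<otimes> x \<otimes> y) \<in> Z" if y: "y \<in> carrier G" for y
      by (rule subgroup.m_closed[OF sZ subgroup.m_inv_closed[OF sZ x] conj_mem(2)[OF Z x y]])
    then show "x \<in> Z'" using xG by (auto simp: Z'_def m_assoc)
  qed
  moreover have "Z \<noteq> Z'"
  proof -
    obtain g where g: "g \<in> carrier G" "g \<notin> Z" using ne ZG by auto
    have "carrier (G Mod Z) \<noteq> {\<one>\<^bsub>G Mod Z\<^esub>}" using qc[OF g(1)] qone[OF g(1)] g(2) by auto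
    then obtain A where A: "A \<in> carrier (G Mod Z)" "A \<noteq> \<one>\<^bsub>G Mod Z\<^esub>"
      "\<forall>B\<in>carrier (G Mod Z). B \<otimes>\<^bsub>G Mod Z\<^esub> A = A \<otimes>\<^bsub>G Mod Z\<^esub> B" using Q.center_nontrivial by blast
    obtain a where a: "a \<in> carrier G" "A = Z #> a" using A(1) by (auto simp: carrier_FactGroup)
    have "a \<notin> Z" using A(2) a qone[OF a(1)] by simp
    moreover have "a \<in> Z'" unfolding Z'_iff using A(3) a qc by simp
    ultimately show ?thesis by blast
  qed
  moreover have "\<forall>x\<in>Z'. \<forall>y\<in>carrier G. inv x \<otimes> inv y \<otimes> x \<otimes> y \<in> Z" by (simp add: Z'_def)
  ultimately show ?thesis by (intro exI[of _ Z']) blast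
qed

text \<open>Descent from \<open>carrier G\<close> along the preimages of centres: since commutators
  of \<open>Z'\<close> with \<open>G\<close> lie in \<open>Z\<close>, one more step of the lower
  central series passes from \<open>Z'\<close> to \<open>Z\<close>. The trivial subgroup is the case
  of interest.\<close>

lemma nilpotent: "nilpotent_group G"
proof -
  have "Z \<lhd> G \<Longrightarrow> \<exists>n. lower_central G n \<subseteq> Z" for Z
  proof (induction "card (carrier G) - card Z" arbitrary: Z rule: less_induct)
    case less
    note Z = \<open>Z \<lhd> G\<close>
    show ?case
    proof (cases "Z = carrier G")
      case True then show ?thesis by (intro exI[of _ 0]) simp
    next
      case False
      obtain Z' where Z': "Z' \<lhd> G" "Z \<subset> Z'" "\<forall>x\<in>Z'. \<forall>y\<in>carrier G. inv x \<otimes> inv y \<otimes> x \<otimes> y \<in> Z"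
        using ex_larger_central[OF Z False] by blast
      have Z'G: "Z' \<subseteq> carrier G" by (rule subgroup.subset[OF normal_imp_subgroup[OF Z'(1)]])
      have "card Z < card Z'" using Z'(2) finite_subset[OF Z'G fin] by (rule psubset_card_mono[rotated])
      moreover have "card Z' \<le> card (carrier G)" by (rule card_mono[OF fin Z'G])
      ultimately have "card (carrier G) - card Z' < card (carrier G) - card Z" by linarith
      then obtain n where n: "lower_central G n \<subseteq> Z'" using less.hyps Z'(1) by blast
      have "lower_central G (Suc n) \<subseteq> Z"
        unfolding lower_central.simps
        by (rule generate_subgroup_incl[OF _ normal_imp_subgroup[OF Z]]) (use Z'(3) n in blast)
      then show ?thesis by blast
    qed
  qed
  then obtain n where n: "lower_central G n \<subseteq> {\<one>}" using one_is_normal by blast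
  moreover have "\<one> \<in> lower_central G n"
    by (rule subgroup.one_closed[OF normal_imp_subgroup[OF lower_central_normal]])
  ultimately show ?thesis unfolding nilpotent_group_def using group_axioms by blast
qed

end

section \<open>Transfer and Dietzmann's lemma\<close>

text \<open>The transfer sends \<open>g\<close> to the product of
  \<open>\<phi> (s b \<otimes> g \<otimes> inv (s (b #> g)))\<close> over all cosets
  \<open>b\<close>. It is multiplicative by the cocycle identity and because translation permutes
  the cosets. An element \<open>d\<close> of \<open>D\<close> fixes every coset, as \<open>D\<close>
  is normal by \<open>inv\<close>, so each factor is \<phi> of a conjugate of \<open>d\<close>, that
  is \<open>\<phi> d\<close>.\<close>

lemma (in group) transfer_hom:
  assumes D: "subgroup D G" and fin: "finite (rcosets D)" and A: "comm_group A"
    and \<phi>: "\<And>d. d \<in> D \<Longrightarrow> \<phi> d \<in> carrier A"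
      "\<And>d e. \<lbrakk>d \<in> D; e \<in> D\<rbrakk> \<Longrightarrow> \<phi> (d \<otimes> e) = \<phi> d \<otimes>\<^bsub>A\<^esub> \<phi> e"
    and inv: "\<And>d g. \<lbrakk>d \<in> D; g \<in> carrier G\<rbrakk> \<Longrightarrow> g \<otimes> d \<otimes> inv g \<in> D \<and> \<phi> (g \<otimes> d \<otimes> inv g) = \<phi> d"
  shows "\<exists>\<tau>\<in>hom G A. \<forall>d\<in>D. \<tau> d = \<phi> d [^]\<^bsub>A\<^esub> card (rcosets D)"
proof -
  interpret A: comm_group A by (rule A)
  let ?R = "rcosets D"
  define s where "s b = (SOME x. x \<in> b)" for b :: "'a set"
  have rep: "s b \<in> carrier G \<and> b = D #> s b" if b: "b \<in> ?R" for b
  proof -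
    obtain g where g: "g \<in> carrier G" "b = D #> g" using b by (auto simp: RCOSETS_def)
    have "g \<in> b" using rcos_self[OF g(1) D] g(2) by simp
    then have sb: "s b \<in> b" unfolding s_def by (rule someI)
    then have "s b \<in> carrier G" using r_coset_subset_G[OF subgroup.subset[OF D] g(1)] g(2) by auto
    moreover have "D #> g = D #> s b" using repr_independence[OF _ g(1) D, of "s b"] sb g(2) by simp
    then have "b = D #> s b" by (rule trans[OF g(2)])
    ultimately show ?thesis by (rule conjI)
  qed
  have sG: "s b \<in> carrier G" if "b \<in> ?R" for b using rep[OF that] by simp
  have act: "b #> g \<in> ?R" "b #> g = D #> (s b \<otimes> g)" if "b \<in> ?R" "g \<in> carrier G" for b g
  proof -
    show e: "b #> g = D #> (s b \<otimes> g)"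
      using rep[OF that(1)] coset_mult_assoc[OF subgroup.subset[OF D], of "s b" g] that(2) by simp
    show "b #> g \<in> ?R" unfolding e using rep[OF that(1)] that(2) by (intro rcosetsI subgroup.subset[OF D]) simp
  qed
  define f where "f g b = s b \<otimes> g \<otimes> inv (s (b #> g))" for g b
  have fD: "f g b \<in> D" if "b \<in> ?R" "g \<in> carrier G" for g b
  proof -
    have "D #> (s b \<otimes> g) = D #> s (b #> g)" using rep[OF act(1)[OF that]] act(2)[OF that] by simp
    then show ?thesis
      unfolding f_def using rcoset_eq_iff[OF D, of "s b \<otimes> g" "s (b #> g)"] sG[OF that(1)] sG[OF act(1)[OF that]] that(2)
      by simp
  qed
  have cocycle: "f (g \<otimes> h) b = f g b \<otimes> f h (b #> g)" if "b \<in> ?R" "g \<in> carrier G" "h \<in> carrier G" for g h b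
  proof -
    have "b \<subseteq> carrier G" using that(1) rcosets_part_G[OF D] by auto
    then have "(b #> g) #> h = b #> (g \<otimes> h)" by (rule coset_mult_assoc[OF _ that(2,3)])
    then show ?thesis
      unfolding f_def using sG[OF that(1)] sG[OF act(1)[OF that(1,2)]] sG[OF act(1)[OF act(1)[OF that(1,2)] that(3)]] that(2,3)
      by (simp add: gsimps)
  qed
  define \<tau> where "\<tau> g = finprod A (\<lambda>b. \<phi> (f g b)) ?R" for g
  have \<phi>f: "(\<lambda>b. \<phi> (f g b)) \<in> ?R \<rightarrow> carrier A" if "g \<in> carrier G" for g
    using \<phi>(1) fD that by auto
  have bij: "inj_on (\<lambda>b. b #> g) ?R" "(\<lambda>b. b #> g) ` ?R = ?R" if g: "g \<in> carrier G" for g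
  proof -
    have undo: "(b #> g) #> inv g = b" "(b #> inv g) #> g = b" if b: "b \<in> ?R" for b
    proof -
      have "b \<subseteq> carrier G" using b rcosets_part_G[OF D] by auto
      then show "(b #> g) #> inv g = b" "(b #> inv g) #> g = b"
        using coset_mult_assoc[of b g "inv g"] coset_mult_assoc[of b "inv g" g] g by simp_all
    qed
    show "inj_on (\<lambda>b. b #> g) ?R" by (rule inj_on_inverseI[of _ "\<lambda>b. b #> inv g"]) (rule undo)
    show "(\<lambda>b. b #> g) ` ?R = ?R"
    proof
      show "(\<lambda>b. b #> g) ` ?R \<subseteq> ?R" using act(1)[OF _ g] by blast
      show "?R \<subseteq> (\<lambda>b. b #> g) ` ?R"
      proof
        fix b assume b: "b \<in> ?R"
        show "b \<in> (\<lambda>b. b #> g) ` ?R"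
          by (rule image_eqI[of _ _ "b #> inv g"]) (use undo(2)[OF b] act(1)[OF b, of "inv g"] g in simp_all)
      qed
    qed
  qed
  have "\<tau> \<in> hom G A"
  proof (rule homI)
    fix g assume "g \<in> carrier G" then show "\<tau> g \<in> carrier A"
      unfolding \<tau>_def by (intro A.finprod_closed \<phi>f)
  next
    fix g h assume gh: "g \<in> carrier G" "h \<in> carrier G"
    have 1: "(\<lambda>b. \<phi> (f h (b #> g))) \<in> ?R \<rightarrow> carrier A" using \<phi>(1) fD[OF act(1)[OF _ gh(1)] gh(2)] by simp
    have "\<tau> (g \<otimes> h) = finprod A (\<lambda>b. \<phi> (f g b) \<otimes>\<^bsub>A\<^esub> \<phi> (f h (b #> g))) ?R"
      unfolding \<tau>_def
    proof (rule A.finprod_cong'[OF refl])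
      show "(\<lambda>b. \<phi> (f g b) \<otimes>\<^bsub>A\<^esub> \<phi> (f h (b #> g))) \<in> ?R \<rightarrow> carrier A"
        using 1 \<phi>f[OF gh(1)] by (simp add: Pi_iff)
      fix b assume b: "b \<in> ?R"
      show "\<phi> (f (g \<otimes> h) b) = \<phi> (f g b) \<otimes>\<^bsub>A\<^esub> \<phi> (f h (b #> g))"
        unfolding cocycle[OF b gh] by (rule \<phi>(2)[OF fD[OF b gh(1)] fD[OF act(1)[OF b gh(1)] gh(2)]])
    qed
    also have "\<dots> = \<tau> g \<otimes>\<^bsub>A\<^esub> finprod A (\<lambda>b. \<phi> (f h (b #> g))) ?R"
      unfolding \<tau>_def by (rule A.finprod_multf[OF \<phi>f[OF gh(1)] 1])
    also have "finprod A (\<lambda>b. \<phi> (f h (b #> g))) ?R = finprod A (\<lambda>b. \<phi> (f h b)) ((\<lambda>b. b #> g) ` ?R)"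
      by (rule A.finprod_reindex[symmetric]) (use \<phi>f[OF gh(2)] bij[OF gh(1)] in simp_all)
    also have "\<dots> = \<tau> h" unfolding bij(2)[OF gh(1)] \<tau>_def ..
    finally show "\<tau> (g \<otimes> h) = \<tau> g \<otimes>\<^bsub>A\<^esub> \<tau> h" .
  qed
  moreover have "\<tau> d = \<phi> d [^]\<^bsub>A\<^esub> card ?R" if d: "d \<in> D" for d
  proof -
    have dG: "d \<in> carrier G" using d subgroup.subset[OF D] by auto
    have "\<phi> (f d b) = \<phi> d" if b: "b \<in> ?R" for b
    proof -
      have sb: "s b \<in> carrier G" "b = D #> s b" using rep[OF b] by auto
      have "s b \<otimes> d \<otimes> inv (s b) \<in> D" using inv[OF d sb(1)] by simp
      then have "D #> (s b \<otimes> d) = D #> s b" using rcoset_eq_iff[OF D, of "s b \<otimes> d" "s b"] sb(1) dG by simp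
      then have "b #> d = b" using act(2)[OF b dG] sb(2) by simp
      then show ?thesis unfolding f_def using inv[OF d sb(1)] by simp
    qed
    then have "\<tau> d = finprod A (\<lambda>b. \<phi> d) ?R"
      unfolding \<tau>_def using \<phi>(1)[OF d] by (intro A.finprod_cong') auto
    also have "\<dots> = \<phi> d [^]\<^bsub>A\<^esub> card ?R" by (rule A.finprod_const[OF \<phi>(1)[OF d]])
    finally show ?thesis .
  qed
  ultimately show ?thesis by blast
qed

section \<open>Words and Dietzmann's lemma\<close>

context group
begin

definition lprod :: "'a list \<Rightarrow> 'a" where
  "lprod xs = foldr (\<otimes>) xs \<one>"

lemma lprod_simps [simp]: "lprod [] = \<one>" "lprod (x # xs) = x \<otimes> lprod xs"
  by (simp_all add: lprod_def)

lemma lprod_closed: "set xs \<subseteq> carrier G \<Longrightarrow> lprod xs \<in> carrier G"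
  by (induction xs) auto

lemma lprod_append: "set xs \<subseteq> carrier G \<Longrightarrow> set ys \<subseteq> carrier G \<Longrightarrow> lprod (xs @ ys) = lprod xs \<otimes> lprod ys"
  by (induction xs) (simp_all add: lprod_closed m_assoc)

text \<open>Pulling copies of \<open>c\<close> to the front conjugates the letters that are passed
  by powers of \<open>c\<close>, and these conjugates stay in \<open>S\<close>. The exact length
  count is what lets a word shrink once \<open>c [^] j = \<one>\<close>.\<close>

lemma lprod_move_front:
  assumes S: "S \<subseteq> carrier G" "\<And>a b. \<lbrakk>a \<in> S; b \<in> S\<rbrakk> \<Longrightarrow> inv b \<otimes> a \<otimes> b \<in> S" and c: "c \<in> S"
  shows "\<lbrakk>set xs \<subseteq> S; j \<le> count_list xs c\<rbrakk> \<Longrightarrow>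
    \<exists>ys. set ys \<subseteq> S \<and> length ys + j = length xs \<and> lprod xs = c [^] j \<otimes> lprod ys"
proof (induction xs arbitrary: j)
  case Nil then show ?case by (intro exI[of _ "[]"]) simp
next
  case (Cons x xs)
  have G: "x \<in> carrier G" "c \<in> carrier G" "x \<in> S" using Cons.prems S(1) c by auto
  have cj: "c [^] j \<in> carrier G" using G by simp
  have xsS: "set xs \<subseteq> S" using Cons.prems(1) by simp
  show ?case
  proof (cases "x = c \<and> j > 0")
    case True
    then obtain i where i: "j = Suc i" using gr0_implies_Suc by blast
    then have "i \<le> count_list xs c" using Cons.prems True by simp
    then obtain ys where ys: "set ys \<subseteq> S" "length ys + i = length xs" "lprod xs = c [^] i \<otimes> lprod ys"
      using Cons.IH[OF xsS] by blast
    have "lprod ys \<in> carrier G" using lprod_closed ys(1) S(1) by auto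
    then have "lprod (x # xs) = c [^] j \<otimes> lprod ys"
      using ys(3) True i G nat_pow_Suc2[of c i] by (simp add: m_assoc)
    then show ?thesis using ys i by (intro exI[of _ ys]) simp
  next
    case False
    show ?thesis
    proof (cases "j = 0")
      case True
      have "lprod (x # xs) \<in> carrier G" using Cons.prems S(1) by (intro lprod_closed) auto
      then show ?thesis using True Cons.prems by (intro exI[of _ "x # xs"]) simp
    next
      case False
      then have "j \<le> count_list xs c" using Cons.prems \<open>\<not> (x = c \<and> j > 0)\<close> by auto
      then obtain ys where ys: "set ys \<subseteq> S" "length ys + j = length xs" "lprod xs = c [^] j \<otimes> lprod ys"
        using Cons.IH[OF xsS] by blast
      have conj: "inv (c [^] i) \<otimes> x \<otimes> c [^] i \<in> S" for i :: nat
      proof (induction i)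
        case 0 then show ?case using G by simp
      next
        case (Suc i)
        have "inv c \<otimes> (inv (c [^] i) \<otimes> x \<otimes> c [^] i) \<otimes> c \<in> S" by (rule S(2)[OF Suc c])
        then show ?case using G by (simp add: gsimps)
      qed
      have yG: "lprod ys \<in> carrier G" using lprod_closed ys(1) S(1) by auto
      have "lprod (x # xs) = c [^] j \<otimes> ((inv (c [^] j) \<otimes> x \<otimes> c [^] j) \<otimes> lprod ys)"
        using ys(3) G cj yG by (simp add: gsimps)
      then show ?thesis using ys conj[of j] by (intro exI[of _ "(inv (c [^] j) \<otimes> x \<otimes> c [^] j) # ys"]) simp
    qed
  qed
qed

text \<open>In a word longer than \<open>card S * k\<close> some letter occurs at least
  \<open>k\<close> times; moved to the front, \<open>k\<close> copies of it cancel. Inverses are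
  \<open>(k - 1)\<close>-th powers, so every element of the generated subgroup is a word in
  \<open>S\<close> of bounded length.\<close>

theorem dietzmann:
  assumes S: "S \<subseteq> carrier G" "finite S" "\<And>a b. \<lbrakk>a \<in> S; b \<in> S\<rbrakk> \<Longrightarrow> inv b \<otimes> a \<otimes> b \<in> S"
    and k: "k > 0" "\<And>a. a \<in> S \<Longrightarrow> a [^] (k::nat) = \<one>"
  shows "finite (generate G S)"
proof -
  have short: "\<exists>ys. set ys \<subseteq> S \<and> length ys \<le> card S * k \<and> lprod xs = lprod ys" if "set xs \<subseteq> S" for xs
    using that
  proof (induction "length xs" arbitrary: xs rule: less_induct)
    case less
    show ?case
    proof (cases "length xs \<le> card S * k")
      case True then show ?thesis using less.prems by blast
    next
      case False
      have "\<exists>c\<in>S. k \<le> count_list xs c"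
      proof (rule ccontr)
        assume "\<not> ?thesis"
        then have "count_list xs c \<le> k" if "c \<in> S" for c using that by (auto simp: not_le)
        then have "sum (count_list xs) S \<le> card S * k" using sum_bounded_above[of S "count_list xs" k] by simp
        moreover have "length xs = sum (count_list xs) S"
          using less.prems S(2) by (simp add: sum_count_set)
        ultimately show False using False by simp
      qed
      then obtain c where c: "c \<in> S" "k \<le> count_list xs c" by blast
      obtain ys where ys: "set ys \<subseteq> S" "length ys + k = length xs" "lprod xs = c [^] k \<otimes> lprod ys"
        using lprod_move_front[OF S(1,3) c(1) less.prems c(2)] by blast
      have "lprod ys \<in> carrier G" using lprod_closed ys(1) S(1) by auto
      then have "lprod xs = lprod ys" using ys(3) k(2)[OF c(1)] by simp
      moreover have "length ys < length xs" using ys(2) k(1) by simp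
      ultimately show ?thesis using less.hyps[OF _ ys(1)] by simp
    qed
  qed
  have gen: "\<exists>xs. set xs \<subseteq> S \<and> x = lprod xs" if "x \<in> generate G S" for x
    using that
  proof (induction rule: generate.induct)
    case one show ?case by (intro exI[of _ "[]"]) simp
  next
    case (incl h)
    then have "h \<in> carrier G" using S(1) by auto
    then show ?case using incl by (intro exI[of _ "[h]"]) simp
  next
    case (inv h)
    have hG: "h \<in> carrier G" using inv S(1) by auto
    have "lprod (replicate n h) = h [^] n" for n
      using hG nat_pow_Suc2[OF hG] by (induction n) auto
    moreover have "inv h = h [^] (k - 1)"
    proof (rule inv_equality)
      show "h [^] (k - 1) \<otimes> h = \<one>" using k(2)[OF inv] nat_pow_Suc[of h "k - 1"] k(1) by simp
    qed (use hG in simp_all)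
    ultimately show ?case using inv by (intro exI[of _ "replicate (k - 1) h"]) auto
  next
    case (eng h1 h2)
    then obtain xs ys where "set xs \<subseteq> S" "h1 = lprod xs" "set ys \<subseteq> S" "h2 = lprod ys" by blast
    then show ?case using lprod_append[of xs ys] S(1) by (intro exI[of _ "xs @ ys"]) auto
  qed
  have "generate G S \<subseteq> lprod ` {ys. set ys \<subseteq> S \<and> length ys \<le> card S * k}"
    using gen short by blast
  moreover have "finite {ys. set ys \<subseteq> S \<and> length ys \<le> card S * k}" by (rule finite_lists_length_le[OF S(2)])
  ultimately show ?thesis by (meson finite_imageI finite_subset)
qed

end

section \<open>Open normal subgroups centralized by elements of coprime order\<close>

context profinite_group
begin

definition cm :: "'a \<Rightarrow> 'a \<Rightarrow> 'a" where
  "cm x y = inv x \<otimes> inv y \<otimes> x \<otimes> y"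

text \<open>Modulo a given \<open>W\<close> only finitely many primes matter for \<open>x\<close>.
  They are split off one at a time by \<open>parts_exist\<close>: the \<open>p\<close>-part lies in
  \<open>C\<close> by hypothesis, and the rest has lost \<open>p\<close> from its order modulo
  \<open>W\<close>.\<close>

lemma primewise_mem:
  assumes U: "csubgroup U" and C: "csubgroup C" and x: "x \<in> U"
    and H: "\<And>p z. \<lbrakk>p \<in> sp x; z \<in> U; sp z \<subseteq> {p}\<rbrakk> \<Longrightarrow> z \<in> C"
  shows "x \<in> C"
proof (rule closedin_memI[OF csubgroupD(2)[OF C]])
  show "x \<in> carrier G" using x csubgroupD(3)[OF U] by auto
  fix W assume W: "onormal W"
  have "\<forall>y\<in>U. sp y \<subseteq> sp x \<longrightarrow> prime_factors (rord W y) \<subseteq> S \<longrightarrow> (\<exists>c\<in>C. c \<otimes> inv y \<in> W)" if "finite S" for S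
    using that
  proof (induction S rule: finite_induct)
    case empty
    show ?case
    proof (intro ballI impI)
      fix y assume y: "y \<in> U" "prime_factors (rord W y) \<subseteq> {}"
      have yG: "y \<in> carrier G" using y csubgroupD(3)[OF U] by auto
      have "rord W y = 1" using rord_pos[OF W yG] y(2) by (auto simp: prime_factorization_empty_iff)
      then have "y \<in> W" using pow_mem_iff[OF W yG, of 1] yG by simp
      then show "\<exists>c\<in>C. c \<otimes> inv y \<in> W"
        using subgroup.one_closed[OF csubgroupD(1)[OF C]] subgroup.m_inv_closed[OF onormalD(2)[OF W]] yG
        by (intro bexI[of _ \<one>]) auto
    qed
  next
    case (insert p S)
    show ?case
    proof (intro ballI impI)
      fix y assume y: "y \<in> U" "sp y \<subseteq> sp x" "prime_factors (rord W y) \<subseteq> insert p S"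
      have yG: "y \<in> carrier G" using y csubgroupD(3)[OF U] by auto
      obtain a b where ab: "a \<in> carrier G" "b \<in> carrier G" "y = a \<otimes> b" "a \<otimes> b = b \<otimes> a"
        "sp a \<subseteq> sp y \<inter> {p}" "sp b \<subseteq> sp y - {p}"
        "prime_factors (rord W b) \<subseteq> prime_factors (rord W y)"
        using parts_exist[OF yG, of "{p}"] W by blast
      have abU: "a \<in> U" "b \<in> U"
        using part_mem_subgroup[OF ab(1,2) _ ab(4) U] ab(3,5,6) y(1) by auto
      have "p \<notin> prime_factors (rord W b)" using prime_factors_rord[OF W ab(2)] ab(6) by auto
      then have "prime_factors (rord W b) \<subseteq> S" using ab(7) y(3) by auto
      then obtain c where c: "c \<in> C" "c \<otimes> inv b \<in> W" using insert.IH abU ab(6) y(2) by blast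
      have aC: "a \<in> C"
      proof (cases "sp a = {}")
        case True
        then have "a = \<one>" using sp_empty ab(1) by auto
        then show ?thesis using subgroup.one_closed[OF csubgroupD(1)[OF C]] by simp
      next
        case False
        then have "p \<in> sp x" using ab(5) y(2) by auto
        then show ?thesis using H[of p a] abU ab(5) by auto
      qed
      have cG: "c \<in> carrier G" using c csubgroupD(3)[OF C] by auto
      have "a \<otimes> (c \<otimes> inv b) \<otimes> inv a \<in> W" by (rule conj_mem(1)[OF onormalD(1)[OF W] c(2) ab(1)])
      then have "(a \<otimes> c) \<otimes> inv y \<in> W" using ab(1,2) cG unfolding ab(3) by (simp add: gsimps)
      then show "\<exists>c\<in>C. c \<otimes> inv y \<in> W"
        using subgroup.m_closed[OF csubgroupD(1)[OF C] aC c(1)] by blast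
    qed
  qed
  from this[of "prime_factors (rord W x)"] x show "\<exists>c\<in>C. c \<otimes> inv x \<in> W" by auto
qed

lemma centralizer_iff:
  assumes "x \<in> carrier G"
  shows "csubgroup {c \<in> carrier G. c \<otimes> x = x \<otimes> c}"
  using centralizer_csubgroup[of "{x}"] assms by simp

text \<open>Let \<open>K\<close> be the stabilizer of the coset \<open>U y\<^sub>0\<close> under conjugation and \<open>R\<close> the
  intersection of the \<open>K\<close>-conjugates of \<open>C\<close>, which is normalized by
  \<open>K\<close>. As \<open>u\<close> and \<open>y\<^sub>0\<close> commute modulo \<open>R\<close>, the
  \<open>\<tau>'\<close>-part of \<open>u y\<^sub>0\<close> lies in \<open>R\<close>, while its
  \<open>\<tau>\<close>-part differs from \<open>y\<^sub>0\<close> by an element of \<open>C\<close> by hypothesis.\<close>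
lemma coset_elements_mem:
  assumes U: "onormal U" and y0: "y0 \<in> carrier G" "sp y0 \<subseteq> \<tau>" and C: "csubgroup C"
    and H: "\<And>y. \<lbrakk>y \<in> carrier G; sp y \<subseteq> \<tau>; y \<otimes> inv y0 \<in> U\<rbrakk> \<Longrightarrow> y \<otimes> inv y0 \<in> C"
    and u: "u \<in> U" "sp u \<subseteq> \<tau>"
  shows "u \<in> C"
proof -
  have sU: "subgroup U G" by (rule onormalD(2)[OF U])
  have uG: "u \<in> carrier G" using u onormalD(4)[OF U] by auto
  have CG: "c \<in> carrier G" if "c \<in> C" for c using that csubgroupD(3)[OF C] by auto
  have sC: "subgroup C G" by (rule csubgroupD(1)[OF C])
  define K where "K = {g \<in> carrier G. inv g \<otimes> y0 \<otimes> g \<otimes> inv y0 \<in> U}"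
  define R where "R = {r \<in> carrier G. \<forall>g\<in>K. inv g \<otimes> r \<otimes> g \<in> C}"
  have KG: "g \<in> carrier G" if "g \<in> K" for g using that by (simp add: K_def)
  have Kmult: "g \<otimes> h \<in> K" if "g \<in> K" "h \<in> K" for g h
  proof -
    have gh: "g \<in> carrier G" "h \<in> carrier G" using that KG by auto
    have "inv h \<otimes> (inv g \<otimes> y0 \<otimes> g \<otimes> inv y0) \<otimes> h \<in> U"
      using that gh by (intro conj_mem(2)[OF onormalD(1)[OF U]]) (auto simp: K_def)
    then have "(inv h \<otimes> (inv g \<otimes> y0 \<otimes> g \<otimes> inv y0) \<otimes> h) \<otimes> (inv h \<otimes> y0 \<otimes> h \<otimes> inv y0) \<in> U"
      by (rule subgroup.m_closed[OF sU]) (use that in \<open>simp add: K_def\<close>)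
    then show ?thesis using gh y0 by (simp add: K_def gsimps)
  qed
  have y0K: "y0 \<in> K" using y0 subgroup.one_closed[OF sU] by (simp add: K_def gsimps)
  have UK: "g \<in> K" if "g \<in> U" for g
  proof -
    have gG: "g \<in> carrier G" using that onormalD(4)[OF U] by auto
    have "y0 \<otimes> g \<otimes> inv y0 \<in> U" using conj_mem(1)[OF onormalD(1)[OF U] that y0(1)] .
    then have "inv g \<otimes> (y0 \<otimes> g \<otimes> inv y0) \<in> U"
      using subgroup.m_closed[OF sU] subgroup.m_inv_closed[OF sU] that by auto
    then show ?thesis using gG y0 by (simp add: K_def gsimps)
  qed
  have R: "csubgroup R"
  proof -
    have "R = \<Inter> ((\<lambda>g. {r \<in> carrier G. inv g \<otimes> r \<otimes> g \<in> C}) ` K)"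
      unfolding R_def using y0K by auto
    moreover have "closedin T {r \<in> carrier G. inv g \<otimes> r \<otimes> g \<in> C}" if "g \<in> K" for g
      using KG[OF that] by (intro closedin_preimage csubgroupD(2)[OF C] cont_intros) auto
    ultimately have "closedin T R" using y0K by (auto intro!: closedin_Inter)
    moreover have "subgroup R G"
    proof (rule subgroupI)
      show "R \<noteq> {}" using subgroup.one_closed[OF sC] KG by (auto simp: R_def intro!: exI[of _ \<one>])
    next
      fix a assume a: "a \<in> R"
      have "inv g \<otimes> inv a \<otimes> g \<in> C" if "g \<in> K" for g
      proof -
        have "inv (inv g \<otimes> a \<otimes> g) \<in> C" using a that subgroup.m_inv_closed[OF sC] by (auto simp: R_def)
        then show ?thesis using a KG[OF that] by (simp add: R_def gsimps)
      qed
      then show "inv a \<in> R" using a by (auto simp: R_def)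
    next
      fix a b assume a: "a \<in> R" and b: "b \<in> R"
      have "inv g \<otimes> (a \<otimes> b) \<otimes> g \<in> C" if "g \<in> K" for g
      proof -
        have "(inv g \<otimes> a \<otimes> g) \<otimes> (inv g \<otimes> b \<otimes> g) \<in> C" using a b that subgroup.m_closed[OF sC] by (auto simp: R_def)
        then show ?thesis using a b KG[OF that] by (simp add: R_def gsimps)
      qed
      then show "a \<otimes> b \<in> R" using a b by (auto simp: R_def)
    qed (auto simp: R_def)
    ultimately show ?thesis by (simp add: csubgroup_def)
  qed
  have sR: "subgroup R G" by (rule csubgroupD(1)[OF R])
  have RG: "r \<in> carrier G" if "r \<in> R" for r using that by (simp add: R_def)
  have RC: "r \<in> C" if "r \<in> R" for r
  proof -
    have "inv \<one> \<otimes> r \<otimes> \<one> \<in> C" using that UK[OF subgroup.one_closed[OF sU]] unfolding R_def by blast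
    then show ?thesis using RG[OF that] by simp
  qed
  have Rconj: "inv k \<otimes> r \<otimes> k \<in> R" if k: "k \<in> K" and r: "r \<in> R" for k r
  proof -
    have "inv g \<otimes> (inv k \<otimes> r \<otimes> k) \<otimes> g \<in> C" if "g \<in> K" for g
    proof -
      have "inv (k \<otimes> g) \<otimes> r \<otimes> (k \<otimes> g) \<in> C" using r Kmult[OF k that] by (auto simp: R_def)
      then show ?thesis using KG[OF k] KG[OF that] RG[OF r] by (simp add: gsimps)
    qed
    then show ?thesis using KG[OF k] RG[OF r] by (simp add: R_def)
  qed
  \<comment> \<open>Conjugation by \<open>g\<close> in \<open>K\<close> keeps \<open>y\<close> and
    \<open>y0\<close> in the coset \<open>U y\<^sub>0\<close> and preserves \<open>sp\<close>. So
    \<open>H\<close> applies to both conjugates, and the conjugate of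
    \<open>y y\<^sub>0\<^sup>-\<^sup>1\<close> is a quotient of the two resulting elements of
    \<open>C\<close>.\<close>
  have BR: "y \<otimes> inv y0 \<in> R" if y: "y \<in> carrier G" "sp y \<subseteq> \<tau>" "y \<otimes> inv y0 \<in> U" for y
  proof -
    have "inv g \<otimes> (y \<otimes> inv y0) \<otimes> g \<in> C" if g: "g \<in> K" for g
    proof -
      have gG: "g \<in> carrier G" by (rule KG[OF g])
      have 1: "inv g \<otimes> y0 \<otimes> g \<otimes> inv y0 \<in> U" using g by (simp add: K_def)
      have "inv g \<otimes> (y \<otimes> inv y0) \<otimes> g \<in> U" by (rule conj_mem(2)[OF onormalD(1)[OF U] y(3) gG])
      then have "(inv g \<otimes> (y \<otimes> inv y0) \<otimes> g) \<otimes> (inv g \<otimes> y0 \<otimes> g \<otimes> inv y0) \<in> U"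
        using subgroup.m_closed[OF sU] 1 by auto
      then have 2: "inv g \<otimes> y \<otimes> g \<otimes> inv y0 \<in> U" using gG y(1) y0(1) by (simp add: gsimps)
      have c1: "inv g \<otimes> y0 \<otimes> g \<otimes> inv y0 \<in> C"
        using H[of "inv g \<otimes> y0 \<otimes> g"] 1 sp_conj[OF y0(1) gG] y0 gG by simp
      have c2: "inv g \<otimes> y \<otimes> g \<otimes> inv y0 \<in> C"
        using H[of "inv g \<otimes> y \<otimes> g"] 2 sp_conj[OF y(1) gG] y gG by simp
      have "(inv g \<otimes> y \<otimes> g \<otimes> inv y0) \<otimes> inv (inv g \<otimes> y0 \<otimes> g \<otimes> inv y0) \<in> C"
        using subgroup.m_closed[OF sC c2 subgroup.m_inv_closed[OF sC c1]] .
      then show ?thesis using gG y(1) y0(1) by (simp add: gsimps)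
    qed
    then show ?thesis using y(1) y0(1) by (simp add: R_def)
  qed
  have uK: "u \<in> K" by (rule UK[OF u(1)])
  \<comment> \<open>\<open>s\<close> is the commutator with
    \<open>y0 \<otimes> u = u \<otimes> y0 \<otimes> s\<close>, written as a
    \<open>y0\<close>-conjugate of an element to which \<open>BR\<close> applies.\<close>
  define s where "s = inv y0 \<otimes> (inv u \<otimes> y0 \<otimes> u \<otimes> inv y0) \<otimes> y0"
  have sR': "s \<in> R"
  proof -
    have "inv u \<otimes> y0 \<otimes> u \<otimes> inv y0 \<in> U" using uK by (simp add: K_def)
    then have "inv u \<otimes> y0 \<otimes> u \<otimes> inv y0 \<in> R"
      using BR[of "inv u \<otimes> y0 \<otimes> u"] sp_conj[OF y0(1) uG] y0 uG by simp
    then show ?thesis unfolding s_def by (rule Rconj[OF y0K])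
  qed
  have comm: "\<exists>r\<in>R. y0 [^] (n::nat) \<otimes> u = u \<otimes> y0 [^] n \<otimes> r" for n
  proof (induction n)
    case 0 then show ?case using subgroup.one_closed[OF sR] uG by (intro bexI[of _ \<one>]) auto
  next
    case (Suc n)
    then obtain r where r: "r \<in> R" "y0 [^] n \<otimes> u = u \<otimes> y0 [^] n \<otimes> r" by blast
    have "y0 [^] Suc n \<otimes> u = (y0 [^] n \<otimes> u) \<otimes> y0 \<otimes> s"
      using y0 uG by (simp add: s_def gsimps)
    also have "\<dots> = u \<otimes> y0 [^] Suc n \<otimes> ((inv y0 \<otimes> r \<otimes> y0) \<otimes> s)"
      unfolding r(2) using y0 uG RG[OF r(1)] RG[OF sR'] by (simp add: gsimps)
    finally show ?case using subgroup.m_closed[OF sR Rconj[OF y0K r(1)] sR'] by blast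
  qed
  have pow: "\<exists>r\<in>R. (u \<otimes> y0) [^] (n::nat) = u [^] n \<otimes> y0 [^] n \<otimes> r" for n
  proof (induction n)
    case 0 then show ?case using subgroup.one_closed[OF sR] by (intro bexI[of _ \<one>]) auto
  next
    case (Suc n)
    then obtain r where r: "r \<in> R" "(u \<otimes> y0) [^] n = u [^] n \<otimes> y0 [^] n \<otimes> r" by blast
    obtain r' where r': "r' \<in> R" "y0 [^] n \<otimes> u = u \<otimes> y0 [^] n \<otimes> r'" using comm by blast
    have uy: "u \<otimes> y0 \<in> K" by (rule Kmult[OF uK y0K])
    have G: "r \<in> carrier G" "r' \<in> carrier G" using RG r r' by auto
    have "(u \<otimes> y0) [^] Suc n = u [^] n \<otimes> (y0 [^] n \<otimes> u) \<otimes> y0 \<otimes> (inv (u \<otimes> y0) \<otimes> r \<otimes> (u \<otimes> y0))"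
      using y0 uG G by (simp add: r(2) gsimps)
    also have "\<dots> = u [^] Suc n \<otimes> y0 [^] Suc n \<otimes> ((inv y0 \<otimes> r' \<otimes> y0) \<otimes> (inv (u \<otimes> y0) \<otimes> r \<otimes> (u \<otimes> y0)))"
      unfolding r'(2) using y0 uG G by (simp add: gsimps)
    finally show ?case using subgroup.m_closed[OF sR Rconj[OF y0K r'(1)] Rconj[OF uy r(1)]] by blast
  qed
  have gG: "u \<otimes> y0 \<in> carrier G" using uG y0 by simp
  obtain a b where ab: "a \<in> carrier G" "b \<in> carrier G" "u \<otimes> y0 = a \<otimes> b" "a \<otimes> b = b \<otimes> a"
    "sp a \<subseteq> \<tau>" "sp b \<inter> \<tau> = {}"
    using parts_exist[OF gG, of \<tau>] by blast
  have bR: "b \<in> R"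
  proof (rule part_mem[OF ab(1,5,2,6,4) R])
    fix W assume W: "onormal W"
    \<comment> \<open>This exponent has only primes in \<tau> and kills both \<open>u\<close> and
      \<open>y0\<close> modulo \<open>W\<close>, so by \<open>pow\<close> the power of
      \<open>u \<otimes> y0\<close> agrees with an element of \<open>R\<close> modulo
      \<open>W\<close>.\<close>
    let ?n = "rord W u * rord W y0"
    obtain r where r: "r \<in> R" "(u \<otimes> y0) [^] ?n = u [^] ?n \<otimes> y0 [^] ?n \<otimes> r" using pow by blast
    have "u [^] ?n \<in> W" "y0 [^] ?n \<in> W" using pow_mem_iff[OF W] uG y0 by simp_all
    then have "u [^] ?n \<otimes> y0 [^] ?n \<in> W" using subgroup.m_closed[OF onormalD(2)[OF W]] by auto
    moreover have "(a \<otimes> b) [^] ?n \<otimes> inv r = u [^] ?n \<otimes> y0 [^] ?n"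
      unfolding ab(3)[symmetric] r(2) using uG y0 RG[OF r(1)] by (simp add: gsimps)
    moreover have "?n > 0" "prime_factors ?n \<subseteq> \<tau>"
      using rord_pos[OF W uG] rord_pos[OF W y0(1)] prime_factors_rord[OF W uG] prime_factors_rord[OF W y0(1)] u(2) y0(2)
      by (auto simp: prime_factors_product)
    ultimately show "\<exists>n>0. prime_factors n \<subseteq> \<tau> \<and> (\<exists>c\<in>R. (a \<otimes> b) [^] n \<otimes> inv c \<in> W)"
      using r(1) by (intro exI[of _ ?n] conjI bexI[of _ r]) simp_all
  qed
  \<comment> \<open>\<open>u \<otimes> y0\<close> and \<open>y0\<close> agree modulo
    \<open>U\<close>, so the exponent \<open>rord U y0\<close>, with primes in \<tau>, takes the
    product into \<open>U\<close>. Knowing \<open>b\<close> in \<open>U\<close> keeps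
    \<open>a\<close> in the coset \<open>U y\<^sub>0\<close>, where \<open>H\<close>
    applies.\<close>
  have bU: "b \<in> U"
  proof (rule part_mem[OF ab(1,5,2,6,4) onormal_csubgroup[OF U]])
    fix W assume W: "onormal W"
    interpret q: group_hom G "G Mod U" "\<lambda>x. U #> x" by (rule normal_quotient_hom[OF onormalD(1)[OF U]])
    let ?n = "rord U y0"
    have "U #> (u \<otimes> y0) = U #> y0"
      using rcoset_eq_iff[OF sU gG y0(1)] u(1) uG y0(1) by (simp add: gsimps)
    then have "rord U (u \<otimes> y0) = ?n" by (simp add: rord_def)
    then have "(a \<otimes> b) [^] ?n \<in> U" using rord_mem[OF U gG] ab(3) by simp
    then show "\<exists>n>0. prime_factors n \<subseteq> \<tau> \<and> (\<exists>c\<in>U. (a \<otimes> b) [^] n \<otimes> inv c \<in> W)"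
      using rord_pos[OF U y0(1)] prime_factors_rord[OF U y0(1)] y0(2) subgroup.one_closed[OF onormalD(2)[OF W]] ab(1,2)
      by (intro exI[of _ ?n] conjI bexI[of _ "(a \<otimes> b) [^] ?n"]) auto
  qed
  have ba: "u \<otimes> y0 = b \<otimes> a" using ab(3,4) by simp
  have "u = (u \<otimes> y0) \<otimes> inv y0" using uG y0(1) by (simp add: gsimps)
  then have e: "u = b \<otimes> (a \<otimes> inv y0)" unfolding ba using ab(1,2) y0(1) by (simp add: gsimps)
  then have "inv b \<otimes> u = a \<otimes> inv y0" using ab(1,2) y0(1) by (simp add: inv_mult_cancel)
  moreover have "inv b \<otimes> u \<in> U" using subgroup.m_closed[OF sU subgroup.m_inv_closed[OF sU bU] u(1)] .
  ultimately have "a \<otimes> inv y0 \<in> C" using H[OF ab(1,5)] by simp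
  then show "u \<in> C" using e subgroup.m_closed[OF sC RC[OF bR]] by simp
qed

text \<open>Both sides say that \<open>y\<close> and \<open>y0\<close> conjugate \<open>x\<close> to
  the same element. This converts constancy of commutators into centralizing.\<close>

lemma cm_eq_iff:
  assumes "x \<in> carrier G" "y \<in> carrier G" "y0 \<in> carrier G"
  shows "cm x y = cm x y0 \<longleftrightarrow> (y \<otimes> inv y0) \<otimes> x = x \<otimes> (y \<otimes> inv y0)"
proof -
  have "cm x y = cm x y0 \<longleftrightarrow> inv y \<otimes> x \<otimes> y = inv y0 \<otimes> x \<otimes> y0"
    using assms by (simp add: cm_def m_assoc)
  also have "\<dots> \<longleftrightarrow> y \<otimes> (inv y \<otimes> x \<otimes> y) \<otimes> inv y0 = y \<otimes> (inv y0 \<otimes> x \<otimes> y0) \<otimes> inv y0"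
    using assms by simp
  also have "\<dots> \<longleftrightarrow> x \<otimes> (y \<otimes> inv y0) = (y \<otimes> inv y0) \<otimes> x"
    using assms by (simp add: gsimps)
  finally show ?thesis by auto
qed

lemma cm_one_iff:
  assumes "x \<in> carrier G" "y \<in> carrier G"
  shows "cm x y = \<one> \<longleftrightarrow> x \<otimes> y = y \<otimes> x"
  using cm_eq_iff[OF assms one_closed] assms by (auto simp: cm_def)

text \<open>\<open>coset_elements_mem\<close> is used once in each variable. With the centralizer of
  an \<open>x\<close> from the first side of the box, it makes \<open>v\<close> commute with
  \<open>x\<close>. Then the quotients \<open>x x\<^sub>0\<^sup>-\<^sup>1\<close> all centralize
  \<open>v\<close>, and the second use, with the centralizer of \<open>v\<close>, gives the claim
  for \<open>u\<close>.\<close>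

lemma box_commute:
  assumes U: "onormal U" and x0: "x0 \<in> carrier G" "sp x0 \<subseteq> \<sigma>" and y0: "y0 \<in> carrier G" "sp y0 \<subseteq> \<tau>"
    and H: "\<And>x y. \<lbrakk>x \<in> carrier G; y \<in> carrier G; sp x \<subseteq> \<sigma>; sp y \<subseteq> \<tau>; x \<otimes> inv x0 \<in> U; y \<otimes> inv y0 \<in> U\<rbrakk>
      \<Longrightarrow> cm x y = cm x0 y0"
    and u: "u \<in> U" "sp u \<subseteq> \<sigma>" and v: "v \<in> U" "sp v \<subseteq> \<tau>"
  shows "u \<otimes> v = v \<otimes> u"
proof -
  have vG: "v \<in> carrier G" using v onormalD(4)[OF U] by auto
  have one: "x0 \<otimes> inv x0 \<in> U" "y0 \<otimes> inv y0 \<in> U"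
    using x0 y0 subgroup.one_closed[OF onormalD(2)[OF U]] by simp_all
  have xv: "v \<otimes> x = x \<otimes> v" if x: "x \<in> carrier G" "sp x \<subseteq> \<sigma>" "x \<otimes> inv x0 \<in> U" for x
  proof -
    have "v \<in> {c \<in> carrier G. c \<otimes> x = x \<otimes> c}"
    proof (rule coset_elements_mem[OF U y0 centralizer_iff[OF x(1)] _ v])
      fix y assume y: "y \<in> carrier G" "sp y \<subseteq> \<tau>" "y \<otimes> inv y0 \<in> U"
      have "cm x y = cm x y0" using H[OF x(1) y(1) x(2) y(2) x(3) y(3)] H[OF x(1) y0(1) x(2) y0(2) x(3) one(2)] by simp
      then show "y \<otimes> inv y0 \<in> {c \<in> carrier G. c \<otimes> x = x \<otimes> c}"
        using cm_eq_iff[OF x(1) y(1) y0(1)] y y0 by simp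
    qed
    then show ?thesis by simp
  qed
  have "u \<in> {c \<in> carrier G. c \<otimes> v = v \<otimes> c}"
  proof (rule coset_elements_mem[OF U x0 centralizer_iff[OF vG] _ u])
    fix x assume x: "x \<in> carrier G" "sp x \<subseteq> \<sigma>" "x \<otimes> inv x0 \<in> U"
    have "inv x0 \<otimes> v = v \<otimes> inv x0" using commute_inv[OF xv[OF x0 one(1), symmetric] x0(1) vG] .
    then have "x \<otimes> inv x0 \<otimes> v = v \<otimes> (x \<otimes> inv x0)"
      using commute_mult[OF xv[OF x, symmetric] _ x(1) _ vG] x0 by simp
    then show "x \<otimes> inv x0 \<in> {c \<in> carrier G. c \<otimes> v = v \<otimes> c}" using x(1) x0(1) by simp
  qed
  then show ?thesis by simp
qed

section \<open>Procyclic subgroups and the primes of an element\<close>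

lemma closure_of_iff:
  assumes "S \<subseteq> carrier G"
  shows "y \<in> Abstract_Topology.closure_of T S \<longleftrightarrow>
    y \<in> carrier G \<and> (\<forall>W. onormal W \<longrightarrow> (\<exists>z\<in>S. z \<otimes> inv y \<in> W))"
proof
  assume y: "y \<in> Abstract_Topology.closure_of T S"
  then have yG: "y \<in> carrier G" by (simp add: in_closure_of topsp)
  have "\<exists>z\<in>S. z \<otimes> inv y \<in> W" if W: "onormal W" for W
  proof -
    have "openin T (W #> y)" "y \<in> W #> y"
      using openin_rcoset[OF onormalD(2,3)[OF W] yG] rcos_self[OF yG onormalD(2)[OF W]] by simp_all
    then obtain z where "z \<in> S" "z \<in> W #> y" using y unfolding in_closure_of by blast
    then show ?thesis using rcoset_eq_Collect[OF onormalD(2)[OF W] yG] by auto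
  qed
  then show "y \<in> carrier G \<and> (\<forall>W. onormal W \<longrightarrow> (\<exists>z\<in>S. z \<otimes> inv y \<in> W))" using yG by simp
next
  assume y: "y \<in> carrier G \<and> (\<forall>W. onormal W \<longrightarrow> (\<exists>z\<in>S. z \<otimes> inv y \<in> W))"
  show "y \<in> Abstract_Topology.closure_of T S"
  proof (rule closedin_memI)
    fix W assume "onormal W"
    then obtain z where "z \<in> S" "z \<otimes> inv y \<in> W" using y by blast
    moreover have "S \<subseteq> Abstract_Topology.closure_of T S" using assms by (simp add: closure_of_subset topsp)
    ultimately show "\<exists>z\<in>Abstract_Topology.closure_of T S. z \<otimes> inv y \<in> W" by blast
  qed (use y in auto)
qed

lemma csubgroup_closure_of:
  assumes H: "subgroup H G"
  shows "csubgroup (Abstract_Topology.closure_of T H)" (is "csubgroup ?C")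
proof -
  note iff = closure_of_iff[OF subgroup.subset[OF H]]
  have "subgroup ?C G"
  proof (rule subgroupI)
    show "?C \<subseteq> carrier G" using iff by blast
    show "?C \<noteq> {}"
      using closure_of_subset[of H T] subgroup.subset[OF H] subgroup.one_closed[OF H] by (auto simp: topsp)
  next
    fix a assume "a \<in> ?C"
    then have a: "a \<in> carrier G" "\<And>W. onormal W \<Longrightarrow> \<exists>z\<in>H. z \<otimes> inv a \<in> W" using iff by auto
    have "\<exists>z\<in>H. z \<otimes> inv (inv a) \<in> W" if W: "onormal W" for W
    proof -
      obtain z where z: "z \<in> H" "z \<otimes> inv a \<in> W" using a(2)[OF W] by blast
      have zG: "z \<in> carrier G" using z subgroup.subset[OF H] by auto
      have "inv z \<otimes> inv (z \<otimes> inv a) \<otimes> z \<in> W"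
        by (rule conj_mem(2)[OF onormalD(1)[OF W] _ zG]) (rule subgroup.m_inv_closed[OF onormalD(2)[OF W] z(2)])
      then have "inv z \<otimes> inv (inv a) \<in> W" using zG a(1) by (simp add: gsimps)
      then show ?thesis using subgroup.m_inv_closed[OF H z(1)] by blast
    qed
    then show "inv a \<in> ?C" using iff a(1) by simp
  next
    fix a b assume "a \<in> ?C" "b \<in> ?C"
    then have a: "a \<in> carrier G" "\<And>W. onormal W \<Longrightarrow> \<exists>z\<in>H. z \<otimes> inv a \<in> W"
      and b: "b \<in> carrier G" "\<And>W. onormal W \<Longrightarrow> \<exists>z\<in>H. z \<otimes> inv b \<in> W" using iff by auto
    have "\<exists>z\<in>H. z \<otimes> inv (a \<otimes> b) \<in> W" if W: "onormal W" for W
    proof -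
      obtain z where z: "z \<in> H" "z \<otimes> inv a \<in> W" using a(2)[OF W] by blast
      obtain w where w: "w \<in> H" "w \<otimes> inv b \<in> W" using b(2)[OF W] by blast
      have G: "z \<in> carrier G" "w \<in> carrier G" using z w subgroup.subset[OF H] by auto
      have "(z \<otimes> (w \<otimes> inv b) \<otimes> inv z) \<otimes> (z \<otimes> inv a) \<in> W"
        by (rule subgroup.m_closed[OF onormalD(2)[OF W] conj_mem(1)[OF onormalD(1)[OF W] w(2) G(1)] z(2)])
      then have "(z \<otimes> w) \<otimes> inv (a \<otimes> b) \<in> W" using G a(1) b(1) by (simp add: gsimps)
      then show ?thesis using subgroup.m_closed[OF H z(1) w(1)] by blast
    qed
    then show "a \<otimes> b \<in> ?C" using iff a(1) b(1) by simp
  qed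
  then show ?thesis by (simp add: csubgroup_def)
qed

text \<open>Let \<open>P\<close> be the procyclic group. An open \<open>V\<close> in
  \<open>P\<close> contains some \<open>W \<inter> P\<close>; by density the coset of
  \<open>x\<close> generates \<open>P\<close> modulo \<open>V\<close>, so the index is the order of
  that coset and divides \<open>rord W x\<close>. Conversely, for \<open>V = W \<inter> P\<close>
  the index is an exponent taking \<open>x\<close> into \<open>W\<close>, hence a multiple of
  \<open>rord W x\<close>.\<close>

lemma prime_set_eq_sp:
  assumes x: "x \<in> carrier G"
  shows "prime_set G T x = sp x"
proof -
  define P where "P = procyclic G T x"
  let ?H = "generate G {x}"
  have H: "subgroup ?H G" using x by (intro generate_is_subgroup) auto
  have HG: "?H \<subseteq> carrier G" by (rule subgroup.subset[OF H])
  have P_def': "P = Abstract_Topology.closure_of T ?H" by (simp add: P_def procyclic_def)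
  have P: "csubgroup P" unfolding P_def' by (rule csubgroup_closure_of[OF H])
  have sP: "subgroup P G" by (rule csubgroupD(1)[OF P])
  have HP: "?H \<subseteq> P" unfolding P_def' using HG by (simp add: closure_of_subset topsp)
  have xP: "x \<in> P" using HP generate.incl[of x "{x}" G] by auto
  let ?K = "G\<lparr>carrier := P\<rparr>"
  interpret K: group ?K by (rule subgroup_imp_group[OF sP])
  have qh: "group_hom ?K (?K Mod V) (\<lambda>y. V #>\<^bsub>?K\<^esub> y)" if "V \<lhd> ?K" for V
    using normal.r_coset_hom_Mod[OF that] normal.factorgroup_is_group[OF that] K.group_axioms
    by (simp add: group_hom_def group_hom_axioms_def)
  have ord: "card (rcosets\<^bsub>?K\<^esub> V) = order (?K Mod V)" for V
    by (simp add: order_def FactGroup_def)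
  have powK: "y [^]\<^bsub>?K\<^esub> (n::nat) = y [^] n" for y n
    by (simp add: nat_pow_def)
  show ?thesis
  proof (intro equalityI subsetI)
    fix p assume "p \<in> prime_set G T x"
    then obtain V where p: "Factorial_Ring.prime p" and V: "V \<lhd> ?K" "openin (subtopology T P) V"
      and dv: "p dvd card (rcosets\<^bsub>?K\<^esub> V)"
      by (auto simp: prime_set_def P_def)
    have sV: "subgroup V ?K" by (rule normal_imp_subgroup[OF V(1)])
    interpret q: group_hom ?K "?K Mod V" "\<lambda>y. V #>\<^bsub>?K\<^esub> y" by (rule qh[OF V(1)])
    obtain A where A: "openin T A" "V = A \<inter> P" using V(2) by (auto simp: openin_subtopology)
    have "\<one> \<in> A" using subgroup.one_closed[OF sV] A(2) by auto
    then obtain W where W: "onormal W" "W \<subseteq> A" using ex_onormal[OF A(1)] by blast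
    then have WV: "W \<inter> P \<subseteq> V" using A by auto
    let ?n = "rord W x" and ?g = "V #>\<^bsub>?K\<^esub> x"
    have gQ: "?g \<in> carrier (?K Mod V)" using q.hom_closed[of x] xP by simp
    have "x [^] ?n \<in> P" by (rule subgroup_nat_pow_closed[OF sP xP])
    then have "x [^] ?n \<in> V" using rord_mem[OF W(1) x] WV by auto
    then have "V #>\<^bsub>?K\<^esub> (x [^]\<^bsub>?K\<^esub> ?n) = V"
      using K.coset_join2[OF _ sV, of "x [^] ?n"] subgroup.subset[OF sV] by (auto simp: powK)
    then have "?g [^]\<^bsub>?K Mod V\<^esub> ?n = \<one>\<^bsub>?K Mod V\<^esub>"
      using q.hom_nat_pow[of x ?n] xP by simp
    then have ordn: "q.H.ord ?g dvd ?n" using q.H.pow_eq_id[OF gQ] by simp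
    have "carrier (?K Mod V) \<subseteq> generate (?K Mod V) {?g}"
    proof
      fix R assume "R \<in> carrier (?K Mod V)"
      then obtain y where y: "y \<in> P" "R = V #>\<^bsub>?K\<^esub> y" by (auto simp: carrier_FactGroup)
      have yG: "y \<in> carrier G" using y sP subgroup.subset by auto
      obtain z where z: "z \<in> ?H" "z \<otimes> inv y \<in> W"
        using y(1) closure_of_iff[OF HG, of y] W(1) unfolding P_def' by blast
      have zP: "z \<in> P" using z HP by auto
      obtain k :: int where k: "z = x [^] k" using z generate_pow[OF x] by auto
      have "z \<otimes> inv y \<in> P" using subgroup.m_closed[OF sP zP subgroup.m_inv_closed[OF sP y(1)]] .
      then have "z \<otimes> inv y \<in> V" using z WV by auto
      then have "V #>\<^bsub>?K\<^esub> z = V #>\<^bsub>?K\<^esub> y"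
        using K.rcoset_eq_iff[OF sV, of z y] zP y(1) m_inv_consistent[OF sP y(1)] by simp
      moreover have "V #>\<^bsub>?K\<^esub> z = ?g [^]\<^bsub>?K Mod V\<^esub> k"
        using q.hom_int_pow[of x k] xP int_pow_consistent[OF sP xP, of k] k by simp
      ultimately show "R \<in> generate (?K Mod V) {?g}"
        using q.H.generate_pow[OF gQ] y by auto
    qed
    then have "generate (?K Mod V) {?g} = carrier (?K Mod V)"
      using q.H.generate_incl[of "{?g}"] gQ by auto
    then have "order (?K Mod V) = q.H.ord ?g" using q.H.generate_pow_card[OF gQ] by (simp add: order_def)
    then have "p dvd ?n" using dv ordn ord[of V] by (metis dvd_trans)
    then show "p \<in> sp x" using W p by (auto simp: sp_def)
  next
    fix p assume "p \<in> sp x"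
    then obtain W where p: "Factorial_Ring.prime p" and W: "onormal W" "p dvd rord W x" by (auto simp: sp_def)
    define V where "V = W \<inter> P"
    have V: "V \<lhd> ?K" unfolding V_def by (rule normal_Int_subgroup[OF sP onormalD(1)[OF W(1)]])
    have sV: "subgroup V ?K" by (rule normal_imp_subgroup[OF V])
    interpret q: group_hom ?K "?K Mod V" "\<lambda>y. V #>\<^bsub>?K\<^esub> y" by (rule qh[OF V])
    let ?n = "order (?K Mod V)" and ?g = "V #>\<^bsub>?K\<^esub> x"
    have gQ: "?g \<in> carrier (?K Mod V)" using q.hom_closed[of x] xP by simp
    have "?g [^]\<^bsub>?K Mod V\<^esub> ?n = V" using q.H.pow_order_eq_1[OF gQ] by simp
    then have e: "V #>\<^bsub>?K\<^esub> (x [^] ?n) = V" using q.hom_nat_pow[of x ?n] xP by (simp add: powK)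
    have "x [^] ?n \<in> P" by (rule subgroup_nat_pow_closed[OF sP xP])
    then have "x [^] ?n \<in> V #>\<^bsub>?K\<^esub> (x [^] ?n)" using K.rcos_self[OF _ sV, of "x [^] ?n"] by simp
    then have "x [^] ?n \<in> W" using e by (auto simp: V_def)
    then have "p dvd card (rcosets\<^bsub>?K\<^esub> V)" unfolding ord using pow_mem_iff[OF W(1) x] W(2) dvd_trans by blast
    moreover have "openin (subtopology T P) V" unfolding V_def using onormalD(3)[OF W(1)] by (auto simp: openin_subtopology)
    ultimately show "p \<in> prime_set G T x" unfolding prime_set_def P_def[symmetric] using p V by blast
  qed
qed

section \<open>Isolated values of the commutator map\<close>

lemma coprime_commutators_eq:
  "coprime_commutators G T = {cm x y | x y. x \<in> carrier G \<and> y \<in> carrier G \<and> sp x \<inter> sp y = {}}"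
  unfolding coprime_commutators_def cm_def
  by (rule Collect_cong, rule ex_cong1, rule ex_cong1) (auto simp: prime_set_eq_sp)

lemma cont_cm: "continuous_map (prod_topology T T) T (\<lambda>p. cm (fst p) (snd p))"
  unfolding cm_def
  by (rule cont_mult[OF cont_mult[OF cont_mult[OF cont_inv[OF continuous_map_fst] cont_inv[OF continuous_map_snd]]
        continuous_map_fst] continuous_map_snd])

text \<open>Closedness of \<open>D\<close> makes its image under the commutator map compact, so that
  \<open>perfect_compact_lepoll\<close> yields an isolated value. Near any pair of \<open>D\<close>
  attaining it, continuity leaves no other value for pairs of \<open>D\<close>.\<close>

lemma isolated_box:
  assumes small: "(card_of (coprime_commutators G T), card_of (UNIV :: real set)) \<in> ordLess"
    and D: "closedin (prod_topology T T) D" "D \<noteq> {}"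
    and cop: "\<And>x y. (x, y) \<in> D \<Longrightarrow> sp x \<inter> sp y = {}"
  shows "\<exists>x0 y0 U. (x0, y0) \<in> D \<and> onormal U \<and>
    (\<forall>x y. (x, y) \<in> D \<longrightarrow> x \<otimes> inv x0 \<in> U \<longrightarrow> y \<otimes> inv y0 \<in> U \<longrightarrow> cm x y = cm x0 y0)"
proof -
  define f where "f p = cm (fst p) (snd p)" for p
  define Y where "Y = f ` D"
  have DG: "D \<subseteq> carrier G \<times> carrier G" using closedin_subset[OF D(1)] by (simp add: topsp)
  have YX: "Y \<subseteq> coprime_commutators G T"
  proof
    fix c assume "c \<in> Y"
    then obtain x y where xy: "(x, y) \<in> D" "c = cm x y" by (auto simp: Y_def f_def)
    then have "x \<in> carrier G" "y \<in> carrier G" using DG by auto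
    then show "c \<in> coprime_commutators G T" unfolding coprime_commutators_eq using xy cop by blast
  qed
  have "compact_space (prod_topology T T)" using comp by (simp add: compact_space_prod_topology)
  then have "compactin (prod_topology T T) D" by (rule closedin_compact_space[OF _ D(1)])
  then have "compactin T Y" unfolding Y_def f_def by (rule image_compactin[OF _ cont_cm])
  then have clY: "closedin T Y" by (rule compactin_imp_closedin[OF haus])
  have YG: "Y \<subseteq> carrier G" using closedin_subset[OF clY] by (simp add: topsp)
  have "\<exists>A c. openin T A \<and> c \<in> A \<and> c \<in> Y \<and> (\<forall>y\<in>Y. y \<in> A \<longrightarrow> y = c)"
  proof (rule ccontr)
    assume no: "\<not> ?thesis"
    have "lepoll (UNIV :: nat set set) Y"
    proof (rule perfect_compact_lepoll[OF comp clY])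
      show "Y \<noteq> {}" using D(2) by (simp add: Y_def)
    next
      fix x y assume xy: "x \<in> Y" "y \<in> Y" "x \<noteq> y"
      have xG: "x \<in> carrier G" "y \<in> carrier G" using xy YG by auto
      have "closedin T {y}" using haus xG(2) by (simp add: closedin_Hausdorff_sing_eq topsp)
      then have "openin T (carrier G - {y})" by (auto simp: closedin_def topsp)
      then obtain K where "openin T K" "closedin T K" "x \<in> K" "K \<subseteq> carrier G - {y}"
        using clopen_nbhd[of "carrier G - {y}" x] xG xy by auto
      then show "\<exists>D. openin T D \<and> closedin T D \<and> x \<in> D \<and> y \<notin> D" by auto
    next
      fix A x assume "openin T A" "x \<in> A" "x \<in> Y"
      then show "\<exists>y\<in>Y. y \<in> A \<and> y \<noteq> x" using no by auto
    qed
    then have "lepoll (UNIV :: real set) Y"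
      by (rule lepoll_trans1[OF eqpoll_sym[OF nat_sets_eqpoll_reals]])
    then obtain g where "inj_on g (UNIV :: real set)" "g ` UNIV \<subseteq> coprime_commutators G T"
      using YX unfolding lepoll_def by blast
    then have "(card_of (UNIV :: real set), card_of (coprime_commutators G T)) \<in> ordLeq"
      by (intro card_of_ordLeq[THEN iffD1]) auto
    then show False using not_ordLess_ordLeq[OF small] by simp
  qed
  then obtain A c where A: "openin T A" "c \<in> A" "c \<in> Y" "\<And>y. y \<in> Y \<Longrightarrow> y \<in> A \<Longrightarrow> y = c" by blast
  obtain x0 y0 where xy0: "(x0, y0) \<in> D" "c = cm x0 y0" using A(3) by (auto simp: Y_def f_def)
  have G0: "x0 \<in> carrier G" "y0 \<in> carrier G" using xy0 DG by auto
  define E where "E = {p \<in> topspace (prod_topology T T). f p \<in> A}"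
  have "openin (prod_topology T T) E"
    unfolding f_def E_def by (rule openin_continuous_map_preimage[OF cont_cm A(1)])
  moreover have "(x0, y0) \<in> E"
    using G0 A(2) xy0 by (simp add: topsp f_def E_def)
  ultimately have "\<exists>B C. openin T B \<and> openin T C \<and> x0 \<in> B \<and> y0 \<in> C \<and> B \<times> C \<subseteq> E"
    by (simp add: openin_prod_topology_alt)
  then obtain B C where BC: "openin T B" "openin T C" "x0 \<in> B" "y0 \<in> C" "B \<times> C \<subseteq> E"
    by auto
  obtain W1 where W1: "onormal W1" "W1 #> x0 \<subseteq> B" using ex_onormal_rcoset[OF BC(1,3)] by blast
  obtain W2 where W2: "onormal W2" "W2 #> y0 \<subseteq> C" using ex_onormal_rcoset[OF BC(2,4)] by blast
  have "cm x y = cm x0 y0" if xy: "(x, y) \<in> D" "x \<otimes> inv x0 \<in> W1 \<inter> W2" "y \<otimes> inv y0 \<in> W1 \<inter> W2" for x y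
  proof -
    have "x \<in> carrier G" "y \<in> carrier G" using xy DG by auto
    then have "x \<in> W1 #> x0" "y \<in> W2 #> y0"
      using rcoset_iff[OF onormalD(2)[OF W1(1)] G0(1)] rcoset_iff[OF onormalD(2)[OF W2(1)] G0(2)] xy by auto
    then have "(x, y) \<in> B \<times> C" using W1(2) W2(2) by auto
    then have "f (x, y) \<in> A" using subsetD[OF BC(5), of "(x, y)"] by (simp add: E_def)
    moreover have "f (x, y) \<in> Y" using xy(1) by (simp add: Y_def)
    ultimately have "f (x, y) = c" using A(4)[of "f (x, y)"] by simp
    then show ?thesis using xy0(2) by (simp add: f_def)
  qed
  then show ?thesis using xy0(1) onormal_Int[OF W1(1) W2(1)]
    by (intro exI[of _ x0] exI[of _ y0] exI[of _ "W1 \<inter> W2"]) simp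
qed

lemma onormal_finite_Inter:
  assumes "finite I" "\<And>i. i \<in> I \<Longrightarrow> \<exists>W. onormal W \<and> Q i W"
    and "\<And>i W W'. \<lbrakk>Q i W; W' \<subseteq> W\<rbrakk> \<Longrightarrow> Q i W'"
  shows "\<exists>W. onormal W \<and> (\<forall>i\<in>I. Q i W)"
  using assms(1,2)
proof (induction I rule: finite_induct)
  case empty show ?case using onormal_carrier by auto
next
  case (insert i I)
  then obtain W where W: "onormal W" "\<forall>i\<in>I. Q i W" by auto
  obtain W' where W': "onormal W'" "Q i W'" using insert.prems by auto
  have "Q j (W \<inter> W')" if "j \<in> insert i I" for j
    using that W(2) W'(2) assms(3)[of j W "W \<inter> W'"] assms(3)[of j W' "W \<inter> W'"] by auto
  then show ?case using onormal_Int[OF W(1) W'(1)] by blast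
qed

text \<open>The order of \<open>x\<close> modulo \<open>U\<close> divides the index but has only
  primes from \<open>sp x\<close>, so it is 1. This is how attention is confined to finitely many
  primes.\<close>

lemma mem_onormal_if_sp_disjoint:
  assumes "onormal U" "x \<in> carrier G" "sp x \<inter> prime_factors (card (rcosets U)) = {}"
  shows "x \<in> U"
proof -
  have "prime_factors (rord U x) \<subseteq> prime_factors (card (rcosets U))"
    using rord_dvd_index[OF assms(1,2)] index_pos[OF assms(1)] by (intro dvd_prime_factors) auto
  then have "prime_factors (rord U x) = {}" using prime_factors_rord[OF assms(1,2)] assms(3) by auto
  then have "rord U x = 1" using rord_pos[OF assms(1,2)] by (auto simp: prime_factorization_empty_iff)
  then show ?thesis using pow_mem_iff[OF assms(1,2), of 1] assms(2) by simp
qed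

end

section \<open>Uniform commutation when coprime commutators are few\<close>

locale small_profinite_group = profinite_group +
  assumes small: "(card_of (coprime_commutators G T), card_of (UNIV :: real set)) \<in> ordLess"
begin

text \<open>The pairs in question form a product of closed sets, so \<open>isolated_box\<close> and
  \<open>box_commute\<close> apply. The subgroup obtained depends on \<sigma> and \<tau>.\<close>

lemma ex_onormal_two_parts:
  assumes "\<sigma> \<inter> \<tau> = {}"
  shows "\<exists>U. onormal U \<and> (\<forall>u\<in>U. \<forall>v\<in>U. sp u \<subseteq> \<sigma> \<longrightarrow> sp v \<subseteq> \<tau> \<longrightarrow> u \<otimes> v = v \<otimes> u)"
proof -
  define D where "D = {x \<in> carrier G. sp x \<subseteq> \<sigma>} \<times> {x \<in> carrier G. sp x \<subseteq> \<tau>}"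
  have "closedin (prod_topology T T) D" by (simp add: D_def closedin_prod_Times_iff closedin_sp)
  moreover have "(\<one>, \<one>) \<in> D" using sp_one by (simp add: D_def)
  then have "D \<noteq> {}" by auto
  moreover have "sp x \<inter> sp y = {}" if "(x, y) \<in> D" for x y using that assms by (auto simp: D_def)
  ultimately obtain x0 y0 U where box: "(x0, y0) \<in> D" "onormal U"
    "\<And>x y. (x, y) \<in> D \<Longrightarrow> x \<otimes> inv x0 \<in> U \<Longrightarrow> y \<otimes> inv y0 \<in> U \<Longrightarrow> cm x y = cm x0 y0"
    using isolated_box[OF small, of D] by blast
  have "u \<otimes> v = v \<otimes> u" if "u \<in> U" "v \<in> U" "sp u \<subseteq> \<sigma>" "sp v \<subseteq> \<tau>" for u v
    by (rule box_commute[OF box(2), of x0 \<sigma> y0 \<tau>]) (use box(1,3) that in \<open>simp_all add: D_def\<close>)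
  then show ?thesis using box(2) by blast
qed

text \<open>Starting from the closed set of all coprime pairs, the base point of the box can be moved to
  \<open>(x\<^sub>1, y\<^sub>1)\<close> involving only finitely many primes. Further primes \<open>p\<close> and \<open>q\<close> may then be
  allowed in the two coordinates; the primes of \<open>x\<^sub>1\<close> and \<open>y\<^sub>1\<close> are treated one by one.\<close>
lemma ex_onormal_primes:
  "\<exists>U. onormal U \<and> (\<forall>p q. \<forall>u\<in>U. \<forall>v\<in>U. p \<noteq> q \<longrightarrow> sp u \<subseteq> {p} \<longrightarrow> sp v \<subseteq> {q} \<longrightarrow> u \<otimes> v = v \<otimes> u)"
proof -
  define A where "A p = {x \<in> carrier G. sp x \<subseteq> - {p}}" for p
  \<comment> \<open>Coprimality is a condition at each prime separately: one of the two coordinates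
    is a \<open>p'\<close>-element. In this form \<open>D\<close> is visibly closed.\<close>
  define D where "D = (\<Inter>p. A p \<times> carrier G \<union> carrier G \<times> A p)"
  have clA: "closedin T (A p)" for p unfolding A_def by (rule closedin_sp)
  have clG: "closedin T (carrier G)" using closedin_topspace[of T] by (simp add: topsp)
  have "closedin (prod_topology T T) (A p \<times> carrier G \<union> carrier G \<times> A p)" for p
    by (intro closedin_Un) (simp_all add: closedin_prod_Times_iff clA clG)
  then have "closedin (prod_topology T T) D" unfolding D_def by (intro closedin_Inter) auto
  moreover have "(\<one>, \<one>) \<in> D" using sp_one by (auto simp: A_def D_def)
  then have "D \<noteq> {}" by blast
  moreover have Diff: "(x, y) \<in> D \<longleftrightarrow> x \<in> carrier G \<and> y \<in> carrier G \<and> sp x \<inter> sp y = {}" for x y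
    by (auto simp: A_def D_def)
  then have "sp x \<inter> sp y = {}" if "(x, y) \<in> D" for x y using that by simp
  ultimately obtain x0 y0 U where box: "(x0, y0) \<in> D" "onormal U"
    "\<And>x y. (x, y) \<in> D \<Longrightarrow> x \<otimes> inv x0 \<in> U \<Longrightarrow> y \<otimes> inv y0 \<in> U \<Longrightarrow> cm x y = cm x0 y0"
    using isolated_box[OF small, of D] by blast
  have G0: "x0 \<in> carrier G" "y0 \<in> carrier G" "sp x0 \<inter> sp y0 = {}" using Diff[of x0 y0] box(1) by simp_all
  note sU = onormalD(2)[OF box(2)]
  define F where "F = prime_factors (card (rcosets U))"
  \<comment> \<open>Discarding the part of \<open>x\<close> at primes outside the index changes
    \<open>x\<close> only by an element of \<open>U\<close>, and leaves finitely many
    primes.\<close>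
  have red: "\<exists>x1. x1 \<in> carrier G \<and> sp x1 \<subseteq> sp x \<inter> F \<and> x1 \<otimes> inv x \<in> U" if x: "x \<in> carrier G" for x
  proof -
    obtain a b where ab: "a \<in> carrier G" "b \<in> carrier G" "x = a \<otimes> b" "sp a \<subseteq> sp x \<inter> F" "sp b \<subseteq> sp x - F"
      using parts_exist[OF x, of F] by blast
    have "b \<in> U" using mem_onormal_if_sp_disjoint[OF box(2) ab(2)] ab(5) by (auto simp: F_def)
    then have "a \<otimes> inv b \<otimes> inv a \<in> U"
      by (intro conj_mem(1)[OF onormalD(1)[OF box(2)] _ ab(1)]) (rule subgroup.m_inv_closed[OF sU])
    then show ?thesis using ab by (intro exI[of _ a]) (simp add: gsimps)
  qed
  obtain x1 where x1: "x1 \<in> carrier G" "sp x1 \<subseteq> sp x0 \<inter> F" "x1 \<otimes> inv x0 \<in> U" using red[OF G0(1)] by blast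
  obtain y1 where y1: "y1 \<in> carrier G" "sp y1 \<subseteq> sp y0 \<inter> F" "y1 \<otimes> inv y0 \<in> U" using red[OF G0(2)] by blast
  have mainstep: "u \<otimes> v = v \<otimes> u"
    if pq: "p \<noteq> q" "p \<notin> sp y1" "q \<notin> sp x1" and uv: "u \<in> U" "v \<in> U" "sp u \<subseteq> {p}" "sp v \<subseteq> {q}" for p q u v
  proof (rule box_commute[OF box(2), of x1 "insert p (sp x1)" y1 "insert q (sp y1)"])
    fix x y assume x: "x \<in> carrier G" "sp x \<subseteq> insert p (sp x1)" "x \<otimes> inv x1 \<in> U"
      and y: "y \<in> carrier G" "sp y \<subseteq> insert q (sp y1)" "y \<otimes> inv y1 \<in> U"
    have "(x \<otimes> inv x1) \<otimes> (x1 \<otimes> inv x0) \<in> U" by (rule subgroup.m_closed[OF sU x(3) x1(3)])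
    then have xU: "x \<otimes> inv x0 \<in> U" using x(1) x1(1) G0 by (simp add: gsimps)
    have "(y \<otimes> inv y1) \<otimes> (y1 \<otimes> inv y0) \<in> U" by (rule subgroup.m_closed[OF sU y(3) y1(3)])
    then have yU: "y \<otimes> inv y0 \<in> U" using y(1) y1(1) G0 by (simp add: gsimps)
    \<comment> \<open>The assumptions on \<open>p\<close> and \<open>q\<close> keep the enlarged
      sets of primes disjoint, so all these pairs still belong to \<open>D\<close> and lie in the
      original box.\<close>
    have "sp x \<inter> sp y = {}" "sp x1 \<inter> sp y1 = {}" using x(2) y(2) x1(2) y1(2) G0(3) pq by blast+
    then have "(x, y) \<in> D" "(x1, y1) \<in> D" using Diff x(1) y(1) x1(1) y1(1) by simp_all
    then show "cm x y = cm x1 y1" using box(3)[of x y] box(3)[of x1 y1] xU yU x1(3) y1(3) by simp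
  qed (use x1 y1 uv in auto)
  define F' where "F' = sp x1 \<union> sp y1"
  have "finite F'" unfolding F'_def F_def using x1(2) y1(2) finite_subset[of _ F] by (auto simp: F_def)
  then have "\<exists>V. onormal V \<and> (\<forall>p\<in>F'. \<forall>u\<in>V. \<forall>v\<in>V. sp u \<subseteq> {p} \<longrightarrow> sp v \<subseteq> - {p} \<longrightarrow> u \<otimes> v = v \<otimes> u)"
  proof (rule onormal_finite_Inter)
    fix p
    show "\<exists>V. onormal V \<and> (\<forall>u\<in>V. \<forall>v\<in>V. sp u \<subseteq> {p} \<longrightarrow> sp v \<subseteq> - {p} \<longrightarrow> u \<otimes> v = v \<otimes> u)"
      by (rule ex_onormal_two_parts) simp
  qed blast
  then obtain V where V: "onormal V" "\<And>p u v. \<lbrakk>p \<in> F'; u \<in> V; v \<in> V; sp u \<subseteq> {p}; sp v \<subseteq> - {p}\<rbrakk> \<Longrightarrow> u \<otimes> v = v \<otimes> u"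
    by blast
  have "u \<otimes> v = v \<otimes> u" if "u \<in> U \<inter> V" "v \<in> U \<inter> V" "p \<noteq> q" "sp u \<subseteq> {p}" "sp v \<subseteq> {q}" for p q u v
  proof -
    consider "p \<in> F'" | "q \<in> F'" | "p \<notin> F'" "q \<notin> F'" by blast
    then show ?thesis
    proof cases
      case 1 then show ?thesis using V(2)[of p u v] that by auto
    next
      case 2
      then have "v \<otimes> u = u \<otimes> v" using V(2)[of q v u] that by auto
      then show ?thesis by simp
    next
      case 3 then show ?thesis using mainstep[of p q u v] that by (auto simp: F'_def)
    qed
  qed
  then show ?thesis using onormal_Int[OF box(2) V(1)] by blast
qed

text \<open>Two nested uses of \<open>primewise_mem\<close>, with the centralizer of
  \<open>v\<close> and then with that of a \<open>p\<close>-element \<open>z\<close>, reduce to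
  elements whose orders involve one prime each.\<close>

lemma ex_onormal_coprime:
  "\<exists>U. onormal U \<and> (\<forall>u\<in>U. \<forall>v\<in>U. sp u \<inter> sp v = {} \<longrightarrow> u \<otimes> v = v \<otimes> u)"
proof -
  obtain U where U: "onormal U" "\<And>p q u v. \<lbrakk>u \<in> U; v \<in> U; p \<noteq> q; sp u \<subseteq> {p}; sp v \<subseteq> {q}\<rbrakk> \<Longrightarrow> u \<otimes> v = v \<otimes> u"
    using ex_onormal_primes by blast
  note cU = onormal_csubgroup[OF U(1)]
  have UG: "u \<in> carrier G" if "u \<in> U" for u using that onormalD(4)[OF U(1)] by auto
  have "u \<otimes> v = v \<otimes> u" if uv: "u \<in> U" "v \<in> U" "sp u \<inter> sp v = {}" for u v
  proof -
    have "u \<in> {c \<in> carrier G. c \<otimes> v = v \<otimes> c}"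
    proof (rule primewise_mem[OF cU centralizer_iff[OF UG[OF uv(2)]] uv(1)])
      fix p z assume z: "p \<in> sp u" "z \<in> U" "sp z \<subseteq> {p}"
      have "v \<in> {c \<in> carrier G. c \<otimes> z = z \<otimes> c}"
      proof (rule primewise_mem[OF cU centralizer_iff[OF UG[OF z(2)]] uv(2)])
        fix q w assume w: "q \<in> sp v" "w \<in> U" "sp w \<subseteq> {q}"
        then have "p \<noteq> q" using uv(3) z(1) by auto
        then show "w \<in> {c \<in> carrier G. c \<otimes> z = z \<otimes> c}" using U(2)[OF z(2) w(2) _ z(3) w(3)] UG[OF w(2)] by simp
      qed
      then show "z \<in> {c \<in> carrier G. c \<otimes> v = v \<otimes> c}" using UG[OF z(2)] by simp
    qed
    then show ?thesis by simp
  qed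
  then show ?thesis using U(1) by blast
qed

text \<open>The same argument with the first coordinate frozen at \<open>x\<close>. Only the half of
  the box argument in the second variable is used, so \<open>x\<close> may lie outside
  \<open>W\<close>, at the price that \<open>W\<close> depends on \<open>x\<close>.\<close>

lemma single_centralizes:
  assumes x: "x \<in> carrier G" "sp x \<inter> \<tau> = {}"
  shows "\<exists>W. onormal W \<and> (\<forall>v\<in>W. sp v \<subseteq> \<tau> \<longrightarrow> x \<otimes> v = v \<otimes> x)"
proof -
  define D where "D = {x} \<times> {y \<in> carrier G. sp y \<subseteq> \<tau>}"
  have "closedin T {x}" using haus x(1) by (simp add: closedin_Hausdorff_sing_eq topsp)
  then have "closedin (prod_topology T T) D" by (simp add: D_def closedin_prod_Times_iff closedin_sp)
  moreover have "(x, \<one>) \<in> D" using sp_one by (simp add: D_def)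
  then have "D \<noteq> {}" by auto
  moreover have "sp a \<inter> sp b = {}" if "(a, b) \<in> D" for a b using that x by (auto simp: D_def)
  ultimately obtain x0 y0 U where box: "(x0, y0) \<in> D" "onormal U"
    "\<And>a b. (a, b) \<in> D \<Longrightarrow> a \<otimes> inv x0 \<in> U \<Longrightarrow> b \<otimes> inv y0 \<in> U \<Longrightarrow> cm a b = cm x0 y0"
    using isolated_box[OF small, of D] by blast
  have x0: "x0 = x" and y0: "y0 \<in> carrier G" "sp y0 \<subseteq> \<tau>" using box(1) by (auto simp: D_def)
  have xx: "x \<otimes> inv x \<in> U" using x subgroup.one_closed[OF onormalD(2)[OF box(2)]] by simp
  have "x \<otimes> v = v \<otimes> x" if v: "v \<in> U" "sp v \<subseteq> \<tau>" for v
  proof -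
    have "v \<in> {c \<in> carrier G. c \<otimes> x = x \<otimes> c}"
    proof (rule coset_elements_mem[OF box(2) y0 centralizer_iff[OF x(1)] _ v])
      fix y assume y: "y \<in> carrier G" "sp y \<subseteq> \<tau>" "y \<otimes> inv y0 \<in> U"
      have "cm x y = cm x y0" using box(3)[of x y] y xx by (simp add: x0 D_def)
      then show "y \<otimes> inv y0 \<in> {c \<in> carrier G. c \<otimes> x = x \<otimes> c}"
        using cm_eq_iff[OF x(1) y(1) y0(1)] y(1) y0(1) by simp
    qed
    then show ?thesis by simp
  qed
  then show ?thesis using box(2) by blast
qed

text \<open>One \<open>p\<close>-element \<open>x\<close> of \<open>R\<close> suffices: the centralizer
  \<open>C\<close> of the \<open>p'\<close>-elements of \<open>?W\<close> is normal in \<open>G\<close>, and any other \<open>x'\<close> is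
  \<open>b\<close> times an element of \<open>C\<close> with \<open>b\<close> a \<open>p'\<close>-element having a
  power of \<open>p\<close>-power exponent in \<open>C\<close>.\<close>
lemma coset_centralizes:
  assumes U: "onormal U" and UU: "\<And>u v. \<lbrakk>u \<in> U; v \<in> U; sp u \<inter> sp v = {}\<rbrakk> \<Longrightarrow> u \<otimes> v = v \<otimes> u"
    and R: "R \<in> rcosets U"
  shows "\<exists>W. onormal W \<and> (\<forall>x\<in>R. \<forall>v\<in>W. sp x \<subseteq> {p} \<longrightarrow> sp v \<subseteq> - {p} \<longrightarrow> x \<otimes> v = v \<otimes> x)"
proof (cases "\<exists>x\<in>R. sp x \<subseteq> {p}")
  case False
  then show ?thesis using onormal_carrier by blast
next
  case True
  note sU = onormalD(2)[OF U]
  have UG: "u \<in> carrier G" if "u \<in> U" for u using that onormalD(4)[OF U] by auto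
  obtain x where x: "x \<in> R" "sp x \<subseteq> {p}" using True by blast
  have RG: "R \<subseteq> carrier G" using R rcosets_part_G[OF sU] by auto
  then have xG: "x \<in> carrier G" using x by auto
  have "sp x \<inter> - {p} = {}" using x by auto
  then obtain W1 where W1: "onormal W1" "\<And>v. v \<in> W1 \<Longrightarrow> sp v \<subseteq> - {p} \<Longrightarrow> x \<otimes> v = v \<otimes> x"
    using single_centralizes[OF xG, of "- {p}"] by blast
  let ?W = "W1 \<inter> U"
  have W: "onormal ?W" by (rule onormal_Int[OF W1(1) U])
  define Z where "Z = {v \<in> ?W. sp v \<subseteq> - {p}}"
  have ZG: "Z \<subseteq> carrier G" using UG by (auto simp: Z_def)
  define C where "C = {c \<in> carrier G. \<forall>s\<in>Z. c \<otimes> s = s \<otimes> c}"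
  have C: "csubgroup C" unfolding C_def by (rule centralizer_csubgroup[OF ZG])
  note sC = csubgroupD(1)[OF C]
  have CG: "c \<in> carrier G" if "c \<in> C" for c using that by (simp add: C_def)
  have Cconj: "inv g \<otimes> c \<otimes> g \<in> C" if g: "g \<in> carrier G" and c: "c \<in> C" for g c
  proof -
    have "(inv g \<otimes> c \<otimes> g) \<otimes> s = s \<otimes> (inv g \<otimes> c \<otimes> g)" if s: "s \<in> Z" for s
    proof -
      have sG: "s \<in> carrier G" using s ZG by auto
      have "inv (inv g) \<otimes> s \<otimes> inv g \<in> ?W"
        using conj_mem(2)[OF onormalD(1)[OF W], of s "inv g"] s g by (simp add: Z_def)
      moreover have "sp (inv (inv g) \<otimes> s \<otimes> inv g) = sp s" by (rule sp_conj[OF sG]) (use g in simp)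
      ultimately have "g \<otimes> s \<otimes> inv g \<in> Z" using s g by (simp add: Z_def)
      then have e: "c \<otimes> (g \<otimes> s \<otimes> inv g) = (g \<otimes> s \<otimes> inv g) \<otimes> c" using c by (simp add: C_def)
      have "(inv g \<otimes> c \<otimes> g) \<otimes> s = inv g \<otimes> (c \<otimes> (g \<otimes> s \<otimes> inv g)) \<otimes> g"
        using g sG CG[OF c] by (simp add: gsimps)
      also have "\<dots> = s \<otimes> (inv g \<otimes> c \<otimes> g)" unfolding e using g sG CG[OF c] by (simp add: gsimps)
      finally show ?thesis .
    qed
    then show ?thesis using g CG[OF c] by (simp add: C_def)
  qed
  have UC: "u \<in> C" if u: "u \<in> U" "sp u \<subseteq> {p}" for u
  proof -
    have "u \<otimes> s = s \<otimes> u" if s: "s \<in> Z" for s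
    proof -
      have "s \<in> U" "sp u \<inter> sp s = {}" using s u(2) by (auto simp: Z_def)
      then show ?thesis using UU[OF u(1)] by simp
    qed
    then show ?thesis using UG[OF u(1)] by (simp add: C_def)
  qed
  have xC: "x \<in> C" using xG W1(2) by (auto simp: C_def Z_def)
  have mem: "x' \<in> C" if x': "x' \<in> R" "sp x' \<subseteq> {p}" for x'
  proof -
    have x'G: "x' \<in> carrier G" using x' RG by auto
    obtain g where g: "g \<in> carrier G" "R = U #> g" using R by (auto simp: RCOSETS_def)
    have "R = U #> x" using repr_independence[of x U g] x(1) g sU by simp
    then have uU: "x' \<otimes> inv x \<in> U" using rcoset_iff[OF sU xG x'G] x'(1) by simp
    obtain a b where ab0: "a \<in> carrier G" "b \<in> carrier G" "x' \<otimes> inv x = a \<otimes> b" "a \<otimes> b = b \<otimes> a"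
      "sp a \<subseteq> sp (x' \<otimes> inv x) \<inter> {p}" "sp b \<subseteq> sp (x' \<otimes> inv x) - {p}"
      using parts_exist[OF UG[OF uU], of "{p}"] by blast
    then have ab: "a \<in> carrier G" "b \<in> carrier G" "x' \<otimes> inv x = a \<otimes> b" "a \<otimes> b = b \<otimes> a"
      "sp a \<subseteq> {p}" "sp b \<inter> {p} = {}" by auto
    have "sp a \<inter> sp b = {}" using ab(5,6) by blast
    then have abU: "a \<in> U" "b \<in> U"
      using part_mem_subgroup[OF ab(1,2) _ ab(4) onormal_csubgroup[OF U]] uU ab(3) by simp_all
    have c0: "a \<otimes> x \<in> C" by (rule subgroup.m_closed[OF sC UC[OF abU(1) ab(5)] xC])
    have "x' = (x' \<otimes> inv x) \<otimes> x" using xG x'G by (simp add: gsimps)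
    then have x'e: "x' = b \<otimes> (a \<otimes> x)" unfolding ab(3,4) using ab(1,2) xG by (simp add: m_assoc)
    have pow: "\<exists>c\<in>C. x' [^] (n::nat) = b [^] n \<otimes> c" for n
    proof (induction n)
      case 0 then show ?case using subgroup.one_closed[OF sC] by (intro bexI[of _ \<one>]) simp_all
    next
      case (Suc n)
      then obtain c where c: "c \<in> C" "x' [^] n = b [^] n \<otimes> c" by blast
      have "x' [^] Suc n = b [^] n \<otimes> c \<otimes> (b \<otimes> (a \<otimes> x))" using c(2) x'e by simp
      also have "\<dots> = b [^] Suc n \<otimes> ((inv b \<otimes> c \<otimes> b) \<otimes> (a \<otimes> x))"
        using ab(1,2) xG CG[OF c(1)] by (simp add: gsimps)
      finally show ?case using subgroup.m_closed[OF sC Cconj[OF ab(2) c(1)] c0] by blast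
    qed
    \<comment> \<open>Only \<open>p\<close> can divide \<open>?m\<close>, and
      \<open>x' [^] ?m\<close> is a \<open>p\<close>-element of \<open>U\<close>, so
      \<open>UC\<close> puts it into \<open>C\<close>. By \<open>pow\<close> the same then holds for
      \<open>b [^] ?m\<close>.\<close>
    let ?m = "rord U x'"
    have "x' [^] ?m \<in> C" using UC[OF rord_mem[OF U x'G]] sp_pow[OF x'G] x'(2) by blast
    moreover obtain c where c: "c \<in> C" "x' [^] ?m = b [^] ?m \<otimes> c" using pow by blast
    ultimately have "(b [^] ?m \<otimes> c) \<otimes> inv c \<in> C"
      using subgroup.m_closed[OF sC _ subgroup.m_inv_closed[OF sC c(1)]] by simp
    then have bm: "b [^] ?m \<in> C" using ab(2) CG[OF c(1)] by (simp add: m_assoc)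
    have "b \<in> C"
    proof (rule part_mem[OF one_closed _ ab(2) ab(6) _ C])
      show "sp \<one> \<subseteq> {p}" by (simp add: sp_one)
      show "\<one> \<otimes> b = b \<otimes> \<one>" using ab by simp
      fix V assume V: "onormal V"
      show "\<exists>n>0. prime_factors n \<subseteq> {p} \<and> (\<exists>c\<in>C. (\<one> \<otimes> b) [^] n \<otimes> inv c \<in> V)"
        using rord_pos[OF U x'G] prime_factors_rord[OF U x'G] x'(2) bm ab(2) subgroup.one_closed[OF onormalD(2)[OF V]]
        by (intro exI[of _ ?m] conjI bexI[of _ "b [^] ?m"]) auto
    qed
    then show ?thesis using x'e subgroup.m_closed[OF sC _ c0] by simp
  qed
  have "x' \<otimes> v = v \<otimes> x'" if "x' \<in> R" "v \<in> ?W" "sp x' \<subseteq> {p}" "sp v \<subseteq> - {p}" for x' v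
    using mem[OF that(1,3)] that(2,4) by (simp add: C_def Z_def)
  then show ?thesis using W by blast
qed

text \<open>For each of the finitely many primes of the index and each coset of \<open>U\<close>,
  \<open>coset_centralizes\<close> gives a subgroup, and these are intersected. For any other prime
  \<open>p\<close> the \<open>p\<close>-elements lie in \<open>U\<close>, where coprime elements
  commute already. \<open>primewise_mem\<close> passes from \<open>p\<close>-elements to arbitrary
  \<open>x\<close>.\<close>

theorem ex_onormal_centralized:
  "\<exists>U. onormal U \<and> (\<forall>x\<in>carrier G. \<forall>v\<in>U. sp x \<inter> sp v = {} \<longrightarrow> x \<otimes> v = v \<otimes> x)"
proof -
  obtain U where U: "onormal U" "\<And>u v. \<lbrakk>u \<in> U; v \<in> U; sp u \<inter> sp v = {}\<rbrakk> \<Longrightarrow> u \<otimes> v = v \<otimes> u"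
    using ex_onormal_coprime by blast
  note sU = onormalD(2)[OF U(1)]
  define F where "F = prime_factors (card (rcosets U))"
  define Q where "Q i W \<longleftrightarrow> (\<forall>x\<in>snd i. \<forall>v\<in>W. sp x \<subseteq> {fst i} \<longrightarrow> sp v \<subseteq> - {fst i} \<longrightarrow> x \<otimes> v = v \<otimes> x)"
    for i :: "nat \<times> 'a set" and W
  have "finite (F \<times> rcosets U)" using finite_rcosets[OF U(1)] by (simp add: F_def)
  then have "\<exists>W. onormal W \<and> (\<forall>i\<in>F \<times> rcosets U. Q i W)"
  proof (rule onormal_finite_Inter)
    fix i assume i: "i \<in> F \<times> rcosets U"
    show "\<exists>W. onormal W \<and> Q i W"
      unfolding Q_def by (rule coset_centralizes[OF U]) (use i in auto)
  next
    fix i W W' assume "Q i W" "W' \<subseteq> W"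
    then show "Q i W'" unfolding Q_def by blast
  qed
  then obtain W0 where W0: "onormal W0" "\<And>i. i \<in> F \<times> rcosets U \<Longrightarrow> Q i W0" by blast
  let ?W = "W0 \<inter> U"
  have W: "onormal ?W" by (rule onormal_Int[OF W0(1) U(1)])
  have *: "x \<otimes> v = v \<otimes> x" if x: "x \<in> carrier G" "sp x \<subseteq> {p}" and v: "v \<in> ?W" "p \<notin> sp v" for x v p
  proof (cases "p \<in> F")
    case True
    have "U #> x \<in> rcosets U" by (rule rcosetsI[OF subgroup.subset[OF sU] x(1)])
    then have "Q (p, U #> x) W0" using W0(2) True by simp
    moreover have "x \<in> U #> x" by (rule rcos_self[OF x(1) sU])
    ultimately show ?thesis using x v by (auto simp: Q_def)
  next
    case False
    then have "x \<in> U" using mem_onormal_if_sp_disjoint[OF U(1) x(1)] x(2) by (auto simp: F_def)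
    then show ?thesis using U(2)[of x v] x(2) v by auto
  qed
  have "x \<otimes> v = v \<otimes> x" if x: "x \<in> carrier G" and v: "v \<in> ?W" and xv: "sp x \<inter> sp v = {}" for x v
  proof -
    have vG: "v \<in> carrier G" using v onormalD(4)[OF W] by auto
    have "x \<in> {c \<in> carrier G. c \<otimes> v = v \<otimes> c}"
    proof (rule primewise_mem[OF onormal_csubgroup[OF onormal_carrier] centralizer_iff[OF vG] x])
      fix p z assume z: "p \<in> sp x" "z \<in> carrier G" "sp z \<subseteq> {p}"
      then have "p \<notin> sp v" using xv by auto
      then show "z \<in> {c \<in> carrier G. c \<otimes> v = v \<otimes> c}" using *[OF z(2,3) v] z(2) by simp
    qed
    then show ?thesis by simp
  qed
  then show ?thesis using W by blast
qed

end

section \<open>Commutators modulo a centralized open normal subgroup\<close>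

lemma finite_image_factor:
  assumes "finite (g ` S)" "\<And>x y. \<lbrakk>x \<in> S; y \<in> S; g x = g y\<rbrakk> \<Longrightarrow> f x = f y"
  shows "finite (f ` S)"
proof -
  have "f x \<in> (\<lambda>b. f (inv_into S g b)) ` g ` S" if x: "x \<in> S" for x
  proof -
    have "inv_into S g (g x) \<in> S" "g (inv_into S g (g x)) = g x"
      using x by (auto intro: inv_into_into f_inv_into_f)
    then have "f x = f (inv_into S g (g x))" using assms(2)[of x "inv_into S g (g x)"] x by simp
    then show ?thesis using x by blast
  qed
  then have "f ` S \<subseteq> (\<lambda>b. f (inv_into S g b)) ` g ` S" by blast
  then show ?thesis by (rule finite_subset) (use assms(1) in simp)
qed

locale centralized_profinite_group = profinite_group +
  fixes U
  assumes U: "onormal U"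
    and cent: "\<And>x v. \<lbrakk>x \<in> carrier G; v \<in> U; sp x \<inter> sp v = {}\<rbrakk> \<Longrightarrow> x \<otimes> v = v \<otimes> x"
begin

lemma sU: "subgroup U G" and UG: "u \<in> U \<Longrightarrow> u \<in> carrier G"
  using onormalD(2,4)[OF U] by auto

text \<open>\<open>a\<close> is the part of \<open>x\<close> at the primes of
  \<open>rord W x\<close>. The order of the other part modulo \<open>W\<close> has no prime left,
  neither inside nor outside that set, so that part lies in \<open>W\<close>.\<close>

lemma lift_sp:
  assumes C: "csubgroup C" and W: "onormal W" and x: "x \<in> C"
  shows "\<exists>a\<in>C. W #> a = W #> x \<and> sp a \<subseteq> prime_factors (rord W x)"
proof -
  have xG: "x \<in> carrier G" using x csubgroupD(3)[OF C] by auto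
  obtain a b where ab: "a \<in> carrier G" "b \<in> carrier G" "x = a \<otimes> b" "a \<otimes> b = b \<otimes> a"
    "sp a \<subseteq> sp x \<inter> prime_factors (rord W x)" "sp b \<subseteq> sp x - prime_factors (rord W x)"
    "prime_factors (rord W b) \<subseteq> prime_factors (rord W x)"
    using parts_exist[OF xG, of "prime_factors (rord W x)"] W by blast
  have "sp a \<inter> sp b = {}" using ab(5,6) by blast
  then have aC: "a \<in> C" using part_mem_subgroup(1)[OF ab(1,2) _ ab(4) C] x ab(3) by simp
  have "prime_factors (rord W b) = {}" using ab(6,7) prime_factors_rord[OF W ab(2)] by blast
  then have "rord W b = 1" using rord_pos[OF W ab(2)] by (auto simp: prime_factorization_empty_iff)
  then have "b \<in> W" using pow_mem_iff[OF W ab(2), of 1] ab(2) by simp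
  then have "inv b \<in> W" by (rule subgroup.m_inv_closed[OF onormalD(2)[OF W]])
  then have "a \<otimes> inv b \<otimes> inv a \<in> W" by (rule conj_mem(1)[OF onormalD(1)[OF W] _ ab(1)])
  then have "a \<otimes> inv x \<in> W" unfolding ab(3) using ab(1,2) by (simp add: gsimps)
  then have "W #> a = W #> x" using rcoset_eq_iff[OF onormalD(2)[OF W] ab(1) xG] by simp
  then show ?thesis using aC ab(5) by blast
qed

text \<open>The claim is tested in the finite image of \<open>U\<close> modulo \<open>W\<close>.
  Elements of coprime orders there lift by \<open>lift_sp\<close> to elements of \<open>U\<close>
  with disjoint \<open>sp\<close>, so they commute, and \<open>pi_elements_mult\<close>
  applies.\<close>

lemma sp_mult_U:
  assumes a: "a \<in> U" "sp a \<subseteq> \<sigma>" and b: "b \<in> U" "sp b \<subseteq> \<sigma>"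
  shows "sp (a \<otimes> b) \<subseteq> \<sigma>"
proof (rule sp_leI)
  show "a \<otimes> b \<in> carrier G" using UG a b by simp
  fix W' assume W': "onormal W'"
  define W where "W = W' \<inter> U"
  have W: "onormal W" unfolding W_def by (rule onormal_Int[OF W' U])
  define Q where "Q = G Mod W"
  define h where "h z = W #> z" for z
  interpret q: group_hom G Q h
    using normal_quotient_hom[OF onormalD(1)[OF W]] by (simp add: Q_def h_def[abs_def])
  have sH: "subgroup (h ` U) Q" by (rule q.subgroup_img_is_subgroup[OF sU])
  define H where "H = Q\<lparr>carrier := h ` U\<rparr>"
  interpret H: group H unfolding H_def by (rule q.H.subgroup_imp_group[OF sH])
  have hQ: "h u \<in> carrier Q" if "u \<in> U" for u using q.hom_closed[OF UG[OF that]] .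
  have ordH: "H.ord (h u) = rord W u" if u: "u \<in> U" for u
  proof -
    have hu: "h u \<in> carrier H" using u by (simp add: H_def)
    have "h u [^]\<^bsub>H\<^esub> n = \<one>\<^bsub>H\<^esub> \<longleftrightarrow> rord W u dvd n" for n :: nat
    proof -
      have "h u [^]\<^bsub>H\<^esub> n = h u [^]\<^bsub>Q\<^esub> n" "\<one>\<^bsub>H\<^esub> = \<one>\<^bsub>Q\<^esub>" by (simp_all add: H_def nat_pow_def)
      then show ?thesis using q.H.pow_eq_id[OF hQ[OF u], of n] by (simp add: rord_def Q_def h_def)
    qed
    then show ?thesis using H.ord_unique[OF hu] by blast
  qed
  have multH: "A \<otimes>\<^bsub>H\<^esub> B = A \<otimes>\<^bsub>Q\<^esub> B" for A B by (simp add: H_def)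
  interpret H: coprime_commuting_group H
  proof unfold_locales
    show "finite (carrier H)"
    proof (rule finite_subset)
      show "carrier H \<subseteq> carrier Q" using hQ by (auto simp: H_def)
      show "finite (carrier Q)" unfolding Q_def by (rule finite_Mod[OF W])
    qed
    fix A B assume A: "A \<in> carrier H" and B: "B \<in> carrier H"
      and disj: "prime_factors (H.ord A) \<inter> prime_factors (H.ord B) = {}"
    obtain u where u: "u \<in> U" "A = h u" using A by (auto simp: H_def)
    obtain v where v: "v \<in> U" "B = h v" using B by (auto simp: H_def)
    obtain u' where u': "u' \<in> U" "h u' = h u" "sp u' \<subseteq> prime_factors (rord W u)"
      using lift_sp[OF onormal_csubgroup[OF U] W u(1)] unfolding h_def by blast
    obtain v' where v': "v' \<in> U" "h v' = h v" "sp v' \<subseteq> prime_factors (rord W v)"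
      using lift_sp[OF onormal_csubgroup[OF U] W v(1)] unfolding h_def by blast
    have "sp u' \<inter> sp v' = {}" using disj u'(3) v'(3) ordH[OF u(1)] ordH[OF v(1)] u(2) v(2) by auto
    then have "u' \<otimes> v' = v' \<otimes> u'" by (rule cent[OF UG[OF u'(1)] v'(1)])
    then have "h u' \<otimes>\<^bsub>Q\<^esub> h v' = h v' \<otimes>\<^bsub>Q\<^esub> h u'"
      using q.hom_mult[OF UG[OF u'(1)] UG[OF v'(1)]] q.hom_mult[OF UG[OF v'(1)] UG[OF u'(1)]] by simp
    then show "A \<otimes>\<^bsub>H\<^esub> B = B \<otimes>\<^bsub>H\<^esub> A" using u(2) v(2) u'(2) v'(2) by (simp add: multH)
  qed
  have abU: "a \<otimes> b \<in> U" by (rule subgroup.m_closed[OF sU a(1) b(1)])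
  have "prime_factors (H.ord (h a \<otimes>\<^bsub>H\<^esub> h b)) \<subseteq> \<sigma>"
  proof (rule H.pi_elements_mult)
    show "h a \<in> carrier H" "h b \<in> carrier H" using a b by (simp_all add: H_def)
    show "prime_factors (H.ord (h a)) \<subseteq> \<sigma>"
      using prime_factors_rord[OF W UG[OF a(1)]] a(2) ordH[OF a(1)] by auto
    show "prime_factors (H.ord (h b)) \<subseteq> \<sigma>"
      using prime_factors_rord[OF W UG[OF b(1)]] b(2) ordH[OF b(1)] by auto
  qed
  moreover have "h a \<otimes>\<^bsub>H\<^esub> h b = h (a \<otimes> b)" using q.hom_mult[OF UG[OF a(1)] UG[OF b(1)]] by (simp add: multH)
  ultimately have "prime_factors (rord W (a \<otimes> b)) \<subseteq> \<sigma>" using ordH[OF abU] by simp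
  moreover have "(a \<otimes> b) [^] rord W (a \<otimes> b) \<in> W'" using rord_mem[OF W UG[OF abU]] by (simp add: W_def)
  ultimately show "\<exists>n>0. (a \<otimes> b) [^] n \<in> W' \<and> prime_factors n \<subseteq> \<sigma>"
    using rord_pos[OF W UG[OF abU]] by blast
qed

section \<open>The decomposition of \<open>U\<close> into a \<sigma>-part and a
  \<sigma>'-part\<close>

definition Upart :: "nat set \<Rightarrow> 'a set" where
  "Upart \<sigma> = {u \<in> U. sp u \<subseteq> \<sigma>}"

lemma Upart_csubgroup: "csubgroup (Upart \<sigma>)"
proof -
  have "subgroup (Upart \<sigma>) G"
  proof (rule subgroupI)
    show "Upart \<sigma> \<subseteq> carrier G" using UG by (auto simp: Upart_def)
    show "Upart \<sigma> \<noteq> {}" using subgroup.one_closed[OF sU] sp_one by (auto simp: Upart_def)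
  next
    fix a assume "a \<in> Upart \<sigma>"
    then show "inv a \<in> Upart \<sigma>" using subgroup.m_inv_closed[OF sU] sp_inv UG by (auto simp: Upart_def)
  next
    fix a b assume "a \<in> Upart \<sigma>" "b \<in> Upart \<sigma>"
    then show "a \<otimes> b \<in> Upart \<sigma>"
      using subgroup.m_closed[OF sU, of a b] sp_mult_U[of a \<sigma> b] by (simp add: Upart_def)
  qed
  moreover have "Upart \<sigma> = U \<inter> {x \<in> carrier G. sp x \<subseteq> \<sigma>}" using UG by (auto simp: Upart_def)
  then have "closedin T (Upart \<sigma>)"
    using closedin_Int[OF csubgroupD(2)[OF onormal_csubgroup[OF U]] closedin_sp] by simp
  ultimately show ?thesis by (simp add: csubgroup_def)
qed

lemma Upart_conj: "u \<in> Upart \<sigma> \<Longrightarrow> g \<in> carrier G \<Longrightarrow> g \<otimes> u \<otimes> inv g \<in> Upart \<sigma>"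
  using conj_mem(1)[OF onormalD(1)[OF U], of u g] sp_conj[OF UG, of u "inv g"] by (simp add: Upart_def)

lemma disjoint_sp_one: "x \<in> carrier G \<Longrightarrow> sp x \<subseteq> \<sigma> \<Longrightarrow> sp x \<inter> \<sigma> = {} \<Longrightarrow> x = \<one>"
  using sp_empty[of x] by blast

text \<open>Split the quotient into a \<sigma>-element \<open>a\<close> and a \<sigma>'-element
  \<open>b\<close> of \<open>U\<close>. First \<open>a \<otimes> x\<close> is shown to be a
  \<sigma>-element; then \<open>b\<close> commutes with it, so
  \<open>b = x' \<otimes> inv (a \<otimes> x)\<close> is a product of commuting \<sigma>-elements
  and must be trivial.\<close>

lemma coset_quotient_sp:
  assumes x: "x \<in> carrier G" "sp x \<subseteq> \<sigma>" and x': "x' \<in> carrier G" "sp x' \<subseteq> \<sigma>" and xx: "x' \<otimes> inv x \<in> U"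
  shows "sp (x' \<otimes> inv x) \<subseteq> \<sigma>"
proof -
  let ?u = "x' \<otimes> inv x"
  obtain a b where ab: "a \<in> carrier G" "b \<in> carrier G" "?u = a \<otimes> b" "a \<otimes> b = b \<otimes> a"
    "sp a \<subseteq> sp ?u \<inter> \<sigma>" "sp b \<subseteq> sp ?u - \<sigma>"
    using parts_exist[OF UG[OF xx], of \<sigma>] by blast
  have "sp a \<inter> sp b = {}" using ab(5,6) by blast
  then have abU: "a \<in> U" "b \<in> U"
    using part_mem_subgroup[OF ab(1,2) _ ab(4) onormal_csubgroup[OF U]] xx ab(3) by simp_all
  have aP: "a \<in> Upart \<sigma>" using abU ab(5) by (simp add: Upart_def)
  have axG: "a \<otimes> x \<in> carrier G" using ab(1) x(1) by simp
  obtain c d where cd: "c \<in> carrier G" "d \<in> carrier G" "a \<otimes> x = c \<otimes> d" "c \<otimes> d = d \<otimes> c"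
    "sp c \<subseteq> sp (a \<otimes> x) \<inter> \<sigma>" "sp d \<subseteq> sp (a \<otimes> x) - \<sigma>"
    using parts_exist[OF axG, of \<sigma>] by blast
  have pow: "\<exists>r\<in>Upart \<sigma>. (a \<otimes> x) [^] (n::nat) = r \<otimes> x [^] n" for n
  proof (induction n)
    case 0 then show ?case using subgroup.one_closed[OF csubgroupD(1)[OF Upart_csubgroup]] by (intro bexI[of _ \<one>]) simp_all
  next
    case (Suc n)
    then obtain r where r: "r \<in> Upart \<sigma>" "(a \<otimes> x) [^] n = r \<otimes> x [^] n" by blast
    have rG: "r \<in> carrier G" using r csubgroupD(3)[OF Upart_csubgroup] by blast
    have "(a \<otimes> x) [^] Suc n = (r \<otimes> (x [^] n \<otimes> a \<otimes> inv (x [^] n))) \<otimes> x [^] Suc n"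
      using r(2) rG x(1) ab(1) by (simp add: gsimps)
    moreover have "r \<otimes> (x [^] n \<otimes> a \<otimes> inv (x [^] n)) \<in> Upart \<sigma>"
      using subgroup.m_closed[OF csubgroupD(1)[OF Upart_csubgroup] r(1) Upart_conj[OF aP]] x(1) by simp
    ultimately show ?case by blast
  qed
  \<comment> \<open>The \<sigma>'-part \<open>d\<close> of \<open>a \<otimes> x\<close> is forced
    into the \<sigma>-subgroup: by \<open>pow\<close>, the exponent \<open>rord W x\<close> brings
    \<open>a \<otimes> x\<close> into \<open>Upart \<sigma>\<close> modulo \<open>W\<close>.\<close>
  have "d \<in> Upart \<sigma>"
  proof (rule part_mem[OF cd(1) _ cd(2) _ cd(4) Upart_csubgroup])
    show "sp c \<subseteq> \<sigma>" "sp d \<inter> \<sigma> = {}" using cd(5,6) by auto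
    fix W assume W: "onormal W"
    let ?n = "rord W x"
    obtain r where r: "r \<in> Upart \<sigma>" "(a \<otimes> x) [^] ?n = r \<otimes> x [^] ?n" using pow by blast
    have "r \<in> carrier G" using r csubgroupD(3)[OF Upart_csubgroup] by blast
    then have "(c \<otimes> d) [^] ?n \<otimes> inv r \<in> W"
      unfolding cd(3)[symmetric] r(2) by (rule conj_mem(1)[OF onormalD(1)[OF W] rord_mem[OF W x(1)]])
    then show "\<exists>n>0. prime_factors n \<subseteq> \<sigma> \<and> (\<exists>e\<in>Upart \<sigma>. (c \<otimes> d) [^] n \<otimes> inv e \<in> W)"
      using rord_pos[OF W x(1)] prime_factors_rord[OF W x(1)] x(2) r(1) by blast
  qed
  then have "d = \<one>" using disjoint_sp_one[OF cd(2), of \<sigma>] cd(6) by (auto simp: Upart_def)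
  then have sax: "sp (a \<otimes> x) \<subseteq> \<sigma>" using cd by auto
  have "sp (a \<otimes> x) \<inter> sp b = {}" using sax ab(6) by blast
  then have com: "(a \<otimes> x) \<otimes> b = b \<otimes> (a \<otimes> x)" by (rule cent[OF axG abU(2)])
  have "x' = ?u \<otimes> x" using x x' by (simp add: gsimps)
  then have x'e: "x' = b \<otimes> (a \<otimes> x)" unfolding ab(3,4) using ab(1,2) x(1) by (simp add: m_assoc)
  then have "b = x' \<otimes> inv (a \<otimes> x)" using ab(1,2) x(1) by (simp add: gsimps)
  moreover have "x' \<otimes> (a \<otimes> x) = (a \<otimes> x) \<otimes> x'"
    unfolding x'e using com ab(2) axG by (simp add: m_assoc[symmetric])
  then have "inv (a \<otimes> x) \<otimes> x' = x' \<otimes> inv (a \<otimes> x)"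
    using commute_inv[OF _ axG x'(1)] by simp
  then have "sp (x' \<otimes> inv (a \<otimes> x)) \<subseteq> sp x' \<union> sp (inv (a \<otimes> x))"
    using sp_mult[OF x'(1) inv_closed[OF axG]] by simp
  ultimately have "sp b \<subseteq> \<sigma>" using sp_inv[OF axG] sax x'(2) by auto
  then have "b = \<one>" using disjoint_sp_one[OF ab(2)] ab(6) by blast
  then show ?thesis using ab(1,3,5) by simp
qed

text \<open>By \<open>coset_quotient_sp\<close> the changes are \<open>x' = u \<otimes> x\<close>
  with a \<sigma>-element \<open>u\<close> of \<open>U\<close> and \<open>y' = v \<otimes> y\<close>
  with a \<tau>-element \<open>v\<close> of \<open>U\<close>. So \<open>u\<close> commutes with
  \<open>y'\<close> and \<open>v\<close> with \<open>x\<close>, and both cancel from the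
  commutator.\<close>

lemma cm_coset:
  assumes x: "x \<in> carrier G" "sp x \<subseteq> \<sigma>" and x': "x' \<in> carrier G" "sp x' \<subseteq> \<sigma>" and xx: "x' \<otimes> inv x \<in> U"
    and y: "y \<in> carrier G" "sp y \<subseteq> \<tau>" and y': "y' \<in> carrier G" "sp y' \<subseteq> \<tau>" and yy: "y' \<otimes> inv y \<in> U"
    and st: "\<sigma> \<inter> \<tau> = {}"
  shows "cm x' y' = cm x y"
proof -
  define u where "u = x' \<otimes> inv x"
  define v where "v = y' \<otimes> inv y"
  have uv: "u \<in> U" "v \<in> U" "sp u \<subseteq> \<sigma>" "sp v \<subseteq> \<tau>"
    using xx yy coset_quotient_sp[OF x x' xx] coset_quotient_sp[OF y y' yy] by (simp_all add: u_def v_def)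
  have G: "u \<in> carrier G" "v \<in> carrier G" using UG uv by auto
  have e: "x' = u \<otimes> x" "y' = v \<otimes> y" using x x' y y' by (simp_all add: u_def v_def gsimps)
  have "sp y' \<inter> sp u = {}" "sp x \<inter> sp v = {}" using uv y'(2) x(2) st by blast+
  then have c: "y' \<otimes> u = u \<otimes> y'" "x \<otimes> v = v \<otimes> x" using cent[OF y'(1) uv(1)] cent[OF x(1) uv(2)] by simp_all
  have "inv y' \<otimes> u = u \<otimes> inv y'" by (rule commute_inv[OF c(1) y'(1) G(1)])
  then have "inv u \<otimes> (inv y' \<otimes> u) = inv y'" using G y' by (simp add: inv_mult_cancel)
  moreover have "cm x' y' = inv x \<otimes> (inv u \<otimes> (inv y' \<otimes> u)) \<otimes> x \<otimes> y'"
    unfolding cm_def e(1) using x(1) y'(1) G by (simp add: m_assoc inv_mult_group)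
  ultimately have 1: "cm x' y' = cm x y'" by (simp add: cm_def)
  have "inv v \<otimes> (x \<otimes> v) = x" unfolding c(2) using x(1) G by (simp add: inv_mult_cancel)
  moreover have "cm x y' = inv x \<otimes> inv y \<otimes> (inv v \<otimes> (x \<otimes> v)) \<otimes> y"
    unfolding cm_def e(2) using x(1) y(1) G by (simp add: m_assoc inv_mult_group)
  ultimately show ?thesis using 1 by (simp add: cm_def)
qed

lemma Upart_disjoint: "x \<in> Upart \<sigma> \<Longrightarrow> x \<in> Upart (- \<sigma>) \<Longrightarrow> x = \<one>"
  using disjoint_sp_one[OF UG, of x \<sigma>] by (auto simp: Upart_def)

lemma Upart_commute: "v \<in> Upart \<sigma> \<Longrightarrow> w \<in> Upart (- \<sigma>) \<Longrightarrow> v \<otimes> w = w \<otimes> v"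
  using cent[OF UG, of v w] by (auto simp: Upart_def)

lemma Upart_split:
  assumes u: "u \<in> U"
  shows "\<exists>v\<in>Upart \<sigma>. \<exists>w\<in>Upart (- \<sigma>). u = v \<otimes> w"
proof -
  obtain a b where ab: "a \<in> carrier G" "b \<in> carrier G" "u = a \<otimes> b" "a \<otimes> b = b \<otimes> a"
    "sp a \<subseteq> sp u \<inter> \<sigma>" "sp b \<subseteq> sp u - \<sigma>"
    using parts_exist[OF UG[OF u], of \<sigma>] by blast
  have "sp a \<inter> sp b = {}" using ab(5,6) by blast
  then have "a \<in> U" "b \<in> U"
    using part_mem_subgroup[OF ab(1,2) _ ab(4) onormal_csubgroup[OF U]] u ab(3) by simp_all
  then have "a \<in> Upart \<sigma>" "b \<in> Upart (- \<sigma>)" using ab(5,6) by (auto simp: Upart_def)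
  then show ?thesis using ab(3) by blast
qed

lemma Upart_unique:
  assumes v: "v \<in> Upart \<sigma>" "v' \<in> Upart \<sigma>" and w: "w \<in> Upart (- \<sigma>)" "w' \<in> Upart (- \<sigma>)" and eq: "v \<otimes> w = v' \<otimes> w'"
  shows "v = v'"
proof -
  note s = csubgroupD(1)[OF Upart_csubgroup]
  have G: "v \<in> carrier G" "v' \<in> carrier G" "w \<in> carrier G" "w' \<in> carrier G"
    using v w csubgroupD(3)[OF Upart_csubgroup] by blast+
  have "inv v' \<otimes> (v \<otimes> w) \<otimes> inv w = inv v' \<otimes> (v' \<otimes> w') \<otimes> inv w" by (simp add: eq)
  then have e: "inv v' \<otimes> v = w' \<otimes> inv w" using G by (simp add: gsimps)
  have "inv v' \<otimes> v \<in> Upart \<sigma>" by (rule subgroup.m_closed[OF s subgroup.m_inv_closed[OF s v(2)] v(1)])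
  moreover have "w' \<otimes> inv w \<in> Upart (- \<sigma>)" by (rule subgroup.m_closed[OF s w(2) subgroup.m_inv_closed[OF s w(1)]])
  ultimately have "inv v' \<otimes> v = \<one>" using Upart_disjoint e by simp
  then have "v' \<otimes> (inv v' \<otimes> v) = v' \<otimes> \<one>" by simp
  then show ?thesis using G by (simp add: mult_inv_cancel)
qed

text \<open>The projection of \<open>U\<close> onto the first factor of its decomposition into
  \<open>Upart \<sigma>\<close> and \<open>Upart (- \<sigma>)\<close>; it carries no information
  outside \<open>U\<close>.\<close>

definition Upt :: "nat set \<Rightarrow> 'a \<Rightarrow> 'a" where
  "Upt \<sigma> u = (SOME v. v \<in> Upart \<sigma> \<and> (\<exists>w\<in>Upart (- \<sigma>). u = v \<otimes> w))"

lemma Upt_eq: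
  assumes "v \<in> Upart \<sigma>" "w \<in> Upart (- \<sigma>)"
  shows "Upt \<sigma> (v \<otimes> w) = v"
  unfolding Upt_def
proof (rule some_equality)
  show "v \<in> Upart \<sigma> \<and> (\<exists>w'\<in>Upart (- \<sigma>). v \<otimes> w = v \<otimes> w')" using assms by blast
  fix v' assume "v' \<in> Upart \<sigma> \<and> (\<exists>w'\<in>Upart (- \<sigma>). v \<otimes> w = v' \<otimes> w')"
  then show "v' = v" using Upart_unique[OF assms(1) _ assms(2)] by blast
qed

text \<open>The projection of \<open>U \<inter> E\<close> to the \<open>\<sigma>\<close>-part of \<open>U\<close>, where \<open>E\<close> is the
  centralizer of that part, extends by transfer to a homomorphism on \<open>E\<close> (up to a power). It kills
  \<open>\<sigma>'\<close>-elements, hence \<open>a\<close>, \<open>b\<close> and \<open>a b\<close>.\<close>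
lemma torsion_part:
  assumes a: "a \<in> carrier G" "sp a \<inter> \<sigma> = {}" and b: "b \<in> carrier G" "sp b \<inter> \<sigma> = {}"
  shows "\<exists>N>0. \<forall>m v w. v \<in> Upart \<sigma> \<longrightarrow> w \<in> Upart (- \<sigma>) \<longrightarrow> (a \<otimes> b) [^] (m::nat) = v \<otimes> w \<longrightarrow> v [^] (N::nat) = \<one>"
proof -
  note sP = csubgroupD(1)[OF Upart_csubgroup]
  have PG: "v \<in> carrier G" if "v \<in> Upart \<rho>" for v \<rho> using that csubgroupD(3)[OF Upart_csubgroup] by blast
  have PU: "v \<in> U" if "v \<in> Upart \<rho>" for v \<rho> using that by (simp add: Upart_def)
  have Psub: "Upart \<sigma> \<subseteq> carrier G" using PG by blast
  define E where "E = {e \<in> carrier G. \<forall>s\<in>Upart \<sigma>. e \<otimes> s = s \<otimes> e}"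
  have sE: "subgroup E G" unfolding E_def by (rule csubgroupD(1)[OF centralizer_csubgroup[OF Psub]])
  have EG: "e \<in> carrier G" if "e \<in> E" for e using that by (simp add: E_def)
  have Ecomm: "e \<otimes> s = s \<otimes> e" if "e \<in> E" "s \<in> Upart \<sigma>" for e s using that by (simp add: E_def)
  have inE: "x \<in> E" if x: "x \<in> carrier G" "sp x \<inter> \<sigma> = {}" for x
  proof -
    have "x \<otimes> s = s \<otimes> x" if s: "s \<in> Upart \<sigma>" for s
    proof -
      have "sp x \<inter> sp s = {}" "s \<in> U" using x(2) s by (auto simp: Upart_def)
      then show ?thesis using cent[OF x(1)] by simp
    qed
    then show ?thesis using x(1) by (simp add: E_def)
  qed
  have P'E: "w \<in> E" if "w \<in> Upart (- \<sigma>)" for w using inE[OF PG[OF that]] that by (auto simp: Upart_def)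
  \<comment> \<open>\<open>A0\<close> is the centre of \<open>Upart \<sigma>\<close>, hence an
    abelian target for the transfer.\<close>
  define A0 where "A0 = Upart \<sigma> \<inter> E"
  have sA0: "subgroup A0 G" unfolding A0_def by (rule subgroups_Inter_pair[OF sP sE])
  define A where "A = G\<lparr>carrier := A0\<rparr>"
  interpret A: group A unfolding A_def by (rule subgroup_imp_group[OF sA0])
  have commA: "comm_group A"
    by (rule A.group_comm_groupI) (simp add: A_def A0_def Ecomm)
  define K where "K = G\<lparr>carrier := E\<rparr>"
  interpret K: group K unfolding K_def by (rule subgroup_imp_group[OF sE])
  define D where "D = E \<inter> U"
  have sD: "subgroup D G" unfolding D_def by (rule subgroups_Inter_pair[OF sE sU])
  have sDK: "subgroup D K" unfolding K_def by (rule subgroup_incl[OF sD sE]) (simp add: D_def)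
  have invK: "inv\<^bsub>K\<^esub> e = inv e" if "e \<in> E" for e unfolding K_def by (rule m_inv_consistent[OF sE that])
  have split: "\<exists>v\<in>A0. \<exists>w\<in>Upart (- \<sigma>). d = v \<otimes> w \<and> Upt \<sigma> d = v" if d: "d \<in> D" for d
  proof -
    obtain v w where vw: "v \<in> Upart \<sigma>" "w \<in> Upart (- \<sigma>)" "d = v \<otimes> w"
      using Upart_split[of d \<sigma>] d unfolding D_def by blast
    have "v = d \<otimes> inv w" unfolding vw(3) using PG[OF vw(1)] PG[OF vw(2)] by (simp add: m_assoc)
    then have "v \<in> E" using subgroup.m_closed[OF sE _ subgroup.m_inv_closed[OF sE P'E[OF vw(2)]]] d by (simp add: D_def)
    then show ?thesis using vw Upt_eq[OF vw(1,2)] by (auto simp: A0_def)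
  qed
  \<comment> \<open>Cosets of \<open>E \<inter> U\<close> in \<open>E\<close> inject into the cosets
    of \<open>U\<close> in \<open>G\<close>.\<close>
  have fin: "finite (rcosets\<^bsub>K\<^esub> D)"
  proof -
    have "rcosets\<^bsub>K\<^esub> D = (\<lambda>e. D #>\<^bsub>K\<^esub> e) ` E" by (auto simp: RCOSETS_def K_def)
    moreover have "finite ((\<lambda>e. D #>\<^bsub>K\<^esub> e) ` E)"
    proof (rule finite_image_factor)
      show "finite ((\<lambda>e. U #> e) ` E)"
        by (rule finite_subset[OF _ finite_rcosets[OF U]]) (use EG in \<open>auto simp: RCOSETS_def\<close>)
      fix e e' assume e: "e \<in> E" "e' \<in> E" "U #> e = U #> e'"
      then have "e \<otimes> inv e' \<in> U" using rcoset_eq_iff[OF sU EG EG] by simp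
      moreover have "e \<otimes> inv e' \<in> E" using subgroup.m_closed[OF sE e(1) subgroup.m_inv_closed[OF sE e(2)]] .
      ultimately have "e \<otimes>\<^bsub>K\<^esub> inv\<^bsub>K\<^esub> e' \<in> D" using invK[OF e(2)] by (simp add: K_def D_def)
      then show "D #>\<^bsub>K\<^esub> e = D #>\<^bsub>K\<^esub> e'" using K.rcoset_eq_iff[OF sDK, of e e'] e by (simp add: K_def)
    qed
    ultimately show ?thesis by simp
  qed
  have "\<exists>\<tau>\<in>hom K A. \<forall>d\<in>D. \<tau> d = Upt \<sigma> d [^]\<^bsub>A\<^esub> card (rcosets\<^bsub>K\<^esub> D)"
  proof (rule K.transfer_hom[OF sDK fin commA])
    fix d assume d: "d \<in> D"
    show "Upt \<sigma> d \<in> carrier A" using split[OF d] by (auto simp: A_def)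
  next
    fix d e assume de: "d \<in> D" "e \<in> D"
    obtain v w where vw: "v \<in> A0" "w \<in> Upart (- \<sigma>)" "d = v \<otimes> w" "Upt \<sigma> d = v" using split[OF de(1)] by blast
    obtain v' w' where vw': "v' \<in> A0" "w' \<in> Upart (- \<sigma>)" "e = v' \<otimes> w'" "Upt \<sigma> e = v'" using split[OF de(2)] by blast
    have vP: "v \<in> Upart \<sigma>" "v' \<in> Upart \<sigma>" using vw vw' by (simp_all add: A0_def)
    note G = PG[OF vP(1)] PG[OF vP(2)] PG[OF vw(2)] PG[OF vw'(2)]
    have "d \<otimes> e = v \<otimes> (w \<otimes> v') \<otimes> w'" unfolding vw(3) vw'(3) using G by (simp add: m_assoc)
    also have "\<dots> = (v \<otimes> v') \<otimes> (w \<otimes> w')" unfolding Upart_commute[OF vP(2) vw(2), symmetric] using G by (simp add: m_assoc)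
    finally have "Upt \<sigma> (d \<otimes> e) = v \<otimes> v'"
      using Upt_eq[OF subgroup.m_closed[OF sP vP] subgroup.m_closed[OF sP vw(2) vw'(2)]] by simp
    then show "Upt \<sigma> (d \<otimes>\<^bsub>K\<^esub> e) = Upt \<sigma> d \<otimes>\<^bsub>A\<^esub> Upt \<sigma> e" using vw(4) vw'(4) by (simp add: K_def A_def)
  next
    fix d g assume d: "d \<in> D" and "g \<in> carrier K"
    then have g: "g \<in> E" by (simp add: K_def)
    obtain v w where vw: "v \<in> A0" "w \<in> Upart (- \<sigma>)" "d = v \<otimes> w" "Upt \<sigma> d = v" using split[OF d] by blast
    have vP: "v \<in> Upart \<sigma>" using vw by (simp add: A0_def)
    note G = PG[OF vP] PG[OF vw(2)] EG[OF g]
    have "g \<otimes> d \<otimes> inv g = (g \<otimes> v \<otimes> inv g) \<otimes> (g \<otimes> w \<otimes> inv g)" unfolding vw(3) using G by (simp add: gsimps)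
    also have "g \<otimes> v \<otimes> inv g = v" unfolding Ecomm[OF g vP] using G by (simp add: m_assoc)
    finally have e: "g \<otimes> d \<otimes> inv g = v \<otimes> (g \<otimes> w \<otimes> inv g)" .
    have "g \<otimes> d \<otimes> inv g \<in> E"
      using subgroup.m_closed[OF sE subgroup.m_closed[OF sE g] subgroup.m_inv_closed[OF sE g]] d by (simp add: D_def)
    moreover have "g \<otimes> d \<otimes> inv g \<in> U" using conj_mem(1)[OF onormalD(1)[OF U] _ G(3)] d by (simp add: D_def)
    moreover have "Upt \<sigma> (g \<otimes> d \<otimes> inv g) = v" unfolding e by (rule Upt_eq[OF vP Upart_conj[OF vw(2) G(3)]])
    ultimately show "g \<otimes>\<^bsub>K\<^esub> d \<otimes>\<^bsub>K\<^esub> inv\<^bsub>K\<^esub> g \<in> D \<and> Upt \<sigma> (g \<otimes>\<^bsub>K\<^esub> d \<otimes>\<^bsub>K\<^esub> inv\<^bsub>K\<^esub> g) = Upt \<sigma> d"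
      using invK[OF g] vw(4) by (simp add: K_def D_def)
  qed
  then obtain \<tau> where \<tau>: "\<tau> \<in> hom K A" "\<And>d. d \<in> D \<Longrightarrow> \<tau> d = Upt \<sigma> d [^]\<^bsub>A\<^esub> card (rcosets\<^bsub>K\<^esub> D)" by blast
  interpret \<tau>: group_hom K A \<tau> by unfold_locales (rule \<tau>(1))
  have powK: "x [^]\<^bsub>K\<^esub> (n::nat) = x [^] n" "x [^]\<^bsub>A\<^esub> n = x [^] n" for x n
    by (simp_all add: K_def A_def nat_pow_def)
  have oneA: "\<one>\<^bsub>A\<^esub> = \<one>" by (simp add: A_def)
  \<comment> \<open>A power of \<open>x\<close> with exponent prime to \<sigma> lies in
    \<open>D\<close> and has trivial \<sigma>-part, so the image of \<open>x\<close> has an exponent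
    prime to \<sigma>. But the image is a \<sigma>-element.\<close>
  have kill: "\<tau> x = \<one>" if x: "x \<in> carrier G" "sp x \<inter> \<sigma> = {}" for x
  proof -
    let ?n = "rord U x"
    have xE: "x \<in> E" by (rule inE[OF x])
    have xn: "x [^] ?n \<in> D"
      using rord_mem[OF U x(1)] subgroup_nat_pow_closed[OF sE xE] by (simp add: D_def)
    have "sp (x [^] ?n) \<subseteq> - \<sigma>" using sp_pow[OF x(1), of ?n] x(2) by blast
    then have "x [^] ?n \<in> Upart (- \<sigma>)" using rord_mem[OF U x(1)] by (simp add: Upart_def)
    then have "Upt \<sigma> (\<one> \<otimes> x [^] ?n) = \<one>" by (rule Upt_eq[OF subgroup.one_closed[OF sP]])
    then have "\<tau> (x [^] ?n) = \<one>" using \<tau>(2)[OF xn] x(1) by (simp add: powK)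
    moreover have xK: "x \<in> carrier K" using xE by (simp add: K_def)
    ultimately have zn: "\<tau> x [^] ?n = \<one>" using \<tau>.hom_nat_pow[OF xK, of ?n] by (simp add: powK)
    have "\<tau> x \<in> A0" using \<tau>.hom_closed[OF xK] by (simp add: A_def)
    then have zP: "\<tau> x \<in> Upart \<sigma>" by (simp add: A0_def)
    have "sp (\<tau> x) \<subseteq> prime_factors ?n"
    proof (rule sp_leI[OF PG[OF zP]])
      fix W assume "onormal W"
      then show "\<exists>n>0. \<tau> x [^] n \<in> W \<and> prime_factors n \<subseteq> prime_factors ?n"
        using zn rord_pos[OF U x(1)] subgroup.one_closed[OF onormalD(2)] by (intro exI[of _ ?n]) simp
    qed
    then have "sp (\<tau> x) \<inter> \<sigma> = {}" using prime_factors_rord[OF U x(1)] x(2) by blast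
    then show ?thesis using disjoint_sp_one[OF PG[OF zP], of \<sigma>] zP by (simp add: Upart_def)
  qed
  have abK: "a \<in> carrier K" "b \<in> carrier K" using inE[OF a] inE[OF b] by (simp_all add: K_def)
  have "\<tau> (a \<otimes>\<^bsub>K\<^esub> b) = \<one>\<^bsub>A\<^esub>" using \<tau>.hom_mult[OF abK] kill[OF a] kill[OF b] by (simp add: A_def)
  then have tab: "\<tau> (a \<otimes> b) = \<one>\<^bsub>A\<^esub>" by (simp add: K_def)
  have abE: "a \<otimes> b \<in> E" by (rule subgroup.m_closed[OF sE inE[OF a] inE[OF b]])
  let ?N = "card (rcosets\<^bsub>K\<^esub> D)"
  \<comment> \<open>The transfer sends \<open>v \<otimes> w\<close> to \<open>v [^] ?N\<close> and,
    as a power of \<open>a \<otimes> b\<close>, to \<open>\<one>\<close>. The exponent does not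
    depend on \<open>m\<close>.\<close>
  have "v [^] ?N = \<one>" if v: "v \<in> Upart \<sigma>" and w: "w \<in> Upart (- \<sigma>)" and e: "(a \<otimes> b) [^] m = v \<otimes> w" for m :: nat and v w
  proof -
    have "v \<otimes> w \<in> D"
      using subgroup_nat_pow_closed[OF sE abE, of m] subgroup.m_closed[OF sU PU[OF v] PU[OF w]] e by (simp add: D_def)
    then have "\<tau> (v \<otimes> w) = v [^] ?N" using \<tau>(2)[of "v \<otimes> w"] Upt_eq[OF v w] by (simp add: powK)
    moreover have "\<tau> ((a \<otimes> b) [^]\<^bsub>K\<^esub> m) = \<tau> (a \<otimes> b) [^]\<^bsub>A\<^esub> m"
      by (rule \<tau>.hom_nat_pow) (use abE in \<open>simp add: K_def\<close>)
    then have "\<tau> ((a \<otimes> b) [^] m) = \<one>" unfolding tab A.nat_pow_one by (simp add: powK oneA)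
    ultimately show ?thesis using e by simp
  qed
  moreover have "?N > 0"
    using fin K.rcosetsI[OF subgroup.subset[OF sDK] K.one_closed] by (auto simp: card_gt_0_iff)
  ultimately show ?thesis by blast
qed

section \<open>Commutators of \<open>p\<close>-elements with \<open>p'\<close>-elements\<close>

definition pcomms :: "nat \<Rightarrow> 'a set" where
  "pcomms p = {cm x y | x y. x \<in> carrier G \<and> y \<in> carrier G \<and> sp x \<subseteq> {p} \<and> sp y \<subseteq> - {p}}"

lemma finite_pcomms: "finite (pcomms p)"
proof -
  define S where "S = {x \<in> carrier G. sp x \<subseteq> {p}} \<times> {y \<in> carrier G. sp y \<subseteq> - {p}}"
  have "pcomms p = (\<lambda>z. cm (fst z) (snd z)) ` S"
    unfolding pcomms_def S_def by force
  moreover have "finite ((\<lambda>z. cm (fst z) (snd z)) ` S)"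
  proof (rule finite_image_factor)
    show "finite ((\<lambda>z. (U #> fst z, U #> snd z)) ` S)"
      by (rule finite_subset[of _ "(rcosets U) \<times> (rcosets U)"])
        (use finite_rcosets[OF U] in \<open>auto simp: S_def RCOSETS_def\<close>)
    fix z z' assume z: "z \<in> S" "z' \<in> S" "(U #> fst z, U #> snd z) = (U #> fst z', U #> snd z')"
    have G: "fst z \<in> carrier G" "snd z \<in> carrier G" "fst z' \<in> carrier G" "snd z' \<in> carrier G"
      "sp (fst z) \<subseteq> {p}" "sp (snd z) \<subseteq> - {p}" "sp (fst z') \<subseteq> {p}" "sp (snd z') \<subseteq> - {p}"
      using z(1,2) by (auto simp: S_def)
    show "cm (fst z) (snd z) = cm (fst z') (snd z')"
    proof (rule cm_coset[OF G(3,7) G(1,5) _ G(4,8) G(2,6)])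
      show "fst z \<otimes> inv fst z' \<in> U" using rcoset_eq_iff[OF sU G(1,3)] z(3) by simp
      show "snd z \<otimes> inv snd z' \<in> U" using rcoset_eq_iff[OF sU G(2,4)] z(3) by simp
    qed simp
  qed
  ultimately show ?thesis by simp
qed

text \<open>\<open>torsion_part\<close> is used for both factorizations of \<open>c\<close>: as
  \<open>inv x\<close> times a conjugate of \<open>x\<close> it bounds the \<open>p'\<close>-part of
  a power of \<open>c\<close> lying in \<open>U\<close>, and as a conjugate of \<open>inv y\<close>
  times \<open>y\<close> it bounds the \<open>p\<close>-part.\<close>

lemma torsion_pcomms:
  assumes c: "c \<in> pcomms p"
  shows "\<exists>k>0. c [^] (k::nat) = \<one>"
proof -
  obtain x y where xy: "x \<in> carrier G" "y \<in> carrier G" "sp x \<subseteq> {p}" "sp y \<subseteq> - {p}" "c = cm x y"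
    using c unfolding pcomms_def by blast
  have cG: "c \<in> carrier G" using xy by (simp add: cm_def)
  have c1: "c = inv x \<otimes> (inv y \<otimes> x \<otimes> y)" using xy by (simp add: cm_def m_assoc)
  have c2: "c = (inv x \<otimes> inv y \<otimes> x) \<otimes> y" using xy by (simp add: cm_def m_assoc)
  have s1: "sp (inv x) \<inter> - {p} = {}" "sp (inv y \<otimes> x \<otimes> y) \<inter> - {p} = {}"
    using sp_inv[OF xy(1)] sp_conj[OF xy(1,2)] xy(3) by auto
  have s2: "sp (inv x \<otimes> inv y \<otimes> x) \<inter> {p} = {}" "sp y \<inter> {p} = {}"
    using sp_inv[OF xy(2)] sp_conj[of "inv y" x] xy(1,2,4) by auto
  obtain N1 where N1: "N1 > 0"
    "\<And>m v w. \<lbrakk>v \<in> Upart (- {p}); w \<in> Upart (- (- {p})); c [^] (m::nat) = v \<otimes> w\<rbrakk> \<Longrightarrow> v [^] (N1::nat) = \<one>"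
    using torsion_part[OF _ s1(1) _ s1(2)] xy(1,2) unfolding c1 by blast
  obtain N2 where N2: "N2 > 0"
    "\<And>m v w. \<lbrakk>v \<in> Upart {p}; w \<in> Upart (- {p}); c [^] (m::nat) = v \<otimes> w\<rbrakk> \<Longrightarrow> v [^] (N2::nat) = \<one>"
    using torsion_part[OF _ s2(1) _ s2(2)] xy(1,2) unfolding c2 by blast
  let ?m = "rord U c"
  obtain v w where vw: "v \<in> Upart {p}" "w \<in> Upart (- {p})" "c [^] ?m = v \<otimes> w"
    using Upart_split[OF rord_mem[OF U cG], of "{p}"] by blast
  have G: "v \<in> carrier G" "w \<in> carrier G" using vw csubgroupD(3)[OF Upart_csubgroup] by blast+
  have com: "v \<otimes> w = w \<otimes> v" by (rule Upart_commute[OF vw(1,2)])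
  have "v [^] N2 = \<one>" by (rule N2(2)[OF vw])
  then have "v [^] (N2 * N1) = \<one>" using nat_pow_pow[OF G(1), of N2 N1] by simp
  moreover have "w [^] N1 = \<one>" by (rule N1(2)[OF vw(2), of v ?m]) (use vw com in simp_all)
  then have "w [^] (N2 * N1) = \<one>" using nat_pow_pow[OF G(2), of N1 N2] by (simp add: mult.commute)
  ultimately have "(v \<otimes> w) [^] (N2 * N1) = \<one>"
    using pow_mult_distrib[OF com G, of "N2 * N1"] by simp
  then have "c [^] (?m * (N2 * N1)) = \<one>" using nat_pow_pow[OF cG, of ?m "N2 * N1"] vw(3) by simp
  then show ?thesis using rord_pos[OF U cG] N1(1) N2(1) by (intro exI[of _ "?m * (N2 * N1)"]) simp
qed

text \<open>Only primes of the index contribute: for any other \<open>p\<close> a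
  \<open>p\<close>-element lies in \<open>U\<close> and is centralized by
  \<open>p'\<close>-elements. Finitely many torsion elements share an exponent, as Dietzmann's lemma
  requires.\<close>

lemma ex_finite_normal:
  "\<exists>N. N \<lhd> G \<and> finite N \<and> (\<forall>p. pcomms p \<subseteq> N)"
proof -
  define F where "F = prime_factors (card (rcosets U))"
  define S where "S = (\<Union>p\<in>F. pcomms p)"
  have finS: "finite S" unfolding S_def F_def using finite_pcomms by simp
  have SG: "S \<subseteq> carrier G" by (auto simp: S_def pcomms_def cm_def)
  have conj: "g \<otimes> h \<otimes> inv g \<in> pcomms p" if h: "h \<in> pcomms p" and g: "g \<in> carrier G" for g h p
  proof -
    obtain x y where xy: "x \<in> carrier G" "y \<in> carrier G" "sp x \<subseteq> {p}" "sp y \<subseteq> - {p}" "h = cm x y"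
      using h unfolding pcomms_def by blast
    have "g \<otimes> h \<otimes> inv g = cm (g \<otimes> x \<otimes> inv g) (g \<otimes> y \<otimes> inv g)"
      unfolding xy(5) cm_def using xy(1,2) g by (simp add: gsimps)
    moreover have "sp (g \<otimes> x \<otimes> inv g) = sp x" "sp (g \<otimes> y \<otimes> inv g) = sp y"
      using sp_conj[OF xy(1), of "inv g"] sp_conj[OF xy(2), of "inv g"] g by simp_all
    moreover have "g \<otimes> x \<otimes> inv g \<in> carrier G" "g \<otimes> y \<otimes> inv g \<in> carrier G" using xy(1,2) g by simp_all
    ultimately show ?thesis unfolding pcomms_def using xy(3,4)
      by (intro CollectI exI[of _ "g \<otimes> x \<otimes> inv g"] exI[of _ "g \<otimes> y \<otimes> inv g"]) simp
  qed
  have "\<exists>k>0. \<forall>a\<in>S'. a [^] (k::nat) = \<one>" if "finite S'" "S' \<subseteq> S" for S'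
    using that
  proof (induction S' rule: finite_induct)
    case empty then show ?case by auto
  next
    case (insert a S')
    then obtain k where k: "k > 0" "\<forall>a\<in>S'. a [^] (k::nat) = \<one>" by auto
    obtain p where "a \<in> pcomms p" using insert.prems by (auto simp: S_def)
    then obtain l where l: "l > 0" "a [^] (l::nat) = \<one>" using torsion_pcomms by blast
    have aG: "a \<in> carrier G" using insert.prems SG by auto
    have "b [^] (k * l) = \<one>" if b: "b \<in> insert a S'" for b
    proof (cases "b = a")
      case True
      then show ?thesis using nat_pow_pow[OF aG, of l k] l(2) by (simp add: mult.commute)
    next
      case False
      then have "b \<in> S'" "b \<in> carrier G" using b insert.prems SG by auto
      then show ?thesis using nat_pow_pow[of b k l] k(2) by simp
    qed
    then show ?case using k(1) l(1) by (intro exI[of _ "k * l"]) simp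
  qed
  from this[OF finS subset_refl] obtain k where k: "k > 0" "\<And>a. a \<in> S \<Longrightarrow> a [^] (k::nat) = \<one>" by blast
  let ?N = "generate G S"
  have "finite ?N"
  proof (rule dietzmann[OF SG finS _ k])
    fix a b assume ab: "a \<in> S" "b \<in> S"
    then obtain p where p: "p \<in> F" "a \<in> pcomms p" by (auto simp: S_def)
    have "b \<in> carrier G" using ab SG by auto
    then have "inv b \<otimes> a \<otimes> b \<in> pcomms p" using conj[OF p(2), of "inv b"] by simp
    then show "inv b \<otimes> a \<otimes> b \<in> S" using p(1) by (auto simp: S_def)
  qed
  moreover have "?N \<lhd> G"
  proof (rule normal_generateI[OF SG])
    fix h g assume h: "h \<in> S" and g: "g \<in> carrier G"
    then obtain p where p: "p \<in> F" "h \<in> pcomms p" by (auto simp: S_def)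
    then show "g \<otimes> h \<otimes> inv g \<in> S" using conj[OF p(2) g] by (auto simp: S_def)
  qed
  moreover have "pcomms p \<subseteq> ?N" for p
  proof
    fix c assume c: "c \<in> pcomms p"
    show "c \<in> ?N"
    proof (cases "p \<in> F")
      case True then show ?thesis using c by (intro generate.incl) (auto simp: S_def)
    next
      case False
      obtain x y where xy: "x \<in> carrier G" "y \<in> carrier G" "sp x \<subseteq> {p}" "sp y \<subseteq> - {p}" "c = cm x y"
        using c unfolding pcomms_def by blast
      have "x \<in> U" using mem_onormal_if_sp_disjoint[OF U xy(1)] xy(3) False by (auto simp: F_def)
      moreover have "sp y \<inter> sp x = {}" using xy(3,4) by blast
      ultimately have "x \<otimes> y = y \<otimes> x" using cent[OF xy(2)] by simp
      then have "c = \<one>" using cm_one_iff[OF xy(1,2)] xy(5) by simp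
      then show ?thesis using generate.one by simp
    qed
  qed
  ultimately show ?thesis by blast
qed

end

section \<open>Quotients by closed normal subgroups\<close>

context profinite_group
begin

text \<open>Cosets are disjoint, so unions of families of cosets commute with binary intersections;
  hence the defining predicate is a topology and \<open>topology\<close> can be unfolded.\<close>

lemma quotient_openin:
  assumes N: "N \<lhd> G"
  shows "openin (quotient_group_topology G T N) S \<longleftrightarrow> S \<subseteq> carrier (G Mod N) \<and> openin T (\<Union>S)"
proof -
  have disj: "A = B" if "A \<in> carrier (G Mod N)" "B \<in> carrier (G Mod N)" "x \<in> A" "x \<in> B" for A B x
    using rcos_disjoint[OF normal_imp_subgroup[OF N]] that
    by (auto simp: FactGroup_def pairwise_def disjnt_def)
  have "istopology (\<lambda>S. S \<subseteq> carrier (G Mod N) \<and> openin T (\<Union>S))"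
    unfolding istopology_def
  proof (intro conjI allI impI)
    fix R S assume R: "R \<subseteq> carrier (G Mod N) \<and> openin T (\<Union>R)" and S: "S \<subseteq> carrier (G Mod N) \<and> openin T (\<Union>S)"
    have "\<Union>(R \<inter> S) = \<Union>R \<inter> \<Union>S"
    proof
      show "\<Union>R \<inter> \<Union>S \<subseteq> \<Union>(R \<inter> S)"
      proof
        fix x assume "x \<in> \<Union>R \<inter> \<Union>S"
        then obtain A B where AB: "A \<in> R" "B \<in> S" "x \<in> A" "x \<in> B" by blast
        then have "A = B" using disj[of A B x] R S by blast
        then show "x \<in> \<Union>(R \<inter> S)" using AB by blast
      qed
    qed blast
    then show "openin T (\<Union>(R \<inter> S))" using R S by (simp add: openin_Int)
    show "R \<inter> S \<subseteq> carrier (G Mod N)" using R by blast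
  next
    fix \<K> assume K: "\<forall>K\<in>\<K>. K \<subseteq> carrier (G Mod N) \<and> openin T (\<Union>K)"
    then show "\<Union>\<K> \<subseteq> carrier (G Mod N)" by blast
    have "\<Union>(\<Union>\<K>) = \<Union>((\<lambda>K. \<Union>K) ` \<K>)" by blast
    moreover have "openin T (\<Union>((\<lambda>K. \<Union>K) ` \<K>))" using K by (intro openin_Union) blast
    ultimately show "openin T (\<Union>(\<Union>\<K>))" by simp
  qed
  then show ?thesis unfolding quotient_group_topology_def by (simp add: topology_inverse')
qed

lemma quotient_mem_Union:
  assumes N: "N \<lhd> G" and S: "S \<subseteq> carrier (G Mod N)" and x: "x \<in> carrier G"
  shows "x \<in> \<Union>S \<longleftrightarrow> N #> x \<in> S"
proof
  note sN = normal_imp_subgroup[OF N]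
  assume "x \<in> \<Union>S"
  then obtain A where A: "A \<in> S" "x \<in> A" by blast
  then obtain y where y: "y \<in> carrier G" "A = N #> y" using S by (auto simp: carrier_FactGroup)
  then have "N #> y = N #> x" using repr_independence[OF _ y(1) sN, of x] A(2) by simp
  then show "N #> x \<in> S" using A y by simp
next
  assume "N #> x \<in> S"
  then show "x \<in> \<Union>S" using rcos_self[OF x normal_imp_subgroup[OF N]] by blast
qed

text \<open>Openness is expressed through representatives in \<open>G\<close>, which is the form in
  which continuity is checked below.\<close>

lemma quotient_openin_iff:
  assumes N: "N \<lhd> G"
  shows "openin (quotient_group_topology G T N) S \<longleftrightarrow> S \<subseteq> carrier (G Mod N) \<and>
    (\<forall>a\<in>carrier G. N #> a \<in> S \<longrightarrow> (\<exists>W. onormal W \<and> (\<forall>y\<in>W #> a. N #> y \<in> S)))"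
proof (cases "S \<subseteq> carrier (G Mod N)")
  case True
  note mem = quotient_mem_Union[OF N True]
  have SG: "\<Union>S \<subseteq> carrier G"
    using True rcosets_part_G[OF normal_imp_subgroup[OF N]] by (auto simp: FactGroup_def)
  have "openin T (\<Union>S) \<longleftrightarrow> (\<forall>a\<in>carrier G. a \<in> \<Union>S \<longrightarrow> (\<exists>W. onormal W \<and> W #> a \<subseteq> \<Union>S))"
  proof
    assume "openin T (\<Union>S)"
    then show "\<forall>a\<in>carrier G. a \<in> \<Union>S \<longrightarrow> (\<exists>W. onormal W \<and> W #> a \<subseteq> \<Union>S)"
      using ex_onormal_rcoset by blast
  next
    assume H: "\<forall>a\<in>carrier G. a \<in> \<Union>S \<longrightarrow> (\<exists>W. onormal W \<and> W #> a \<subseteq> \<Union>S)"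
    show "openin T (\<Union>S)"
    proof (rule openin_subopen[THEN iffD2], rule ballI)
      fix a assume a: "a \<in> \<Union>S"
      then have aG: "a \<in> carrier G" using SG by blast
      then obtain W where W: "onormal W" "W #> a \<subseteq> \<Union>S" using H a by blast
      then show "\<exists>V. openin T V \<and> a \<in> V \<and> V \<subseteq> \<Union>S"
        using openin_rcoset[OF onormalD(2,3)[OF W(1)] aG] rcos_self[OF aG onormalD(2)[OF W(1)]] by blast
    qed
  qed
  also have "\<dots> \<longleftrightarrow> (\<forall>a\<in>carrier G. N #> a \<in> S \<longrightarrow> (\<exists>W. onormal W \<and> (\<forall>y\<in>W #> a. N #> y \<in> S)))"
  proof -
    have "W #> a \<subseteq> \<Union>S \<longleftrightarrow> (\<forall>y\<in>W #> a. N #> y \<in> S)" if "onormal W" "a \<in> carrier G" for W a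
      using mem r_coset_subset_G[OF onormalD(4)[OF that(1)] that(2)] by blast
    then show ?thesis using mem by (intro ball_cong refl imp_cong ex_cong1 conj_cong) simp_all
  qed
  finally show ?thesis using True quotient_openin[OF N] by simp
next
  case False
  then show ?thesis using quotient_openin[OF N] by simp
qed

lemma quotient_topspace:
  assumes N: "N \<lhd> G"
  shows "topspace (quotient_group_topology G T N) = carrier (G Mod N)"
proof
  let ?Q = "quotient_group_topology G T N"
  show "topspace ?Q \<subseteq> carrier (G Mod N)" using openin_topspace[of ?Q] quotient_openin[OF N] by blast
  have "openin ?Q (carrier (G Mod N))"
    unfolding quotient_openin_iff[OF N]
  proof (intro conjI subset_refl ballI impI)
    fix a assume "a \<in> carrier G"
    then have "\<forall>y\<in>carrier G #> a. N #> y \<in> carrier (G Mod N)"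
      using r_coset_subset_G[OF subset_refl, of a] by (auto simp: carrier_FactGroup)
    then show "\<exists>W. onormal W \<and> (\<forall>y\<in>W #> a. N #> y \<in> carrier (G Mod N))" using onormal_carrier by blast
  qed
  then show "carrier (G Mod N) \<subseteq> topspace ?Q" by (rule openin_subset)
qed

lemma quotient_profinite:
  assumes N: "N \<lhd> G" and cl: "closedin T N"
  shows "profinite (G Mod N) (quotient_group_topology G T N)"
proof -
  define QT where "QT = quotient_group_topology G T N"
  define Q where "Q = G Mod N"
  define h where "h x = N #> x" for x
  note sN = normal_imp_subgroup[OF N]
  interpret q: group_hom G Q h
    using normal_quotient_hom[OF N] by (simp add: Q_def h_def[abs_def])
  have top: "topspace QT = carrier Q" unfolding QT_def Q_def by (rule quotient_topspace[OF N])
  have carQ: "carrier Q = h ` carrier G" by (simp add: Q_def h_def carrier_FactGroup)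
  have opI: "openin QT S" if "S \<subseteq> carrier Q" "\<And>a. a \<in> carrier G \<Longrightarrow> h a \<in> S \<Longrightarrow> \<exists>W. onormal W \<and> (\<forall>y\<in>W #> a. h y \<in> S)" for S
    unfolding QT_def quotient_openin_iff[OF N] using that by (simp add: Q_def h_def)
  have opD: "\<exists>W. onormal W \<and> (\<forall>y\<in>W #> a. h y \<in> S)" if "openin QT S" "a \<in> carrier G" "h a \<in> S" for S a
    using that unfolding QT_def quotient_openin_iff[OF N] by (simp add: h_def)
  have heq: "h x = h y \<longleftrightarrow> x \<otimes> inv y \<in> N" if "x \<in> carrier G" "y \<in> carrier G" for x y
    unfolding h_def by (rule rcoset_eq_iff[OF sN that])
  \<comment> \<open>These images of cosets are clopen and serve as basic neighbourhoods in the
    quotient.\<close>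
  define B where "B W a = h ` (W #> a)" for W a
  have cosetG: "W #> a \<subseteq> carrier G" if "onormal W" "a \<in> carrier G" for W a
    by (rule r_coset_subset_G[OF onormalD(4)[OF that(1)] that(2)])
  have cosetB: "h y \<in> B W b \<Longrightarrow> z \<in> W #> y \<Longrightarrow> h z \<in> B W b"
    if W: "onormal W" and b: "b \<in> carrier G" and y: "y \<in> carrier G" for W b y z
  proof -
    assume "h y \<in> B W b" and z: "z \<in> W #> y"
    then obtain y' where y': "y' \<in> W #> b" "h y = h y'" by (auto simp: B_def)
    have y'G: "y' \<in> carrier G" using y' cosetG[OF W b] by auto
    have zG: "z \<in> carrier G" using z cosetG[OF W y] by auto
    have w: "z \<otimes> inv y \<in> W" using z rcoset_iff[OF onormalD(2)[OF W] y zG] by simp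
    have wG: "z \<otimes> inv y \<in> carrier G" using zG y by simp
    have "y' \<otimes> inv b \<in> W" using y'(1) rcoset_iff[OF onormalD(2)[OF W] b y'G] by simp
    then have "(z \<otimes> inv y) \<otimes> (y' \<otimes> inv b) \<in> W" by (rule subgroup.m_closed[OF onormalD(2)[OF W] w])
    then have "((z \<otimes> inv y) \<otimes> y') \<otimes> inv b \<in> W" using wG y'G b by (simp add: m_assoc)
    then have "(z \<otimes> inv y) \<otimes> y' \<in> W #> b" using rcoset_iff[OF onormalD(2)[OF W] b, of "(z \<otimes> inv y) \<otimes> y'"] wG y'G by simp
    moreover have "h ((z \<otimes> inv y) \<otimes> y') = h z"
    proof -
      have "h ((z \<otimes> inv y) \<otimes> y') = h (z \<otimes> inv y) \<otimes>\<^bsub>Q\<^esub> h y" using q.hom_mult[OF wG y'G] y'(2) by simp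
      also have "\<dots> = h (z \<otimes> inv y \<otimes> y)" using q.hom_mult[OF wG y] by simp
      also have "z \<otimes> inv y \<otimes> y = z" using zG y by (simp add: m_assoc)
      finally show ?thesis .
    qed
    ultimately show "h z \<in> B W b" unfolding B_def by (metis image_eqI)
  qed
  have Bopen: "openin QT (B W a)" if W: "onormal W" and a: "a \<in> carrier G" for W a
  proof (rule opI)
    show "B W a \<subseteq> carrier Q" using cosetG[OF W a] carQ by (auto simp: B_def)
    fix y assume "y \<in> carrier G" "h y \<in> B W a"
    then show "\<exists>V. onormal V \<and> (\<forall>z\<in>V #> y. h z \<in> B W a)"
      using cosetB[OF W a] W by (intro exI[of _ W]) blast
  qed
  have Bself: "h a \<in> B W a" if "onormal W" "a \<in> carrier G" for W a
    unfolding B_def using rcos_self[OF that(2) onormalD(2)[OF that(1)]] by blast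
  have Bclosed: "closedin QT (B W a)" if W: "onormal W" and a: "a \<in> carrier G" for W a
  proof -
    have "openin QT (carrier Q - B W a)"
    proof (rule opI)
      fix y assume y: "y \<in> carrier G" "h y \<in> carrier Q - B W a"
      have "h z \<in> carrier Q - B W a" if z: "z \<in> W #> y" for z
      proof -
        have zG: "z \<in> carrier G" using z cosetG[OF W y(1)] by auto
        have "y \<in> W #> z" using z repr_independence[OF z y(1) onormalD(2)[OF W]] rcos_self[OF y(1) onormalD(2)[OF W]] by simp
        then have "h z \<notin> B W a" using cosetB[OF W a zG, of y] y(2) by blast
        then show ?thesis using zG carQ by simp
      qed
      then show "\<exists>V. onormal V \<and> (\<forall>z\<in>V #> y. h z \<in> carrier Q - B W a)"
        using W by (intro exI[of _ W]) blast
    qed simp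
    moreover have "B W a \<subseteq> carrier Q" using cosetG[OF W a] carQ by (auto simp: B_def)
    ultimately show ?thesis by (simp add: closedin_def top)
  qed
  \<comment> \<open>Closedness of \<open>N\<close> enters here: an element outside \<open>N\<close>
    has a coset of some \<open>W\<close> disjoint from \<open>N\<close>.\<close>
  have sep: "\<exists>W. onormal W \<and> h b \<notin> B W a" if a: "a \<in> carrier G" and b: "b \<in> carrier G" and ne: "h a \<noteq> h b" for a b
  proof -
    have "b \<otimes> inv a \<notin> N" using heq[OF b a] ne by simp
    then have "\<not> (\<forall>W. onormal W \<longrightarrow> (\<exists>y\<in>N. y \<otimes> inv (b \<otimes> inv a) \<in> W))"
      using closedin_memI[OF cl, of "b \<otimes> inv a"] a b by auto
    then obtain W where W: "onormal W" "\<And>y. y \<in> N \<Longrightarrow> y \<otimes> inv (b \<otimes> inv a) \<notin> W" by blast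
    have "h b \<notin> B W a"
    proof
      assume "h b \<in> B W a"
      then obtain y where y: "y \<in> W #> a" "h b = h y" by (auto simp: B_def)
      have yG: "y \<in> carrier G" using y cosetG[OF W(1) a] by auto
      have w: "y \<otimes> inv a \<in> W" using y(1) rcoset_iff[OF onormalD(2)[OF W(1)] a yG] by simp
      have n: "b \<otimes> inv y \<in> N" using heq[OF b yG] y(2) by simp
      have nG: "b \<otimes> inv y \<in> carrier G" using b yG by simp
      have "(b \<otimes> inv y) \<otimes> inv (y \<otimes> inv a) \<otimes> inv (b \<otimes> inv y) \<in> W"
        by (rule conj_mem(1)[OF onormalD(1)[OF W(1)] subgroup.m_inv_closed[OF onormalD(2)[OF W(1)] w] nG])
      moreover have "inv (b \<otimes> inv y) \<otimes> ((b \<otimes> inv y) \<otimes> inv (y \<otimes> inv a) \<otimes> inv (b \<otimes> inv y)) \<otimes> (b \<otimes> inv y) = inv (y \<otimes> inv a)"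
        using b yG a by (simp add: gsimps)
      have "(b \<otimes> inv y) \<otimes> inv (b \<otimes> inv a) = (b \<otimes> inv y) \<otimes> inv (y \<otimes> inv a) \<otimes> inv (b \<otimes> inv y)"
        using b yG a by (simp add: gsimps)
      ultimately show False using W(2)[OF n] by simp
    qed
    then show ?thesis using W(1) by blast
  qed
  have conth: "continuous_map T QT h"
    unfolding continuous_map
  proof (intro conjI allI impI)
    show "h ` topspace T \<subseteq> topspace QT" using carQ by (simp add: topsp top)
    fix S assume S: "openin QT S"
    show "openin T {x \<in> topspace T. h x \<in> S}"
    proof (rule openin_subopen[THEN iffD2], rule ballI)
      fix a assume "a \<in> {x \<in> topspace T. h x \<in> S}"
      then have a: "a \<in> carrier G" "h a \<in> S" by (simp_all add: topsp)
      obtain W where W: "onormal W" "\<forall>y\<in>W #> a. h y \<in> S" using opD[OF S a] by blast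
      then show "\<exists>V. openin T V \<and> a \<in> V \<and> V \<subseteq> {x \<in> topspace T. h x \<in> S}"
        using openin_rcoset[OF onormalD(2,3)[OF W(1)] a(1)] rcos_self[OF a(1) onormalD(2)[OF W(1)]] cosetG[OF W(1) a(1)]
        by (intro exI[of _ "W #> a"]) (auto simp: topsp)
    qed
  qed
  have cmult: "continuous_map (prod_topology QT QT) QT (\<lambda>(x, y). x \<otimes>\<^bsub>Q\<^esub> y)"
    unfolding continuous_map
  proof (intro conjI allI impI)
    show "(\<lambda>(x, y). x \<otimes>\<^bsub>Q\<^esub> y) ` topspace (prod_topology QT QT) \<subseteq> topspace QT" by (auto simp: top)
    fix S assume S: "openin QT S"
    show "openin (prod_topology QT QT) {p \<in> topspace (prod_topology QT QT). (case p of (x, y) \<Rightarrow> x \<otimes>\<^bsub>Q\<^esub> y) \<in> S}" (is "openin _ ?P")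
      unfolding openin_prod_topology_alt
    proof (intro allI impI)
      fix A C assume AC: "(A, C) \<in> ?P"
      obtain a c where a: "a \<in> carrier G" "A = h a" and c: "c \<in> carrier G" "C = h c"
        using AC carQ by (auto simp: top)
      have ac: "a \<otimes> c \<in> carrier G" using a c by simp
      have "h (a \<otimes> c) \<in> S" using AC a c by simp
      then obtain W where W: "onormal W" "\<forall>y\<in>W #> (a \<otimes> c). h y \<in> S" using opD[OF S ac] by blast
      have "B W a \<times> B W c \<subseteq> ?P"
      proof
        fix p assume "p \<in> B W a \<times> B W c"
        then obtain x y where xy: "x \<in> W #> a" "y \<in> W #> c" "p = (h x, h y)" by (auto simp: B_def)
        have G: "x \<in> carrier G" "y \<in> carrier G" using xy cosetG[OF W(1) a(1)] cosetG[OF W(1) c(1)] by auto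
        have "x \<otimes> inv a \<in> W" "y \<otimes> inv c \<in> W"
          using xy rcoset_iff[OF onormalD(2)[OF W(1)] a(1) G(1)] rcoset_iff[OF onormalD(2)[OF W(1)] c(1) G(2)] by simp_all
        then have "(x \<otimes> (y \<otimes> inv c) \<otimes> inv x) \<otimes> (x \<otimes> inv a) \<in> W"
          using subgroup.m_closed[OF onormalD(2)[OF W(1)] conj_mem(1)[OF onormalD(1)[OF W(1)] _ G(1)]] by simp
        then have "(x \<otimes> y) \<otimes> inv (a \<otimes> c) \<in> W" using G a(1) c(1) by (simp add: gsimps)
        then have "x \<otimes> y \<in> W #> (a \<otimes> c)" using rcoset_iff[OF onormalD(2)[OF W(1)] ac, of "x \<otimes> y"] G by simp
        then have "h (x \<otimes> y) \<in> S" using W(2) by blast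
        then show "p \<in> ?P" using xy(3) G by (simp add: top)
      qed
      then show "\<exists>V V'. openin QT V \<and> openin QT V' \<and> A \<in> V \<and> C \<in> V' \<and> V \<times> V' \<subseteq> ?P"
        using Bopen[OF W(1) a(1)] Bopen[OF W(1) c(1)] Bself[OF W(1) a(1)] Bself[OF W(1) c(1)] a(2) c(2)
        by (rule_tac x = "B W a" in exI, rule_tac x = "B W c" in exI) simp
    qed
  qed
  have cinv: "continuous_map QT QT (\<lambda>x. inv\<^bsub>Q\<^esub> x)"
    unfolding continuous_map
  proof (intro conjI allI impI)
    show "(\<lambda>x. inv\<^bsub>Q\<^esub> x) ` topspace QT \<subseteq> topspace QT" by (auto simp: top)
    fix S assume S: "openin QT S"
    show "openin QT {x \<in> topspace QT. inv\<^bsub>Q\<^esub> x \<in> S}"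
    proof (rule opI)
      fix a assume a: "a \<in> carrier G" "h a \<in> {x \<in> topspace QT. inv\<^bsub>Q\<^esub> x \<in> S}"
      have ia: "inv a \<in> carrier G" using a by simp
      have "h (inv a) \<in> S" using a by simp
      then obtain W where W: "onormal W" "\<forall>y\<in>W #> inv a. h y \<in> S" using opD[OF S ia] by blast
      have "h y \<in> {x \<in> topspace QT. inv\<^bsub>Q\<^esub> x \<in> S}" if y: "y \<in> W #> a" for y
      proof -
        have yG: "y \<in> carrier G" using y cosetG[OF W(1) a(1)] by auto
        have "y \<otimes> inv a \<in> W" using y rcoset_iff[OF onormalD(2)[OF W(1)] a(1) yG] by simp
        then have "inv y \<otimes> inv (y \<otimes> inv a) \<otimes> y \<in> W"
          by (intro conj_mem(2)[OF onormalD(1)[OF W(1)] _ yG] subgroup.m_inv_closed[OF onormalD(2)[OF W(1)]])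
        then have "inv y \<otimes> inv (inv a) \<in> W" using yG a(1) by (simp add: gsimps)
        then have "inv y \<in> W #> inv a" using rcoset_iff[OF onormalD(2)[OF W(1)] ia, of "inv y"] yG by simp
        then have "h (inv y) \<in> S" using W(2) by blast
        then show ?thesis using yG by (simp add: top)
      qed
      then show "\<exists>W. onormal W \<and> (\<forall>y\<in>W #> a. h y \<in> {x \<in> topspace QT. inv\<^bsub>Q\<^esub> x \<in> S})" using W(1) by blast
    qed (auto simp: top)
  qed
  \<comment> \<open>Clopen separation of points gives both the Hausdorff property and total
    disconnectedness.\<close>
  have clopen_sep: "\<exists>K. openin QT K \<and> closedin QT K \<and> A \<in> K \<and> C \<notin> K"
    if AC: "A \<in> carrier Q" "C \<in> carrier Q" "A \<noteq> C" for A C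
  proof -
    obtain a where a: "a \<in> carrier G" "A = h a" using AC(1) carQ by auto
    obtain c where c: "c \<in> carrier G" "C = h c" using AC(2) carQ by auto
    obtain W where "onormal W" "h c \<notin> B W a" using sep[OF a(1) c(1)] AC(3) a(2) c(2) by blast
    then show ?thesis using Bopen[OF _ a(1)] Bclosed[OF _ a(1)] Bself[OF _ a(1)] a(2) c(2) by blast
  qed
  have "compactin QT (h ` topspace T)" by (rule image_compactin[OF _ conth]) (use comp in \<open>simp add: compact_space_def\<close>)
  then have "compact_space QT" using carQ by (simp add: compact_space_def topsp top)
  moreover have "Hausdorff_space QT"
    unfolding Hausdorff_space_def
  proof (intro allI impI)
    fix A C assume "A \<in> topspace QT \<and> C \<in> topspace QT \<and> A \<noteq> C"
    then obtain K where K: "openin QT K" "closedin QT K" "A \<in> K" "C \<notin> K" "C \<in> topspace QT"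
      using clopen_sep[of A C] by (auto simp: top)
    then have "openin QT (topspace QT - K)" by (simp add: openin_diff)
    moreover have "disjnt K (topspace QT - K)" by (simp add: disjnt_def)
    ultimately show "\<exists>V V'. openin QT V \<and> openin QT V' \<and> A \<in> V \<and> C \<in> V' \<and> disjnt V V'" using K by blast
  qed
  moreover have "totally_disconnected_space QT"
    unfolding totally_disconnected_space_def
  proof (intro allI impI)
    fix S assume S: "connectedin QT S"
    have "A = C" if AC: "A \<in> S" "C \<in> S" for A C
    proof (rule ccontr)
      assume "A \<noteq> C"
      moreover have "A \<in> carrier Q" "C \<in> carrier Q" using S AC connectedin_subset_topspace top by blast+
      ultimately obtain K where K: "openin QT K" "closedin QT K" "A \<in> K" "C \<notin> K"
        using clopen_sep[of A C] by blast
      then show False using connectedin_clopen_cases[OF S K(2,1)] AC by (auto simp: disjnt_def)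
    qed
    then show "\<exists>a. S \<subseteq> {a}" by blast
  qed
  ultimately show ?thesis
    unfolding profinite_def topological_group_def using cmult cinv top q.H.group_axioms
    by (simp add: QT_def[symmetric] Q_def[symmetric])
qed

lemma rord_kernel_hom:
  assumes h: "group_hom G Q h" and K: "onormal (kernel G Q h)" and x: "x \<in> carrier G"
  shows "group.ord Q (h x) = rord (kernel G Q h) x"
proof -
  interpret h: group_hom G Q h by (rule h)
  have "h x [^]\<^bsub>Q\<^esub> n = \<one>\<^bsub>Q\<^esub> \<longleftrightarrow> rord (kernel G Q h) x dvd n" for n :: nat
    using pow_mem_iff[OF K x, of n] h.hom_nat_pow[OF x, of n] x by (simp add: kernel_def)
  then show ?thesis using h.H.ord_unique[OF h.hom_closed[OF x]] by blast
qed

text \<open>The double quotient is viewed as one homomorphic image of \<open>G\<close> with open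
  normal kernel, so that orders in it become values of \<open>rord\<close>.\<close>

lemma quotient_quotient_hom:
  assumes N: "N \<lhd> G" and V: "V \<lhd> (G Mod N)" "openin (quotient_group_topology G T N) V"
  defines "h \<equiv> \<lambda>x. V #>\<^bsub>G Mod N\<^esub> (N #> x)"
  shows "group_hom G (G Mod N Mod V) h"
    and "h ` carrier G = carrier (G Mod N Mod V)"
    and "kernel G (G Mod N Mod V) h = {x \<in> carrier G. N #> x \<in> V}"
    and "onormal (kernel G (G Mod N Mod V) h)"
proof -
  interpret Q: group "G Mod N" by (rule normal.factorgroup_is_group[OF N])
  interpret R: group "G Mod N Mod V" by (rule normal.factorgroup_is_group[OF V(1)])
  interpret q: group_hom G "G Mod N" "\<lambda>x. N #> x"
    using normal.r_coset_hom_Mod[OF N] group_axioms Q.group_axioms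
    by (simp add: group_hom_def group_hom_axioms_def)
  interpret r: group_hom "G Mod N" "G Mod N Mod V" "\<lambda>B. V #>\<^bsub>G Mod N\<^esub> B"
    using normal.r_coset_hom_Mod[OF V(1)] Q.group_axioms R.group_axioms
    by (simp add: group_hom_def group_hom_axioms_def)
  have "h \<in> hom G (G Mod N Mod V)"
  proof (rule homI)
    fix x assume "x \<in> carrier G"
    then show "h x \<in> carrier (G Mod N Mod V)" unfolding h_def by (intro r.hom_closed q.hom_closed)
  next
    fix x y assume xy: "x \<in> carrier G" "y \<in> carrier G"
    show "h (x \<otimes> y) = h x \<otimes>\<^bsub>G Mod N Mod V\<^esub> h y"
      unfolding h_def q.hom_mult[OF xy] by (rule r.hom_mult[OF q.hom_closed[OF xy(1)] q.hom_closed[OF xy(2)]])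
  qed
  then show hom: "group_hom G (G Mod N Mod V) h"
    using group_axioms R.group_axioms by (simp add: group_hom_def group_hom_axioms_def)
  show "h ` carrier G = carrier (G Mod N Mod V)"
    unfolding h_def by (auto simp: carrier_FactGroup image_image)
  have sV: "subgroup V (G Mod N)" by (rule normal_imp_subgroup[OF V(1)])
  have VQ: "V \<subseteq> carrier (G Mod N)" by (rule subgroup.subset[OF sV])
  show ker: "kernel G (G Mod N Mod V) h = {x \<in> carrier G. N #> x \<in> V}"
  proof -
    have "h x = V \<longleftrightarrow> N #> x \<in> V" if x: "x \<in> carrier G" for x
    proof
      have NxQ: "N #> x \<in> carrier (G Mod N)" using x by (auto simp: carrier_FactGroup)
      { assume "h x = V"
        then show "N #> x \<in> V" using Q.rcos_self[OF NxQ sV] by (simp add: h_def)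
      next
        assume "N #> x \<in> V"
        then show "h x = V" unfolding h_def by (rule Q.coset_join2[OF NxQ sV]) }
    qed
    then show ?thesis unfolding kernel_def by auto
  qed
  have "{x \<in> carrier G. N #> x \<in> V} = \<Union>V"
  proof -
    have "\<Union>V \<subseteq> carrier G" using VQ rcosets_part_G[OF normal_imp_subgroup[OF N]] by (auto simp: FactGroup_def)
    then show ?thesis using quotient_mem_Union[OF N VQ] by blast
  qed
  then have "openin T (kernel G (G Mod N Mod V) h)" using V(2) ker quotient_openin[OF N] by simp
  then show "onormal (kernel G (G Mod N Mod V) h)"
    unfolding onormal_def using group_hom.normal_kernel[OF hom] by simp
qed

lemma finite_closedin: "finite N \<Longrightarrow> N \<subseteq> carrier G \<Longrightarrow> closedin T N"
  using Hausdorff_imp_t1_space[OF haus] t1_space_closedin_finite[of T] by (simp add: topsp)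

text \<open>Since the finite \<open>N\<close> is closed, it suffices to approximate \<open>c\<close>
  modulo each \<open>W\<close>. In the nilpotent quotient of \<open>G Mod N\<close> by the image of
  \<open>W\<close> the coprime images of \<open>x\<close> and \<open>y\<close> commute, so
  \<open>c\<close> lies in the product of \<open>N\<close> and \<open>W\<close>.\<close>

lemma coprime_commutators_subset:
  assumes N: "N \<lhd> G" "finite N" and pro: "pronilpotent (G Mod N) (quotient_group_topology G T N)"
  shows "coprime_commutators G T \<subseteq> N"
proof
  note sN = normal_imp_subgroup[OF N(1)]
  have NG: "N \<subseteq> carrier G" by (rule subgroup.subset[OF sN])
  fix c assume "c \<in> coprime_commutators G T"
  then obtain x y where xy: "x \<in> carrier G" "y \<in> carrier G" "sp x \<inter> sp y = {}" "c = cm x y"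
    unfolding coprime_commutators_eq by blast
  have cG: "c \<in> carrier G" using xy by (simp add: cm_def)
  show "c \<in> N"
  proof (rule closedin_memI[OF finite_closedin[OF N(2) NG] cG])
    fix W assume W: "onormal W"
    interpret q: group_hom G "G Mod N" "\<lambda>x. N #> x"
      by (rule normal_quotient_hom[OF N(1)])
    define V where "V = (\<lambda>x. N #> x) ` W"
    have surj: "(\<lambda>x. N #> x) ` carrier G = carrier (G Mod N)" by (simp add: carrier_FactGroup)
    have "V \<lhd> (G Mod N)"
    proof (rule q.H.normal_invI)
      show "subgroup V (G Mod N)" unfolding V_def by (rule q.subgroup_img_is_subgroup[OF onormalD(2)[OF W]])
      fix A B assume A: "A \<in> carrier (G Mod N)" and B: "B \<in> V"
      obtain g where g: "g \<in> carrier G" "A = N #> g" using A surj by auto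
      obtain w where w: "w \<in> W" "B = N #> w" using B by (auto simp: V_def)
      have wG: "w \<in> carrier G" using w onormalD(4)[OF W] by auto
      have "A \<otimes>\<^bsub>G Mod N\<^esub> B \<otimes>\<^bsub>G Mod N\<^esub> inv\<^bsub>G Mod N\<^esub> A = N #> (g \<otimes> w \<otimes> inv g)"
        unfolding g(2) w(2) using q.hom_mult[of "g \<otimes> w" "inv g"] q.hom_mult[OF g(1) wG] q.hom_inv[OF g(1)] g(1) wG by simp
      then show "A \<otimes>\<^bsub>G Mod N\<^esub> B \<otimes>\<^bsub>G Mod N\<^esub> inv\<^bsub>G Mod N\<^esub> A \<in> V"
        using conj_mem(1)[OF onormalD(1)[OF W] w(1) g(1)] by (simp add: V_def)
    qed
    moreover have "openin (quotient_group_topology G T N) V"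
      unfolding quotient_openin_iff[OF N(1)]
    proof (intro conjI ballI impI)
      show "V \<subseteq> carrier (G Mod N)" using surj onormalD(4)[OF W] by (auto simp: V_def)
      fix a assume a: "a \<in> carrier G" "N #> a \<in> V"
      obtain w where w: "w \<in> W" "N #> a = N #> w" using a(2) by (auto simp: V_def)
      have wG: "w \<in> carrier G" using w onormalD(4)[OF W] by auto
      have "N #> y \<in> V" if y: "y \<in> W #> a" for y
      proof -
        have yG: "y \<in> carrier G" using y r_coset_subset_G[OF onormalD(4)[OF W] a(1)] by auto
        have u: "y \<otimes> inv a \<in> W" using y rcoset_iff[OF onormalD(2)[OF W] a(1) yG] by simp
        have uG: "y \<otimes> inv a \<in> carrier G" using yG a by simp
        have "N #> y = N #> ((y \<otimes> inv a) \<otimes> a)" using yG a by (simp add: m_assoc)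
        also have "\<dots> = N #> ((y \<otimes> inv a) \<otimes> w)" using q.hom_mult[OF uG a(1)] q.hom_mult[OF uG wG] w(2) by simp
        finally show ?thesis using subgroup.m_closed[OF onormalD(2)[OF W] u w(1)] by (simp add: V_def)
      qed
      then show "\<exists>W. onormal W \<and> (\<forall>y\<in>W #> a. N #> y \<in> V)" using W by blast
    qed
    ultimately have V: "V \<lhd> (G Mod N)" "openin (quotient_group_topology G T N) V" .
    define R where "R = G Mod N Mod V"
    define h where "h x = V #>\<^bsub>G Mod N\<^esub> (N #> x)" for x
    define K where "K = kernel G R h"
    have hom: "group_hom G R h" and Keq: "K = {x \<in> carrier G. N #> x \<in> V}" and oK: "onormal K"
      unfolding K_def R_def h_def[abs_def] using quotient_quotient_hom[OF N(1) V] by simp_all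
    interpret h: group_hom G R h by (rule hom)
    have "nilpotent_group R" using pro V unfolding pronilpotent_def R_def by blast
    moreover have "h x [^]\<^bsub>R\<^esub> rord K x = \<one>\<^bsub>R\<^esub>" "h y [^]\<^bsub>R\<^esub> rord K y = \<one>\<^bsub>R\<^esub>"
      using rord_kernel_hom[OF hom _ xy(1)] rord_kernel_hom[OF hom _ xy(2)] oK
        h.H.pow_ord_eq_1[OF h.hom_closed[OF xy(1)]] h.H.pow_ord_eq_1[OF h.hom_closed[OF xy(2)]]
      by (simp_all add: K_def)
    moreover have "coprime (rord K x) (rord K y)"
    proof (rule coprime_prime_factors[OF rord_pos[OF oK xy(1)] rord_pos[OF oK xy(2)]])
      show "prime_factors (rord K x) \<inter> prime_factors (rord K y) = {}"
        using prime_factors_rord[OF oK xy(1)] prime_factors_rord[OF oK xy(2)] xy(3) by blast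
    qed
    ultimately have com: "h x \<otimes>\<^bsub>R\<^esub> h y = h y \<otimes>\<^bsub>R\<^esub> h x"
      using h.H.nilpotent_coprime_commute[OF _ h.hom_closed[OF xy(1)] _ h.hom_closed[OF xy(2)]] by blast
    have e: "y \<otimes> x \<otimes> c = x \<otimes> y" unfolding xy(4) cm_def using xy(1,2) by (simp add: gsimps)
    have "h (y \<otimes> x) \<otimes>\<^bsub>R\<^esub> h c = h (x \<otimes> y)" using h.hom_mult[of "y \<otimes> x" c] xy(1,2) cG e by simp
    also have "\<dots> = h (y \<otimes> x)" using com xy(1,2) by simp
    finally have "h c = \<one>\<^bsub>R\<^esub>" using xy(1,2) cG by (simp del: h.hom_mult)
    then have "c \<in> K" using cG by (simp add: K_def kernel_def)
    then have "N #> c \<in> V" by (simp add: Keq)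
    then obtain w where w: "w \<in> W" "N #> c = N #> w" by (auto simp: V_def)
    have wG: "w \<in> carrier G" using w onormalD(4)[OF W] by auto
    have n: "w \<otimes> inv c \<in> N" using rcoset_eq_iff[OF sN wG cG] w(2) by simp
    \<comment> \<open>The approximating element of \<open>N\<close> is
      \<open>c \<otimes> inv w\<close>; it differs from \<open>c\<close> by a conjugate of
      \<open>inv w\<close>, which lies in \<open>W\<close>.\<close>
    have "c \<otimes> inv w \<in> N" using subgroup.m_inv_closed[OF sN n] wG cG by (simp add: gsimps)
    moreover have "inv w \<in> W" by (rule subgroup.m_inv_closed[OF onormalD(2)[OF W] w(1)])
    then have "c \<otimes> inv w \<otimes> inv c \<in> W" by (rule conj_mem(1)[OF onormalD(1)[OF W] _ cG])
    ultimately show "\<exists>z\<in>N. z \<otimes> inv c \<in> W" by blast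
  qed
qed

end

context centralized_profinite_group
begin

text \<open>Elements of coprime orders in a finite quotient \<open>R\<close> of
  \<open>G Mod N\<close> lift to \<open>a\<close> and \<open>b\<close> with disjoint
  \<open>sp\<close>. By \<open>primewise_mem\<close> it is enough that each \<open>p\<close>-element
  \<open>z\<close> with \<open>p\<close> in \<open>sp a\<close> commutes with \<open>b\<close>
  modulo the kernel, and \<open>cm z b\<close> lies in \<open>pcomms p\<close>, hence in
  \<open>N\<close>.\<close>

lemma finite_by_pronilpotent_if_centralized: "finite_by_pronilpotent G T"
proof -
  obtain N where N: "N \<lhd> G" "finite N" "\<And>p. pcomms p \<subseteq> N" using ex_finite_normal by blast
  note sN = normal_imp_subgroup[OF N(1)]
  have NG: "N \<subseteq> carrier G" by (rule subgroup.subset[OF sN])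
  have "nilpotent_group (G Mod N Mod V)" if V: "V \<lhd> (G Mod N)" "openin (quotient_group_topology G T N) V" for V
  proof -
    define R where "R = G Mod N Mod V"
    define h where "h x = V #>\<^bsub>G Mod N\<^esub> (N #> x)" for x
    define K where "K = kernel G R h"
    have hom: "group_hom G R h" and surj: "h ` carrier G = carrier R"
      and Keq: "K = {x \<in> carrier G. N #> x \<in> V}" and oK: "onormal K"
      unfolding K_def R_def h_def[abs_def] using quotient_quotient_hom[OF N(1) V] by simp_all
    interpret h: group_hom G R h by (rule hom)
    note ordR = rord_kernel_hom[OF hom oK[unfolded K_def], folded K_def]
    have NK: "N \<subseteq> K"
    proof
      fix n assume n: "n \<in> N"
      then have nG: "n \<in> carrier G" using NG by auto
      interpret Q: group "G Mod N" by (rule normal.factorgroup_is_group[OF N(1)])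
      have "N #> n = \<one>\<^bsub>G Mod N\<^esub>" using coset_join2[OF nG sN n] by simp
      then have "N #> n \<in> V" using subgroup.one_closed[OF normal_imp_subgroup[OF V(1)]] by simp
      then show "n \<in> K" using nG by (simp add: Keq)
    qed
    have hK: "h x = h y \<longleftrightarrow> x \<otimes> inv y \<in> K" if xy: "x \<in> carrier G" "y \<in> carrier G" for x y
    proof -
      have "x \<otimes> inv y \<in> K \<longleftrightarrow> h x \<otimes>\<^bsub>R\<^esub> inv\<^bsub>R\<^esub> h y = \<one>\<^bsub>R\<^esub>" using xy by (simp add: K_def kernel_def)
      also have "\<dots> \<longleftrightarrow> h x = h y"
      proof
        assume e: "h x \<otimes>\<^bsub>R\<^esub> inv\<^bsub>R\<^esub> h y = \<one>\<^bsub>R\<^esub>"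
        have "inv\<^bsub>R\<^esub> (inv\<^bsub>R\<^esub> h y) = h x" by (rule h.H.inv_equality[OF e]) (use xy in simp_all)
        then show "h x = h y" using xy by simp
      qed (use xy in simp)
      finally show ?thesis by simp
    qed
    have lift: "\<exists>a\<in>carrier G. h a = A \<and> sp a \<subseteq> prime_factors (h.H.ord A)" if A: "A \<in> carrier R" for A
    proof -
      obtain x where x: "x \<in> carrier G" "A = h x" using A surj by blast
      obtain a where a: "a \<in> carrier G" "K #> a = K #> x" "sp a \<subseteq> prime_factors (rord K x)"
        using lift_sp[OF onormal_csubgroup[OF onormal_carrier] oK x(1)] by blast
      have "a \<otimes> inv x \<in> K" using rcoset_eq_iff[OF onormalD(2)[OF oK] a(1) x(1)] a(2) by simp
      then have "h a = A" using hK[OF a(1) x(1)] x(2) by simp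
      then show ?thesis using a(1,3) ordR[OF x(1)] x(2) by auto
    qed
    have "coprime_commuting_group R"
    proof unfold_locales
      have "carrier R = (\<lambda>x. h x) ` carrier G" using surj by simp
      moreover have "finite ((\<lambda>x. h x) ` carrier G)"
      proof (rule finite_image_factor)
        show "finite ((\<lambda>x. K #> x) ` carrier G)"
          by (rule finite_subset[OF _ finite_rcosets[OF oK]]) (auto simp: RCOSETS_def)
        fix x y assume xy: "x \<in> carrier G" "y \<in> carrier G" "K #> x = K #> y"
        then show "h x = h y" using hK[OF xy(1,2)] rcoset_eq_iff[OF onormalD(2)[OF oK] xy(1,2)] by simp
      qed
      ultimately show "finite (carrier R)" by simp
    next
      fix A B assume A: "A \<in> carrier R" and B: "B \<in> carrier R"
        and disj: "prime_factors (h.H.ord A) \<inter> prime_factors (h.H.ord B) = {}"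
      obtain a where a: "a \<in> carrier G" "h a = A" "sp a \<subseteq> prime_factors (h.H.ord A)" using lift[OF A] by blast
      obtain b where b: "b \<in> carrier G" "h b = B" "sp b \<subseteq> prime_factors (h.H.ord B)" using lift[OF B] by blast
      have ab: "sp a \<inter> sp b = {}" using a(3) b(3) disj by blast
      define C where "C = {c \<in> carrier G. h c \<otimes>\<^bsub>R\<^esub> h b = h b \<otimes>\<^bsub>R\<^esub> h c}"
      \<comment> \<open>Membership in \<open>C\<close> depends only on the coset modulo the open
        kernel \<open>K\<close>; this rewriting makes \<open>C\<close> closed, as
        \<open>primewise_mem\<close> requires.\<close>
      have Crc: "C = {c \<in> carrier G. \<exists>d\<in>carrier G. K #> c = K #> d \<and> h d \<otimes>\<^bsub>R\<^esub> h b = h b \<otimes>\<^bsub>R\<^esub> h d}"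
      proof -
        have "c \<in> C" if "c \<in> carrier G" "d \<in> carrier G" "K #> c = K #> d" "h d \<otimes>\<^bsub>R\<^esub> h b = h b \<otimes>\<^bsub>R\<^esub> h d" for c d
        proof -
          have "h c = h d" using that(3) hK[OF that(1,2)] rcoset_eq_iff[OF onormalD(2)[OF oK] that(1,2)] by simp
          then show ?thesis using that(1,4) by (simp add: C_def)
        qed
        moreover have "c \<in> carrier G" "h c \<otimes>\<^bsub>R\<^esub> h b = h b \<otimes>\<^bsub>R\<^esub> h c" if "c \<in> C" for c
          using that by (simp_all add: C_def)
        ultimately show ?thesis by blast
      qed
      have hb: "h b \<in> carrier R" by (rule h.hom_closed[OF b(1)])
      have "subgroup C G"
      proof (rule subgroupI)
        show "C \<noteq> {}" using hb by (auto simp: C_def intro!: exI[of _ \<one>])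
      next
        fix x assume "x \<in> C" then show "inv x \<in> C"
          using h.H.commute_inv[OF _ _ hb, of "h x"] by (simp add: C_def)
      next
        fix x y assume "x \<in> C" "y \<in> C" then show "x \<otimes> y \<in> C"
          using h.H.commute_mult[OF _ _ _ _ hb, of "h x" "h y"] by (simp add: C_def)
      qed (auto simp: C_def)
      moreover have "closedin T C" unfolding Crc by (rule closedin_rcoset_invariant[OF oK])
      ultimately have C: "csubgroup C" by (simp add: csubgroup_def)
      have "a \<in> C"
      proof (rule primewise_mem[OF onormal_csubgroup[OF onormal_carrier] C a(1)])
        fix p z assume z: "p \<in> sp a" "z \<in> carrier G" "sp z \<subseteq> {p}"
        have "sp b \<subseteq> - {p}" using ab z(1) by blast
        then have "cm z b \<in> pcomms p" unfolding pcomms_def using z(2,3) b(1) by blast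
        then have k: "cm z b \<in> K" using N(3) NK by blast
        have cG: "cm z b \<in> carrier G" using z(2) b(1) by (simp add: cm_def)
        have hc: "h (cm z b) = \<one>\<^bsub>R\<^esub>" using k by (simp add: K_def kernel_def)
        have "h (b \<otimes> z \<otimes> cm z b) = h (z \<otimes> b)" using z(2) b(1) by (simp add: cm_def gsimps del: h.hom_mult)
        then have "h b \<otimes>\<^bsub>R\<^esub> h z = h z \<otimes>\<^bsub>R\<^esub> h b" using z(2) b(1) cG hc by simp
        then show "z \<in> C" using z(2) by (simp add: C_def)
      qed
      then show "A \<otimes>\<^bsub>R\<^esub> B = B \<otimes>\<^bsub>R\<^esub> A" using a(2) b(2) by (simp add: C_def)
    qed
    then show ?thesis unfolding R_def[symmetric] by (rule coprime_commuting_group.nilpotent)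
  qed
  then have "pronilpotent (G Mod N) (quotient_group_topology G T N)"
    unfolding pronilpotent_def using quotient_profinite[OF N(1) finite_closedin[OF N(2) NG]] by blast
  then show ?thesis unfolding finite_by_pronilpotent_def using N by blast
qed

end

theorem theorem1p1:
  fixes G :: "('a, 'b) monoid_scheme" and T :: "'a topology"
  assumes "profinite G T"
  shows "finite_by_pronilpotent G T \<longleftrightarrow>
         (card_of (coprime_commutators G T), card_of (UNIV :: real set)) \<in> ordLess"
proof
  have "group G" using assms by (simp add: profinite_def topological_group_def)
  then interpret profinite_group G T
    using assms by (simp add: profinite_group_def profinite_group_axioms_def)
  {
    assume "finite_by_pronilpotent G T"
    then obtain N where N: "N \<lhd> G" "finite N" "pronilpotent (G Mod N) (quotient_group_topology G T N)"
      unfolding finite_by_pronilpotent_def by blast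
    \<comment> \<open>More than required: the set is finite. Together with the converse this
      excludes every infinite cardinality below the continuum.\<close>
    have "finite (coprime_commutators G T)"
      by (rule finite_subset[OF coprime_commutators_subset[OF N] N(2)])
    moreover have "infinite (UNIV :: real set)" by (rule infinite_UNIV_char_0)
    ultimately show "(card_of (coprime_commutators G T), card_of (UNIV :: real set)) \<in> ordLess"
      by (simp add: finite_ordLess_infinite2)
  next
    assume "(card_of (coprime_commutators G T), card_of (UNIV :: real set)) \<in> ordLess"
    then interpret small_profinite_group G T by unfold_locales
    obtain U where "onormal U" "\<forall>x\<in>carrier G. \<forall>v\<in>U. sp x \<inter> sp v = {} \<longrightarrow> x \<otimes>\<^bsub>G\<^esub> v = v \<otimes>\<^bsub>G\<^esub> x"
      using ex_onormal_centralized by blast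
    then interpret centralized_profinite_group G T U by unfold_locales blast+
    show "finite_by_pronilpotent G T" by (rule finite_by_pronilpotent_if_centralized)
  }
qed

end
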